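(* Let $(G,H_0,\mathcal{L}_0)$ be a cut-and-project scheme and let $(G,H,\mathcal{L})$ be its extended cut-and-project scheme (with $H\subset H_0\times G_{\mathsf b}$). Then any modulation of a deformed weighted model set in $(G,H,\mathcal{L})$ is a deformed weighted model set in $(G,H,\mathcal{L})$.
   Context: LCAG means locally compact (Hausdorff) abelian group. A cut-and-project scheme (CPS) $(G,H,\mathcal{L})$ consists of LCAGs $G,H$ and a lattice (co-compact discrete subgroup) $\mathcal{L}\subset G\times H$ such that the projection $\pi^G:G\times H\to G$ is one-to-one on $\mathcal{L}$ and $\pi^H(\mathcal{L})$ is dense in $H$. With $L=\pi^G(\mathcal{L})$, for $x\in L$ let $x^\star\in H$ be the unique element with $(x,x^\star)\in\mathcal{L}$ (star map). A deformed weighted model set in $(G,H,\mathcal{L})$ is a measure of the form $\nu=\sum_{\ell\in L}f(\ell^\star)\,\delta_{\ell+p(\ell^\star)}$ with $f\in C_c(H)$ (continuous, compactly supported, complex valued) and $p\in C(H,G)$ (continuous). Extended CPS: let $G_{\mathsf b}$ be the Bohr compactification of $G$ (the dual of $\widehat G$ with the discrete topology) and $i_{\mathsf b}:G\to G_{\mathsf b}$ the canonical injective homomorphism with dense range. Given a CPS $(G,H_0,\mathcal{L}_0)$ with $L_0=\pi^G(\mathcal{L}_0)$ and star map $\star_0:L_0\to H_0$, put $\ell^\star=(\ell^{\star_0},i_{\mathsf b}(\ell))\in H_0\times G_{\mathsf b}$ for $\ell\in L_0$, $\mathcal{L}=\{(\ell,\ell^\star):\ell\in L_0\}$, and let $H$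 be the closure of $\{\ell^\star:\ell\in L_0\}$ in $H_0\times G_{\mathsf b}$. Then $(G,H,\mathcal{L})$ is a CPS, called the extended CPS of $(G,H_0,\mathcal{L}_0)$. $C_{\mathsf u}(G,K)$ denotes the uniformly continuous functions with relatively compact range from $G$ to an LCAG $K$, with the topology of uniform convergence, and $C_{\mathsf u}(G)=C_{\mathsf u}(G,\mathbb{C})$. $h\in C_{\mathsf u}(G,K)$ is almost periodic if its set of translates $\{h(\cdot-t):t\in G\}$ has compact closure in $C_{\mathsf u}(G,K)$; equivalently $h=h_{\mathsf b}\circ i_{\mathsf b}$ for some continuous $h_{\mathsf b}:G_{\mathsf b}\to K$. A modulation of a (complex Radon) measure $\nu$ on $G$ is a measure $\nu^{w,g}$ given by $\nu^{w,g}(\varphi)=\int w(x)\varphi(x+g(x))\,\mathrm{d}\nu(x)$ for $\varphi\in C_c(G)$, where $w\in C_{\mathsf u}(G)$ and $g\in C_{\mathsf u}(G,G)$ are almost periodic. *)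

theory Defs
  imports "HOL-Analysis.Analysis" "HOL-Algebra.Coset"
begin

section \<open>Locally compact abelian groups\<close>

text \<open>Groups are written multiplicatively, as in HOL-Algebra: the sum \<open>x + y\<close> of the usual additive
  notation is \<open>x \<otimes>\<^bsub>G\<^esub> y\<close>, and \<open>x - y\<close> is \<open>x \<otimes>\<^bsub>G\<^esub> inv\<^bsub>G\<^esub> y\<close>. Explicit carriers are needed because the
  internal space of the extended scheme is a closed subgroup of a product with a Bohr
  compactification.\<close>

record 'a top_group = "'a monoid" +
  gtop :: "'a topology"

locale lcag = comm_group G for G (structure) +
  assumes topspace_gtop: "topspace (gtop G) = carrier G"
    and continuous_mult: "continuous_map (prod_topology (gtop G) (gtop G)) (gtop G) (\<lambda>(x, y). x \<otimes> y)"
    and continuous_inv: "continuous_map (gtop G) (gtop G) (\<lambda>x. inv x)"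
    and Hausdorff: "Hausdorff_space (gtop G)"
    and locally_compact: "locally_compact_space (gtop G)"

definition prod_group :: "'a top_group \<Rightarrow> 'b top_group \<Rightarrow> ('a \<times> 'b) top_group" where
  "prod_group G H =
    \<lparr>carrier = carrier (G \<times>\<times> H), mult = mult (G \<times>\<times> H), one = one (G \<times>\<times> H),
     gtop = prod_topology (gtop G) (gtop H)\<rparr>"

definition sub_group :: "'a top_group \<Rightarrow> 'a set \<Rightarrow> 'a top_group" where
  "sub_group G S = G\<lparr>carrier := S, gtop := subtopology (gtop G) S\<rparr>"

definition discretization :: "'a top_group \<Rightarrow> 'a top_group" where
  "discretization G = G\<lparr>gtop := discrete_topology (carrier G)\<rparr>"

definition complex_group :: "complex top_group" where
  "complex_group = \<lparr>carrier = UNIV, mult = (+), one = 0, gtop = euclidean\<rparr>"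

definition circle_group :: "complex top_group" where
  "circle_group =
    \<lparr>carrier = {z. cmod z = 1}, mult = (*), one = 1, gtop = top_of_set {z. cmod z = 1}\<rparr>"

section \<open>Cut-and-project schemes\<close>

definition quotient_topology :: "'a top_group \<Rightarrow> 'a set \<Rightarrow> 'a set topology" where
  "quotient_topology G N =
    topology (\<lambda>\<U>. \<U> \<subseteq> rcosets\<^bsub>G\<^esub> N \<and> openin (gtop G) {x \<in> carrier G. N #>\<^bsub>G\<^esub> x \<in> \<U>})"

lemma openin_quotient_topology:
  "openin (quotient_topology G N) \<U> \<longleftrightarrow>
    \<U> \<subseteq> rcosets\<^bsub>G\<^esub> N \<and> openin (gtop G) {x \<in> carrier G. N #>\<^bsub>G\<^esub> x \<in> \<U>}"
proof -
  let ?P = "\<lambda>\<U>. \<U> \<subseteq> rcosets\<^bsub>G\<^esub> N \<and> openin (gtop G) {x \<in> carrier G. N #>\<^bsub>G\<^esub> x \<in> \<U>}"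
  have "istopology ?P"
    unfolding istopology_def
  proof (intro conjI allI impI)
    fix S T assume S: "?P S" and T: "?P T"
    have "{x \<in> carrier G. N #>\<^bsub>G\<^esub> x \<in> S \<inter> T} =
        {x \<in> carrier G. N #>\<^bsub>G\<^esub> x \<in> S} \<inter> {x \<in> carrier G. N #>\<^bsub>G\<^esub> x \<in> T}"
      by blast
    then show "openin (gtop G) {x \<in> carrier G. N #>\<^bsub>G\<^esub> x \<in> S \<inter> T}"
      using S T by (simp add: openin_Int)
    show "S \<inter> T \<subseteq> rcosets\<^bsub>G\<^esub> N" using S by blast
  next
    fix \<K> assume K: "\<forall>S\<in>\<K>. ?P S"
    have "{x \<in> carrier G. N #>\<^bsub>G\<^esub> x \<in> \<Union>\<K>} = (\<Union>S\<in>\<K>. {x \<in> carrier G. N #>\<^bsub>G\<^esub> x \<in> S})"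
      by blast
    then show "openin (gtop G) {x \<in> carrier G. N #>\<^bsub>G\<^esub> x \<in> \<Union>\<K>}"
      using K by (simp only: openin_Union ball_simps openin_clauses) blast
    show "\<Union>\<K> \<subseteq> rcosets\<^bsub>G\<^esub> N" using K by blast
  qed
  then show ?thesis by (simp add: quotient_topology_def)
qed

definition is_lattice :: "'a top_group \<Rightarrow> 'a set \<Rightarrow> bool" where
  "is_lattice G N \<longleftrightarrow>
    subgroup N G \<and>
    subtopology (gtop G) N = discrete_topology N \<and>
    compact_space (quotient_topology G N)"

definition cut_and_project_scheme :: "'a top_group \<Rightarrow> 'b top_group \<Rightarrow> ('a \<times> 'b) set \<Rightarrow> bool" where
  "cut_and_project_scheme G H \<L> \<longleftrightarrow>
    lcag G \<and> lcag H \<and> is_lattice (prod_group G H) \<L> \<and>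
    inj_on fst \<L> \<and> gtop H closure_of (snd ` \<L>) = carrier H"

definition star_map :: "('a \<times> 'b) set \<Rightarrow> 'a \<Rightarrow> 'b" where
  "star_map \<L> x = (THE y. (x, y) \<in> \<L>)"

section \<open>Bohr compactification and extended schemes\<close>

text \<open>Characters are extensional functions, so that each character has exactly one representative.
  The topology on the dual is the compact-open topology.\<close>

definition dual_group :: "'a top_group \<Rightarrow> ('a \<Rightarrow> complex) top_group" where
  "dual_group G =
    (let X = {\<xi> \<in> extensional (carrier G).
                \<xi> \<in> hom G circle_group \<and> continuous_map (gtop G) (gtop circle_group) \<xi>}
     in \<lparr>carrier = X,
         mult = (\<lambda>\<xi> \<psi>. \<lambda>x\<in>carrier G. \<xi> x * \<psi> x),
         one = (\<lambda>x\<in>carrier G. 1),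
         gtop = topology_generated_by
           {{\<xi> \<in> X. \<xi> ` K \<subseteq> U} | K U. compactin (gtop G) K \<and> openin (gtop circle_group) U}\<rparr>)"

definition bohr :: "'a top_group \<Rightarrow> (('a \<Rightarrow> complex) \<Rightarrow> complex) top_group" where
  "bohr G = dual_group (discretization (dual_group G))"

definition bohr_map :: "'a top_group \<Rightarrow> 'a \<Rightarrow> ('a \<Rightarrow> complex) \<Rightarrow> complex" where
  "bohr_map G x = (\<lambda>\<xi>\<in>carrier (dual_group G). \<xi> x)"

definition extended_star :: "'a top_group \<Rightarrow> ('a \<times> 'b) set \<Rightarrow> 'a \<Rightarrow> 'b \<times> (('a \<Rightarrow> complex) \<Rightarrow> complex)" where
  "extended_star G \<L>\<^sub>0 l = (star_map \<L>\<^sub>0 l, bohr_map G l)"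

definition extended_lattice ::
  "'a top_group \<Rightarrow> ('a \<times> 'b) set \<Rightarrow> ('a \<times> 'b \<times> (('a \<Rightarrow> complex) \<Rightarrow> complex)) set" where
  "extended_lattice G \<L>\<^sub>0 = {(l, extended_star G \<L>\<^sub>0 l) | l. l \<in> fst ` \<L>\<^sub>0}"

definition extended_internal ::
  "'a top_group \<Rightarrow> 'b top_group \<Rightarrow> ('a \<times> 'b) set \<Rightarrow> ('b \<times> (('a \<Rightarrow> complex) \<Rightarrow> complex)) top_group" where
  "extended_internal G H\<^sub>0 \<L>\<^sub>0 =
    (let P = prod_group H\<^sub>0 (bohr G)
     in sub_group P (gtop P closure_of (extended_star G \<L>\<^sub>0 ` fst ` \<L>\<^sub>0)))"

section \<open>Measures and deformed weighted model sets\<close>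

text \<open>Compactly supported functions are extended by zero outside the carrier, so that sums and scalar
  multiples of such functions are formed pointwise.\<close>

definition Cc :: "'a top_group \<Rightarrow> ('a \<Rightarrow> complex) set" where
  "Cc G = {\<phi>. continuous_map (gtop G) euclidean \<phi> \<and>
              compactin (gtop G) (gtop G closure_of {x \<in> carrier G. \<phi> x \<noteq> 0}) \<and>
              (\<forall>x. x \<notin> carrier G \<longrightarrow> \<phi> x = 0)}"

text \<open>A complex Radon measure is a linear functional on \<open>Cc G\<close> that is continuous for the inductive
  limit topology; its values outside \<open>Cc G\<close> are irrelevant.\<close>

definition radon_measure :: "'a top_group \<Rightarrow> (('a \<Rightarrow> complex) \<Rightarrow> complex) \<Rightarrow> bool" where
  "radon_measure G \<nu> \<longleftrightarrow>
    (\<forall>\<phi>\<in>Cc G. \<forall>\<psi>\<in>Cc G. \<nu> (\<lambda>x. \<phi> x + \<psi> x) = \<nu> \<phi> + \<nu> \<psi>) \<and>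
    (\<forall>c. \<forall>\<phi>\<in>Cc G. \<nu> (\<lambda>x. c * \<phi> x) = c * \<nu> \<phi>) \<and>
    (\<forall>K. compactin (gtop G) K \<longrightarrow>
      (\<exists>C. \<forall>\<phi>\<in>Cc G. (\<forall>x. x \<notin> K \<longrightarrow> \<phi> x = 0) \<longrightarrow>
        cmod (\<nu> \<phi>) \<le> C * (SUP x\<in>carrier G. cmod (\<phi> x))))"

text \<open>The weighted Dirac comb \<open>\<nu> = (\<Sum>l\<in>L. f(l\<^sup>\<star>) \<delta>(l + p(l\<^sup>\<star>)))\<close>, tested against \<open>\<phi>\<close>.\<close>

definition deformed_weighted_model_set ::
  "'a top_group \<Rightarrow> 'b top_group \<Rightarrow> ('a \<times> 'b) set \<Rightarrow> (('a \<Rightarrow> complex) \<Rightarrow> complex) \<Rightarrow> bool" where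
  "deformed_weighted_model_set G H \<L> \<nu> \<longleftrightarrow>
    radon_measure G \<nu> \<and>
    (\<exists>f p. f \<in> Cc H \<and> continuous_map (gtop H) (gtop G) p \<and>
      (\<forall>\<phi>\<in>Cc G.
        ((\<lambda>l. f (star_map \<L> l) * \<phi> (l \<otimes>\<^bsub>G\<^esub> p (star_map \<L> l))) has_sum \<nu> \<phi>) (fst ` \<L>)))"

section \<open>Almost periodic functions and modulations\<close>

definition uniformly_continuous_group_map :: "'a top_group \<Rightarrow> 'k top_group \<Rightarrow> ('a \<Rightarrow> 'k) \<Rightarrow> bool" where
  "uniformly_continuous_group_map G K h \<longleftrightarrow>
    (\<forall>V. openin (gtop K) V \<and> \<one>\<^bsub>K\<^esub> \<in> V \<longrightarrow>
      (\<exists>U. openin (gtop G) U \<and> \<one>\<^bsub>G\<^esub> \<in> U \<and>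
        (\<forall>x\<in>carrier G. \<forall>y\<in>carrier G. x \<otimes>\<^bsub>G\<^esub> inv\<^bsub>G\<^esub> y \<in> U \<longrightarrow> h x \<otimes>\<^bsub>K\<^esub> inv\<^bsub>K\<^esub> (h y) \<in> V)))"

definition Cu :: "'a top_group \<Rightarrow> 'k top_group \<Rightarrow> ('a \<Rightarrow> 'k) set" where
  "Cu G K = {h \<in> carrier G \<rightarrow>\<^sub>E carrier K.
               uniformly_continuous_group_map G K h \<and>
               compactin (gtop K) (gtop K closure_of (h ` carrier G))}"

definition Cu_topology :: "'a top_group \<Rightarrow> 'k top_group \<Rightarrow> ('a \<Rightarrow> 'k) topology" where
  "Cu_topology G K = topology (\<lambda>W. W \<subseteq> Cu G K \<and>
    (\<forall>h\<in>W. \<exists>V. openin (gtop K) V \<and> \<one>\<^bsub>K\<^esub> \<in> V \<and>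
      (\<forall>h'\<in>Cu G K. (\<forall>x\<in>carrier G. h' x \<otimes>\<^bsub>K\<^esub> inv\<^bsub>K\<^esub> (h x) \<in> V) \<longrightarrow> h' \<in> W)))"

lemma openin_Cu_topology:
  "openin (Cu_topology G K) W \<longleftrightarrow> W \<subseteq> Cu G K \<and>
    (\<forall>h\<in>W. \<exists>V. openin (gtop K) V \<and> \<one>\<^bsub>K\<^esub> \<in> V \<and>
      (\<forall>h'\<in>Cu G K. (\<forall>x\<in>carrier G. h' x \<otimes>\<^bsub>K\<^esub> inv\<^bsub>K\<^esub> (h x) \<in> V) \<longrightarrow> h' \<in> W))"
proof -
  define Q where "Q W h V \<longleftrightarrow> openin (gtop K) V \<and> \<one>\<^bsub>K\<^esub> \<in> V \<and>
      (\<forall>h'\<in>Cu G K. (\<forall>x\<in>carrier G. h' x \<otimes>\<^bsub>K\<^esub> inv\<^bsub>K\<^esub> (h x) \<in> V) \<longrightarrow> h' \<in> W)" for W h V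
  have Int: "Q (S \<inter> T) h (V \<inter> V')" if "Q S h V" "Q T h V'" for S T h V V'
    using that unfolding Q_def by (simp add: openin_Int)
  have mono: "Q T h V" if "Q S h V" "S \<subseteq> T" for S T h V
    using that unfolding Q_def by blast
  have "istopology (\<lambda>W. W \<subseteq> Cu G K \<and> (\<forall>h\<in>W. \<exists>V. Q W h V))"
    unfolding istopology_def
  proof (intro conjI allI impI)
    fix S T assume "S \<subseteq> Cu G K \<and> (\<forall>h\<in>S. \<exists>V. Q S h V)" "T \<subseteq> Cu G K \<and> (\<forall>h\<in>T. \<exists>V. Q T h V)"
    then show "S \<inter> T \<subseteq> Cu G K" "\<forall>h\<in>S \<inter> T. \<exists>V. Q (S \<inter> T) h V"
      using Int by blast+
  next
    fix \<K> assume K: "\<forall>S\<in>\<K>. S \<subseteq> Cu G K \<and> (\<forall>h\<in>S. \<exists>V. Q S h V)"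
    then show "\<Union>\<K> \<subseteq> Cu G K" by blast
    show "\<forall>h\<in>\<Union>\<K>. \<exists>V. Q (\<Union>\<K>) h V"
      using K mono by (meson Union_iff Union_upper)
  qed
  then show ?thesis by (simp add: Cu_topology_def Q_def)
qed

definition translate :: "'a top_group \<Rightarrow> 'a \<Rightarrow> ('a \<Rightarrow> 'k) \<Rightarrow> 'a \<Rightarrow> 'k" where
  "translate G t h = (\<lambda>x\<in>carrier G. h (x \<otimes>\<^bsub>G\<^esub> inv\<^bsub>G\<^esub> t))"

definition almost_periodic :: "'a top_group \<Rightarrow> 'k top_group \<Rightarrow> ('a \<Rightarrow> 'k) \<Rightarrow> bool" where
  "almost_periodic G K h \<longleftrightarrow>
    h \<in> Cu G K \<and>
    compactin (Cu_topology G K) (Cu_topology G K closure_of {translate G t h | t. t \<in> carrier G})"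

text \<open>The measure \<open>\<phi> \<mapsto> \<integral> w(x) \<phi>(x + g(x)) d\<nu>(x)\<close>; the integrand belongs to \<open>Cc G\<close> for
  \<open>w \<in> Cu G complex_group\<close> and \<open>g \<in> Cu G G\<close>.\<close>

definition modulate ::
  "'a top_group \<Rightarrow> ('a \<Rightarrow> complex) \<Rightarrow> ('a \<Rightarrow> 'a) \<Rightarrow> (('a \<Rightarrow> complex) \<Rightarrow> complex) \<Rightarrow> ('a \<Rightarrow> complex) \<Rightarrow> complex" where
  "modulate G w g \<nu> \<phi> = \<nu> (\<lambda>x. if x \<in> carrier G then w x * \<phi> (x \<otimes>\<^bsub>G\<^esub> g x) else 0)"

definition is_modulation ::
  "'a top_group \<Rightarrow> (('a \<Rightarrow> complex) \<Rightarrow> complex) \<Rightarrow> (('a \<Rightarrow> complex) \<Rightarrow> complex) \<Rightarrow> bool" where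
  "is_modulation G \<nu> \<mu> \<longleftrightarrow>
    (\<exists>w g. almost_periodic G complex_group w \<and> almost_periodic G G g \<and>
      (\<forall>\<phi>\<in>Cc G. \<mu> \<phi> = modulate G w g \<nu> \<phi>))"

end

theory Submission
  imports Defs "HOL-Algebra.Free_Abelian_Groups"
begin

text \<open>Why the theorem holds. A modulation of \<open>\<nu> = (\<Sum>l\<in>L. f(l\<^sup>\<star>) \<delta>(l + p(l\<^sup>\<star>)))\<close> evaluates \<open>w\<close> and \<open>g\<close>
  at the points \<open>l + p(l\<^sup>\<star>)\<close>. An almost periodic function on \<open>G\<close> is the restriction along
  \<open>i\<^sub>b\<close> of a continuous function on the closure of \<open>i\<^sub>b(G)\<close> in the Bohr compactification; let
  \<open>w\<^sub>b\<close> and \<open>g\<^sub>b\<close> be the extensions of \<open>w\<close> and \<open>g\<close>. The second component of \<open>l\<^sup>\<star>\<close> is \<open>i\<^sub>b(l)\<close> and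
  \<open>i\<^sub>b\<close> is a homomorphism, so \<open>i\<^sub>b(l + p(l\<^sup>\<star>)) = q(l\<^sup>\<star>)\<close> for the map
  \<open>q(h, b) = b + i\<^sub>b(p(h, b))\<close>, which is continuous on the internal space and takes its values in the
  closure of \<open>i\<^sub>b(G)\<close>. Therefore the modulated measure is again a deformed weighted model set, with
  weight \<open>f \<cdot> (w\<^sub>b \<circ> q)\<close> and displacement \<open>p + g\<^sub>b \<circ> q\<close>.

  The substance lies in the extension theorem \<open>almost_periodic_bohr_extension\<close>, because almost
  periodicity is defined by relative compactness of the set of translates. It reduces to scalar
  functions \<open>f\<close>, and for these to Bohr's theorem in the form
  \<open>almost_periods_contain_bohr_set\<close>: for each \<open>e > 0\<close> there are finitely many continuous characters
  such that every \<open>t\<close> at which they are all close to \<open>1\<close> satisfies \<open>|f(x + t) - f(x)| < e\<close> for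
  all \<open>x\<close>.

  The characters are found as follows. The seminorm \<open>D(t) = sup |f(x + t) - f(x)|\<close> is totally bounded,
  and averages over finite nets converge to an invariant mean on the bounded \<open>D\<close>-Lipschitz functions.
  If \<open>t\<close> is not an \<open>e\<close>-almost period, then \<open>v(x) = f(x + t) - f(x)\<close> is a nonzero function. Among the
  positive definite functions with value \<open>1\<close> at \<open>0\<close>, those which pair maximally with the
  autocorrelation \<open>C\<close> of \<open>v\<close> are eigenfunctions of convolution with \<open>C\<close>
  (\<open>convolution_eigenfunction\<close>). Hence they share a Lipschitz constant, form a compact face, and the
  one with the largest quadratic mean is an extreme point. An extreme positive definite function is a
  character \<open>\<xi>\<close>, and it has a Fourier coefficient against \<open>v\<close> which is bounded below in terms of \<open>e\<close>
  and the Lipschitz constant of \<open>f\<close> (\<open>fourier_coef_lower_bound\<close>). The coefficient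
  of \<open>v\<close> is \<open>\<xi>(t) - 1\<close> times the coefficient of \<open>f\<close>, so \<open>\<xi>(t)\<close> stays away from \<open>1\<close>, and by Bessel's
  inequality only finitely many characters occur as \<open>t\<close> varies.\<close>

section \<open>Finite averages of translates\<close>

definition avg :: "'g list \<Rightarrow> ('g::ab_group_add \<Rightarrow> complex) \<Rightarrow> 'g \<Rightarrow> complex" where
  "avg ts u x = (\<Sum>t\<leftarrow>ts. u (x + t)) / of_nat (length ts)"

lemma norm_sum_list_le:
  fixes f :: "'a \<Rightarrow> 'b::real_normed_vector"
  shows "(\<And>t. t \<in> set ts \<Longrightarrow> norm (f t) \<le> e) \<Longrightarrow> norm (\<Sum>t\<leftarrow>ts. f t) \<le> of_nat (length ts) * e"
proof (induction ts)
  case (Cons t ts)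
  then have "norm (f t) \<le> e" "norm (\<Sum>t\<leftarrow>ts. f t) \<le> of_nat (length ts) * e"
    by auto
  then show ?case
    using norm_triangle_ineq[of "f t" "\<Sum>t\<leftarrow>ts. f t"] by (simp add: algebra_simps)
qed simp

lemma avg_norm_le:
  assumes "ts \<noteq> []" "\<And>t. t \<in> set ts \<Longrightarrow> norm (u (x + t)) \<le> e"
  shows "norm (avg ts u x) \<le> e"
proof -
  have "norm (\<Sum>t\<leftarrow>ts. u (x + t)) \<le> of_nat (length ts) * e"
    by (rule norm_sum_list_le) (use assms in auto)
  with \<open>ts \<noteq> []\<close> show ?thesis
    by (simp add: avg_def norm_divide divide_simps mult.commute)
qed

lemma avg_add: "avg ts (\<lambda>x. u x + v x) x = avg ts u x + avg ts v x"
  by (simp add: avg_def sum_list_addf add_divide_distrib)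

lemma avg_cmult: "avg ts (\<lambda>x. c * u x) x = c * avg ts u x"
  by (simp add: avg_def sum_list_const_mult)

lemma avg_diff: "avg ts (\<lambda>x. u x - v x) x = avg ts u x - avg ts v x"
  using avg_add[of ts u "\<lambda>x. (-1) * v x" x] avg_cmult[of ts "-1" v x] by simp

lemma avg_const: "ts \<noteq> [] \<Longrightarrow> avg ts (\<lambda>x. c) x = c"
  by (simp add: avg_def sum_list_triv)

lemma avg_cnj: "avg ts (\<lambda>x. cnj (u x)) x = cnj (avg ts u x)"
proof -
  have "(\<Sum>t\<leftarrow>ts. cnj (u (x + t))) = cnj (\<Sum>t\<leftarrow>ts. u (x + t))"
    by (induction ts) auto
  then show ?thesis by (simp add: avg_def)
qed

lemma avg_shift: "avg ts (\<lambda>x. u (x + a)) x = avg ts u (x + a)"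
  by (simp add: avg_def algebra_simps)

lemma avg_dist_le:
  assumes "ts \<noteq> []" "\<And>t. t \<in> set ts \<Longrightarrow> norm (u (x + t) - v (y + t)) \<le> e"
  shows "norm (avg ts u x - avg ts v y) \<le> e"
proof -
  have "norm (avg ts (\<lambda>z. u (z + x) - v (z + y)) 0) \<le> e"
    by (rule avg_norm_le) (use assms in \<open>auto simp: add.commute\<close>)
  then show ?thesis by (simp add: avg_diff avg_shift)
qed

lemma sum_list_swap:
  "(\<Sum>s\<leftarrow>ss. \<Sum>t\<leftarrow>ts. f s t) = (\<Sum>t\<leftarrow>ts. \<Sum>s\<leftarrow>ss. f s t :: 'b::comm_monoid_add)"
  by (induction ss) (simp_all add: sum_list_addf)

lemma avg_swap:
  "avg ss (\<lambda>x. avg ts (\<lambda>y. F x y) b) a = avg ts (\<lambda>y. avg ss (\<lambda>x. F x y) a) b"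
  by (simp add: avg_def divide_inverse flip: sum_list_mult_const)
     (simp add: sum_list_swap[of _ ss] mult_ac)

lemma avg_commute: "avg ss (avg ts u) x = avg ts (avg ss u) x"
proof -
  have "avg ss (avg ts u) x = avg ss (\<lambda>a. avg ts (\<lambda>b. u (a + b)) 0) x"
    by (simp add: avg_def)
  also have "\<dots> = avg ts (\<lambda>b. avg ss (\<lambda>a. u (a + b)) x) 0"
    by (rule avg_swap)
  also have "\<dots> = avg ts (avg ss u) x"
    by (simp add: avg_def algebra_simps)
  finally show ?thesis .
qed

lemma avg_compose:
  assumes "ss \<noteq> []" "ts \<noteq> []"
  obtains us where "us \<noteq> []" "\<And>u. avg us u = avg ss (avg ts u)"
proof
  let ?us = "concat (map (\<lambda>s. map (\<lambda>t. s + t) ts) ss)"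
  show "?us \<noteq> []" using assms by (cases ss) auto
  have len: "length ?us = length ss * length ts"
    by (induction ss) auto
  have sum: "(\<Sum>t\<leftarrow>concat (map (\<lambda>s. map (\<lambda>t. s + t) ts) ss). u (x + t))
      = (\<Sum>s\<leftarrow>ss. \<Sum>t\<leftarrow>ts. u (x + s + t))" for u :: "'a \<Rightarrow> complex" and x
    by (induction ss) (auto simp: o_def add.assoc)
  show "avg ?us u = avg ss (avg ts u)" for u
    by (rule ext, simp add: avg_def sum len divide_inverse flip: sum_list_mult_const)
       (simp add: mult_ac)
qed

section \<open>The invariant mean of a totally bounded seminorm\<close>

text \<open>The typical \<open>D\<close> is \<open>t \<mapsto> sup |f(x + t) - f(x)|\<close>, where total boundedness says that \<open>f\<close> is almost
  periodic.\<close>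

locale totally_bounded_seminorm =
  fixes D :: "'g::ab_group_add \<Rightarrow> real"
  assumes D_zero: "D 0 = 0"
    and D_minus: "D (- x) = D x"
    and D_add: "D (x + y) \<le> D x + D y"
    and finite_net: "e > 0 \<Longrightarrow> \<exists>F. finite F \<and> (\<forall>x. \<exists>s\<in>F. D (x - s) < e)"
begin

lemma D_nonneg: "D x \<ge> 0"
  using D_add[of x "-x"] by (simp add: D_zero D_minus)

text \<open>Bounded Lipschitz functions. One constant serves as bound and as Lipschitz constant, so that a family
  is uniformly bounded and equicontinuous as soon as its members share \<open>L\<close>; \<open>bl\<close> forgets the constant.\<close>

definition BL :: "real \<Rightarrow> ('g \<Rightarrow> complex) \<Rightarrow> bool" where
  "BL L u \<longleftrightarrow> (\<forall>x. norm (u x) \<le> L) \<and> (\<forall>x t. norm (u (x + t) - u x) \<le> L * D t)"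

definition bl :: "('g \<Rightarrow> complex) \<Rightarrow> bool" where
  "bl u \<longleftrightarrow> (\<exists>L. BL L u)"

lemma BL_imp_bl: "BL L u \<Longrightarrow> bl u"
  by (auto simp: bl_def)

lemma BL_nonneg: "BL L u \<Longrightarrow> L \<ge> 0"
  unfolding BL_def using norm_ge_zero order_trans by blast

lemma BL_norm: "BL L u \<Longrightarrow> norm (u x) \<le> L"
  by (auto simp: BL_def)

lemma BL_lip: "BL L u \<Longrightarrow> norm (u (x + t) - u x) \<le> L * D t"
  by (auto simp: BL_def)

lemma BL_mono: "BL L u \<Longrightarrow> L \<le> L' \<Longrightarrow> BL L' u"
  unfolding BL_def using D_nonneg by (meson mult_right_mono order_trans)

lemma BL_const: "BL (norm c) (\<lambda>x. c)"
  using D_nonneg by (auto simp: BL_def)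

lemma BL_add:
  assumes "BL L u" "BL M v" shows "BL (L + M) (\<lambda>x. u x + v x)"
  unfolding BL_def
proof (intro conjI allI)
  fix x t
  show "norm (u x + v x) \<le> L + M"
    using norm_triangle_ineq[of "u x" "v x"] BL_norm[OF assms(1), of x] BL_norm[OF assms(2), of x]
    by linarith
  have "norm (u (x+t) + v (x+t) - (u x + v x)) \<le> norm (u (x+t) - u x) + norm (v (x+t) - v x)"
    by (metis add_diff_add norm_triangle_ineq)
  then show "norm (u (x+t) + v (x+t) - (u x + v x)) \<le> (L + M) * D t"
    using BL_lip[OF assms(1), of x t] BL_lip[OF assms(2), of x t] by (simp add: distrib_right)
qed

lemma BL_mult:
  assumes "BL L u" "BL M v" shows "BL (2 * L * M) (\<lambda>x. u x * v x)"
  unfolding BL_def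
proof (intro conjI allI)
  fix x t
  have L: "L \<ge> 0" "M \<ge> 0" using assms BL_nonneg by auto
  have "norm (u x) * norm (v x) \<le> L * M"
    using BL_norm[OF assms(1)] BL_norm[OF assms(2)] L by (intro mult_mono) auto
  moreover have "0 \<le> L * M" using L by simp
  ultimately show "norm (u x * v x) \<le> 2 * L * M"
    by (simp add: norm_mult)
  have "u (x+t) * v (x+t) - u x * v x = u (x+t) * (v (x+t) - v x) + (u (x+t) - u x) * v x"
    by (simp add: algebra_simps)
  then have "norm (u (x+t) * v (x+t) - u x * v x)
      \<le> norm (u (x+t)) * norm (v (x+t) - v x) + norm (u (x+t) - u x) * norm (v x)"
    by (metis norm_mult norm_triangle_ineq)
  also have "\<dots> \<le> L * (M * D t) + (L * D t) * M"
    using BL_norm[OF assms(1)] BL_norm[OF assms(2)] BL_lip[OF assms(1)] BL_lip[OF assms(2)] L D_nonneg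
    by (intro add_mono mult_mono) auto
  finally show "norm (u (x+t) * v (x+t) - u x * v x) \<le> 2 * L * M * D t"
    by (simp add: algebra_simps)
qed

lemma BL_cmult: "BL L u \<Longrightarrow> BL (norm c * L) (\<lambda>x. c * u x)"
  unfolding BL_def by (auto simp: norm_mult mult.assoc mult_left_mono simp flip: right_diff_distrib)

lemma BL_cnj: "BL L u \<Longrightarrow> BL L (\<lambda>x. cnj (u x))"
  unfolding BL_def by (auto simp flip: complex_cnj_diff)

lemma BL_shift: "BL L u \<Longrightarrow> BL L (\<lambda>x. u (x + a))"
  unfolding BL_def by (metis add.assoc add.commute)

lemma BL_reflect:
  assumes "BL L u" shows "BL L (\<lambda>x. u (a - x))"
proof -
  have "norm (u (a - (x + t)) - u (a - x)) \<le> L * D t" for x t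
    using BL_lip[OF assms, of "a - x" "- t"] by (simp add: D_minus algebra_simps)
  then show ?thesis using BL_norm[OF assms] by (auto simp: BL_def)
qed

lemma bl_const: "bl (\<lambda>x. c)"
  unfolding bl_def by (rule exI, rule BL_const)

lemma bl_add: "bl u \<Longrightarrow> bl v \<Longrightarrow> bl (\<lambda>x. u x + v x)"
  unfolding bl_def by (elim exE, rule exI, rule BL_add)

lemma bl_mult: "bl u \<Longrightarrow> bl v \<Longrightarrow> bl (\<lambda>x. u x * v x)"
  unfolding bl_def by (elim exE, rule exI, rule BL_mult)

lemma bl_cnj: "bl u \<Longrightarrow> bl (\<lambda>x. cnj (u x))"
  unfolding bl_def by (elim exE, rule exI, rule BL_cnj)

lemma bl_shift: "bl u \<Longrightarrow> bl (\<lambda>x. u (x + a))"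
  unfolding bl_def by (elim exE, rule exI, rule BL_shift)

lemma bl_shift_diff: "bl u \<Longrightarrow> bl (\<lambda>x. u (x - a))"
  using bl_shift[of u "- a"] by simp

lemma bl_reflect: "bl u \<Longrightarrow> bl (\<lambda>x. u (a - x))"
  unfolding bl_def by (elim exE, rule exI, rule BL_reflect)

lemma bl_uminus_arg: "bl u \<Longrightarrow> bl (\<lambda>x. u (- x))"
  using bl_reflect[of u 0] by simp

lemma bl_cmult: "bl u \<Longrightarrow> bl (\<lambda>x. c * u x)"
  by (intro bl_mult bl_const)

lemma bl_diff: "bl u \<Longrightarrow> bl v \<Longrightarrow> bl (\<lambda>x. u x - v x)"
  using bl_add[of u "\<lambda>x. (-1) * v x"] bl_cmult[of v "-1"] by simp

lemma bl_sum_list: "(\<And>i. i \<in> set xs \<Longrightarrow> bl (f i)) \<Longrightarrow> bl (\<lambda>x. \<Sum>i\<leftarrow>xs. f i x)"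
  by (induction xs) (auto intro: bl_const bl_add)

lemma BL_avg:
  assumes "BL L u" "ts \<noteq> []" shows "BL L (avg ts u)"
  unfolding BL_def
proof (intro conjI allI)
  fix x t
  show "norm (avg ts u x) \<le> L"
    by (rule avg_norm_le) (use assms BL_norm in auto)
  show "norm (avg ts u (x + t) - avg ts u x) \<le> L * D t"
  proof (rule avg_dist_le[OF assms(2)])
    fix s
    show "norm (u (x + t + s) - u (x + s)) \<le> L * D t"
      using BL_lip[OF assms(1), of "x + s" t] by (simp add: algebra_simps)
  qed
qed

lemma norm_sum_diff_le:
  fixes a b :: "nat \<Rightarrow> complex"
  assumes "finite I" "finite J" "card I = card J" "\<And>i j. i \<in> I \<Longrightarrow> j \<in> J \<Longrightarrow> norm (a i - b j) \<le> r"
  shows "norm (sum a I - sum b J) \<le> real (card I) * r"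
proof -
  obtain h where h: "bij_betw h I J"
    using assms finite_same_card_bij by blast
  have "sum a I - sum b J = (\<Sum>i\<in>I. a i - b (h i))"
    by (simp add: sum_subtractf sum.reindex_bij_betw[OF h])
  moreover have "norm (\<Sum>i\<in>I. a i - b (h i)) \<le> (\<Sum>i\<in>I. r)"
    by (rule sum_norm_le) (use assms h in \<open>auto simp: bij_betw_def\<close>)
  ultimately show ?thesis by simp
qed

text \<open>Averaging over a finite net shrinks the oscillation by a fixed factor: among the translates that enter
  the average at \<open>x\<close> and at \<open>y\<close>, one pair of points is \<open>d\<close>-close, so that this pair contributes only the
  modulus of continuity, while the remaining terms are compared at the cost of the oscillation \<open>r\<close>.\<close>

lemma avg_contract:
  assumes ts: "ts \<noteq> []" and net: "\<And>x. \<exists>s\<in>set ts. D (x - s) < d"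
    and osc: "\<And>x y. norm (u x - u y) \<le> r"
    and md: "\<And>x t. D t < d \<Longrightarrow> norm (u (x + t) - u x) \<le> e"
  shows "norm (avg ts u x - avg ts u y) \<le> (1 - 1 / length ts) * r + e / length ts"
proof -
  define n where "n = length ts"
  have n: "n > 0" using ts by (simp add: n_def)
  define a where "a = (\<lambda>i. u (x + ts ! i))"
  define b where "b = (\<lambda>i. u (y + ts ! i))"
  obtain j where j: "j < n" "D (x + ts ! 0 - y - ts ! j) < d"
    using net[of "x + ts ! 0 - y"] by (metis in_set_conv_nth n_def)
  have "norm (a 0 - b j) \<le> e"
    using md[OF j(2), of "y + ts ! j"] by (simp add: a_def b_def algebra_simps)
  moreover have "norm (sum a ({..<n} - {0}) - sum b ({..<n} - {j})) \<le> real (card ({..<n} - {0})) * r"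
    by (rule norm_sum_diff_le) (use j n osc in \<open>auto simp: a_def b_def\<close>)
  moreover have "sum a {..<n} - sum b {..<n} = (a 0 - b j) + (sum a ({..<n} - {0}) - sum b ({..<n} - {j}))"
    using j n by (simp add: sum_diff1)
  ultimately have "norm (sum a {..<n} - sum b {..<n}) \<le> e + (real n - 1) * r"
    using norm_triangle_ineq[of "a 0 - b j" "sum a ({..<n} - {0}) - sum b ({..<n} - {j})"] n
    by (simp add: of_nat_diff)
  moreover have "avg ts u x - avg ts u y = (sum a {..<n} - sum b {..<n}) / of_nat n"
    by (simp add: avg_def a_def b_def n_def sum_list_sum_nth diff_divide_distrib atLeast0LessThan)
  ultimately have "norm (avg ts u x - avg ts u y) \<le> (e + (real n - 1) * r) / n"
    using n by (simp add: norm_divide divide_right_mono)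
  also have "\<dots> = (1 - 1 / n) * r + e / n"
    using n by (simp add: field_simps)
  finally show ?thesis by (simp add: n_def)
qed

text \<open>Iterating the contraction brings the oscillation down to the modulus of continuity at the scale of the
  net. The number of iterations depends only on the net and on \<open>k\<close>, so a single list serves all
  Lipschitz functions at once; this uniformity is what later permits the interchange of means.\<close>

lemma averaging_list_exists:
  "\<exists>ts. ts \<noteq> [] \<and> (\<forall>L u x y. BL L u \<longrightarrow> norm (avg ts u x - avg ts u y) \<le> 3 * L / real (Suc k))"
proof -
  define d where "d = 1 / real (Suc k)"
  have "d > 0" by (simp add: d_def)
  then obtain F where F: "finite F" "\<And>x. \<exists>s\<in>F. D (x - s) < d"
    using finite_net by meson
  obtain ts0 where ts0: "set ts0 = F" using F(1) finite_list by auto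
  have ne: "ts0 \<noteq> []" using F(2)[of 0] ts0 by auto
  define q where "q = 1 - 1 / real (length ts0)"
  have q: "0 \<le> q" "q < 1" using ne by (auto simp: q_def divide_simps Suc_le_eq)
  have step: "\<exists>ts. ts \<noteq> [] \<and> (\<forall>L u x y. BL L u \<longrightarrow> norm (avg ts u x - avg ts u y) \<le> q ^ j * (2 * L) + d * L)" for j
  proof (induction j)
    case 0
    have "norm (avg [0] u x - avg [0] u y) \<le> q ^ 0 * (2 * L) + d * L" if "BL L u" for L u x y
      using norm_triangle_ineq4[of "u x" "u y"] BL_norm[OF that, of x] BL_norm[OF that, of y]
        mult_nonneg_nonneg[OF less_imp_le[OF \<open>d > 0\<close>] BL_nonneg[OF that]]
      by (simp add: avg_def)
    then show ?case by blast
  next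
    case (Suc j)
    then obtain ts where ts: "ts \<noteq> []"
      "\<And>L u x y. BL L u \<Longrightarrow> norm (avg ts u x - avg ts u y) \<le> q ^ j * (2 * L) + d * L" by blast
    obtain us where us: "us \<noteq> []" "\<And>u. avg us u = avg ts0 (avg ts u)"
      using avg_compose[OF ne ts(1)] by blast
    have "norm (avg us u x - avg us u y) \<le> q ^ Suc j * (2 * L) + d * L" if u: "BL L u" for L u x y
    proof -
      have "norm (avg ts0 (avg ts u) x - avg ts0 (avg ts u) y)
          \<le> (1 - 1 / length ts0) * (q ^ j * (2 * L) + d * L) + (d * L) / length ts0"
      proof (rule avg_contract[OF ne, of d])
        show "\<exists>s\<in>set ts0. D (x - s) < d" for x using F(2) ts0 by blast
        show "norm (avg ts u x - avg ts u y) \<le> q ^ j * (2 * L) + d * L" for x y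
          using ts(2)[OF u] .
        show "norm (avg ts u (x + t) - avg ts u x) \<le> d * L" if "D t < d" for x t
          using BL_lip[OF BL_avg[OF u ts(1)], of x t] that
            mult_left_mono[OF less_imp_le[OF that] BL_nonneg[OF u]]
          by (simp add: mult.commute)
      qed
      also have "\<dots> = q ^ Suc j * (2 * L) + d * L"
        by (simp add: q_def[symmetric]) (simp add: q_def algebra_simps)
      finally show ?thesis by (simp add: us)
    qed
    with us(1) show ?case by blast
  qed
  obtain j where j: "q ^ j < d" using real_arch_pow_inv[of d q] \<open>d > 0\<close> q by auto
  obtain ts where ts: "ts \<noteq> []"
      "\<And>L u x y. BL L u \<Longrightarrow> norm (avg ts u x - avg ts u y) \<le> q ^ j * (2 * L) + d * L"
    using step by blast
  have "norm (avg ts u x - avg ts u y) \<le> 3 * L / real (Suc k)" if "BL L u" for L u x y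
  proof -
    have "q ^ j * (2 * L) \<le> d * (2 * L)"
      using j BL_nonneg[OF that] by (intro mult_right_mono) auto
    then have "norm (avg ts u x - avg ts u y) \<le> 3 * (d * L)"
      using ts(2)[OF that, of x y] by linarith
    then show ?thesis by (simp add: d_def)
  qed
  with ts(1) show ?thesis by blast
qed

definition averaging_list :: "nat \<Rightarrow> 'g list" where
  "averaging_list k = (SOME ts. ts \<noteq> [] \<and>
    (\<forall>L u x y. BL L u \<longrightarrow> norm (avg ts u x - avg ts u y) \<le> 3 * L / real (Suc k)))"

text \<open>The constant to which the averages of a Lipschitz function converge uniformly. It plays the part of
  the Haar integral on the compact group obtained by completing with respect to \<open>D\<close>.\<close>

definition mean :: "('g \<Rightarrow> complex) \<Rightarrow> complex" where
  "mean u = lim (\<lambda>k. avg (averaging_list k) u 0)"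

lemma averaging_list: "averaging_list k \<noteq> []"
  "BL L u \<Longrightarrow> norm (avg (averaging_list k) u x - avg (averaging_list k) u y) \<le> 3 * L / real (Suc k)"
  using someI_ex[OF averaging_list_exists[of k]] unfolding averaging_list_def[symmetric] by blast+

text \<open>Both averages are compared with the average over both lists, which is formed in either order because
  the group is commutative.\<close>

lemma averaging_list_diff:
  assumes "BL L u"
  shows "norm (avg (averaging_list k) u x - avg (averaging_list l) u y) \<le> 3 * L / real (Suc k) + 3 * L / real (Suc l)"
proof -
  have A: "norm (avg (averaging_list l) (avg (averaging_list k) u) 0 - avg (averaging_list k) u x) \<le> 3 * L / real (Suc k)"
    using avg_dist_le[OF averaging_list(1)[of l], of "avg (averaging_list k) u" 0 "\<lambda>z. avg (averaging_list k) u x"  0] averaging_list(2)[OF assms]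
    by (simp add: avg_const averaging_list)
  have B: "norm (avg (averaging_list k) (avg (averaging_list l) u) 0 - avg (averaging_list l) u y) \<le> 3 * L / real (Suc l)"
    using avg_dist_le[OF averaging_list(1)[of k], of "avg (averaging_list l) u" 0 "\<lambda>z. avg (averaging_list l) u y"  0] averaging_list(2)[OF assms]
    by (simp add: avg_const averaging_list)
  show ?thesis
    by (rule norm_diff_triangle_le[OF A[unfolded norm_minus_commute[of _ "avg (averaging_list k) u x"]]])
       (use B avg_commute[of "averaging_list k" "averaging_list l" u 0] in simp)
qed

lemma tendsto_rate: "(\<lambda>k. c / real (Suc k)) \<longlonglongrightarrow> 0"
  by (rule LIMSEQ_Suc) (rule lim_const_over_n)

lemma mean_tendsto:
  assumes "BL L u" shows "(\<lambda>k. avg (averaging_list k) u x) \<longlonglongrightarrow> mean u"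
proof -
  have "Cauchy (\<lambda>k. avg (averaging_list k) u 0)"
  proof (rule CauchyI)
    fix e :: real assume "e > 0"
    then obtain N where N: "\<And>k. k \<ge> N \<Longrightarrow> 3 * L / real (Suc k) < e / 2"
      using order_tendstoD(2)[OF tendsto_rate[of "3 * L"], of "e / 2"]
      by (auto simp: eventually_sequentially)
    have "norm (avg (averaging_list m) u 0 - avg (averaging_list n) u 0) < e" if "m \<ge> N" "n \<ge> N"
      for m n
      using le_less_trans[OF averaging_list_diff[OF assms] add_strict_mono[OF N[OF that(1)] N[OF that(2)]]]
      by simp
    then show "\<exists>M. \<forall>m\<ge>M. \<forall>n\<ge>M. norm (avg (averaging_list m) u 0 - avg (averaging_list n) u 0) < e"
      by blast
  qed
  then have lim: "(\<lambda>k. avg (averaging_list k) u 0) \<longlonglongrightarrow> mean u"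
    using Cauchy_convergent convergent_LIMSEQ_iff mean_def by metis
  have "(\<lambda>k. avg (averaging_list k) u x - avg (averaging_list k) u 0) \<longlonglongrightarrow> 0"
    by (rule Lim_null_comparison[OF _ tendsto_rate[of "3 * L"]]) (use averaging_list(2)[OF assms] in auto)
  from tendsto_add[OF this lim] show ?thesis by simp
qed

lemma mean_rate:
  assumes "BL L u" shows "norm (avg (averaging_list k) u x - mean u) \<le> 3 * L / real (Suc k)"
proof (rule tendsto_le[OF sequentially_bot])
  show "(\<lambda>l. norm (avg (averaging_list k) u x - avg (averaging_list l) u 0)) \<longlonglongrightarrow> norm (avg (averaging_list k) u x - mean u)"
    by (intro tendsto_intros mean_tendsto[OF assms])
  show "(\<lambda>l. 3 * L / real (Suc k) + 3 * L / real (Suc l)) \<longlonglongrightarrow> 3 * L / real (Suc k)"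
    using tendsto_add[OF tendsto_const tendsto_rate, of "3 * L / real (Suc k)" "3 * L"] by simp
qed (use averaging_list_diff[OF assms] in auto)

lemma mean_lim: "bl u \<Longrightarrow> (\<lambda>k. avg (averaging_list k) u x) \<longlonglongrightarrow> mean u"
  using mean_tendsto by (auto simp: bl_def)

lemma mean_unique: "(\<lambda>k. avg (averaging_list k) u 0) \<longlonglongrightarrow> m \<Longrightarrow> mean u = m"
  unfolding mean_def by (rule limI)

lemma mean_add: "bl u \<Longrightarrow> bl v \<Longrightarrow> mean (\<lambda>x. u x + v x) = mean u + mean v"
  by (rule mean_unique) (simp add: avg_add mean_lim tendsto_add)

lemma mean_diff: "bl u \<Longrightarrow> bl v \<Longrightarrow> mean (\<lambda>x. u x - v x) = mean u - mean v"
  by (rule mean_unique) (simp add: avg_diff mean_lim tendsto_diff)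

lemma mean_cmult: "bl u \<Longrightarrow> mean (\<lambda>x. c * u x) = c * mean u"
  by (rule mean_unique) (simp add: avg_cmult mean_lim tendsto_mult)

lemma mean_cnj: "bl u \<Longrightarrow> mean (\<lambda>x. cnj (u x)) = cnj (mean u)"
  by (rule mean_unique) (simp add: avg_cnj mean_lim tendsto_cnj)

lemma mean_const: "mean (\<lambda>x. c) = c"
  by (rule mean_unique) (simp add: avg_const averaging_list)

lemma mean_shift: "bl u \<Longrightarrow> mean (\<lambda>x. u (x + a)) = mean u"
  by (rule mean_unique) (simp add: avg_shift mean_lim)

lemma mean_sum_list:
  "(\<And>i. i \<in> set xs \<Longrightarrow> bl (f i)) \<Longrightarrow> mean (\<lambda>x. \<Sum>i\<leftarrow>xs. f i x) = (\<Sum>i\<leftarrow>xs. mean (f i))"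
  by (induction xs) (auto simp: mean_const mean_add bl_sum_list)

lemma mean_norm_le:
  assumes "bl u" "\<And>x. norm (u x) \<le> b" shows "norm (mean u) \<le> b"
  by (rule tendsto_upperbound[OF tendsto_norm[OF mean_lim[OF assms(1), of 0]]])
     (intro always_eventually allI avg_norm_le[OF averaging_list(1)] assms(2), simp)

lemma mean_Re_nonneg:
  assumes "bl u" "\<And>x. Re (u x) \<ge> 0" shows "Re (mean u) \<ge> 0"
proof (rule tendsto_lowerbound[OF tendsto_Re[OF mean_lim[OF assms(1)]]])
  have "Re (\<Sum>t\<leftarrow>ts. u (0 + t)) \<ge> 0" for ts
    using assms(2) by (induction ts) auto
  then show "\<forall>\<^sub>F k in sequentially. 0 \<le> Re (avg (averaging_list k) u 0)"
    by (intro always_eventually allI) (simp add: avg_def)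
qed simp

lemma BL_mean:
  assumes "\<And>x. BL L (F x)" "\<And>y. BL L (\<lambda>x. F x y)"
  shows "BL L (\<lambda>x. mean (F x))"
  unfolding BL_def
proof (intro conjI allI)
  fix x t
  show "norm (mean (F x)) \<le> L"
    by (rule mean_norm_le) (rule BL_imp_bl[OF assms(1)] BL_norm[OF assms(1)])+
  have "mean (F (x + t)) - mean (F x) = mean (\<lambda>y. F (x + t) y - F x y)"
    by (rule mean_diff[symmetric]) (rule BL_imp_bl[OF assms(1)])+
  moreover have "norm (mean (\<lambda>y. F (x + t) y - F x y)) \<le> L * D t"
    by (rule mean_norm_le) (rule bl_diff BL_imp_bl[OF assms(1)] BL_lip[OF assms(2)])+
  ultimately show "norm (mean (F (x + t)) - mean (F x)) \<le> L * D t" by simp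
qed

text \<open>Since the rate of convergence depends only on the Lipschitz constant, the inner average may be replaced
  by the inner mean uniformly in the outer variable. Fubini's theorem for the mean follows, because
  finite averages commute.\<close>

lemma mean_iterated_lim:
  assumes 1: "\<And>x. BL L (F x)" and 2: "\<And>y. BL L (\<lambda>x. F x y)"
  shows "(\<lambda>k. avg (averaging_list k) (\<lambda>x. avg (averaging_list k) (F x) 0) 0) \<longlonglongrightarrow> mean (\<lambda>x. mean (F x))"
proof -
  let ?a = "\<lambda>k. avg (averaging_list k) (\<lambda>x. mean (F x)) 0"
  let ?m = "\<lambda>k. avg (averaging_list k) (\<lambda>x. avg (averaging_list k) (F x) 0) 0"
  have "norm (?m k - ?a k) \<le> 3 * L / real (Suc k)" for k
    by (rule avg_dist_le[OF averaging_list(1)]) (use mean_rate[OF 1] in auto)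
  then have "(\<lambda>k. ?m k - ?a k) \<longlonglongrightarrow> 0"
    by (intro Lim_null_comparison[OF always_eventually tendsto_rate] allI)
  moreover have "?a \<longlonglongrightarrow> mean (\<lambda>x. mean (F x))"
    by (rule mean_lim) (rule BL_imp_bl[OF BL_mean[OF 1 2]])
  ultimately show ?thesis
    using tendsto_add[of "\<lambda>k. ?m k - ?a k" 0 sequentially ?a] by simp
qed

lemma mean_swap:
  assumes "\<And>x. BL L (F x)" and "\<And>y. BL L (\<lambda>x. F x y)"
  shows "mean (\<lambda>x. mean (F x)) = mean (\<lambda>y. mean (\<lambda>x. F x y))"
  using mean_iterated_lim[OF assms] mean_iterated_lim[OF assms(2,1)]
  by (subst (asm) (2) avg_swap) (rule LIMSEQ_unique)

text \<open>Average \<open>u (y - x)\<close> over both variables: the mean over \<open>y\<close> is the mean of \<open>u\<close>, the mean over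
  \<open>x\<close> is that of the reflected function.\<close>

lemma mean_reflect:
  assumes "bl u" shows "mean (\<lambda>x. u (- x)) = mean u"
proof -
  obtain L where L: "BL L u" using assms by (auto simp: bl_def)
  have "mean (\<lambda>x. mean (\<lambda>y. u (y - x))) = mean (\<lambda>y. mean (\<lambda>x. u (y - x)))"
    by (rule mean_swap) (use BL_shift[OF L, of "- _"] BL_reflect[OF L] in auto)
  moreover have "mean (\<lambda>y. u (y - x)) = mean u" for x
    using mean_shift[OF assms, of "- x"] by simp
  moreover have "mean (\<lambda>x. u (y - x)) = mean (\<lambda>x. u (- x))" for y
    using mean_shift[OF bl_uminus_arg[OF assms], of "- y"] by simp
  ultimately show ?thesis by (simp add: mean_const)
qed

end

section \<open>Positive definite functions\<close>

text \<open>Finitely supported measures are represented by lists of pairs (point, coefficient). Points may repeat,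
  so the sum of two measures is the concatenation of the lists.\<close>

definition hermitian_form :: "('g::ab_group_add \<Rightarrow> complex) \<Rightarrow> ('g \<times> complex) list \<Rightarrow> ('g \<times> complex) list \<Rightarrow> complex" where
  "hermitian_form \<phi> xs ys = (\<Sum>p\<leftarrow>xs. \<Sum>q\<leftarrow>ys. snd p * cnj (snd q) * \<phi> (fst p - fst q))"

text \<open>Hermitian symmetry is included, since positivity is required only for the real part of the form.\<close>

definition positive_definite :: "('g::ab_group_add \<Rightarrow> complex) \<Rightarrow> bool" where
  "positive_definite \<phi> \<longleftrightarrow> (\<forall>x. \<phi> (- x) = cnj (\<phi> x)) \<and> (\<forall>xs. 0 \<le> Re (hermitian_form \<phi> xs xs))"

lemma hermitian_form_append_left: "hermitian_form \<phi> (xs @ ys) zs = hermitian_form \<phi> xs zs + hermitian_form \<phi> ys zs"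
  by (simp add: hermitian_form_def)

lemma hermitian_form_append_right: "hermitian_form \<phi> zs (xs @ ys) = hermitian_form \<phi> zs xs + hermitian_form \<phi> zs ys"
  by (simp add: hermitian_form_def sum_list_addf)

lemma cnj_sum_list: "cnj (\<Sum>x\<leftarrow>xs. f x) = (\<Sum>x\<leftarrow>xs. cnj (f x))"
  by (induction xs) auto

lemma hermitian_form_cnj:
  assumes "positive_definite \<phi>" shows "hermitian_form \<phi> ys xs = cnj (hermitian_form \<phi> xs ys)"
proof -
  have "cnj (\<phi> (a - b)) = \<phi> (b - a)" for a b
    using assms by (metis minus_diff_eq positive_definite_def)
  then show ?thesis
    unfolding hermitian_form_def cnj_sum_list by (subst sum_list_swap) (simp add: mult_ac)
qed

lemma pd_hermitian: "positive_definite \<phi> \<Longrightarrow> \<phi> (- x) = cnj (\<phi> x)"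
  by (simp add: positive_definite_def)

lemma pd_form_nonneg: "positive_definite \<phi> \<Longrightarrow> 0 \<le> Re (hermitian_form \<phi> xs xs)"
  by (simp add: positive_definite_def)

lemma pd_zero_real: "positive_definite \<phi> \<Longrightarrow> Im (\<phi> 0) = 0"
  using pd_hermitian[of \<phi> 0] by (auto simp: complex_eq_iff)

lemma pd_zero_eq: "positive_definite \<phi> \<Longrightarrow> \<phi> 0 = of_real (Re (\<phi> 0))"
  using pd_zero_real by (simp add: complex_eq_iff)

text \<open>Evaluate the form at a two-point measure whose coefficient at \<open>x\<close> rotates \<open>\<phi> x\<close> to the negative
  real axis.\<close>

lemma pd_norm_le:
  assumes "positive_definite \<phi>" shows "norm (\<phi> x) \<le> Re (\<phi> 0)"
proof -
  define w where "w = (if \<phi> x = 0 then 1 else - cnj (\<phi> x) / norm (\<phi> x))"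
  have "norm w = 1" by (simp add: w_def norm_divide)
  then have w: "w * cnj w = 1" "w * \<phi> x = - norm (\<phi> x)"
    using complex_norm_square[of w] complex_norm_square[of "\<phi> x"]
    by (auto simp: w_def power2_eq_square divide_simps mult.commute)
  have "hermitian_form \<phi> [(x, w), (0, 1)] [(x, w), (0, 1)] =
      (w * cnj w) * \<phi> 0 + w * \<phi> x + (cnj (w * \<phi> x) + \<phi> 0)"
    using pd_hermitian[OF assms, of x] by (simp add: hermitian_form_def)
  then have "Re (hermitian_form \<phi> [(x, w), (0, 1)] [(x, w), (0, 1)]) = 2 * Re (\<phi> 0) - 2 * norm (\<phi> x)"
    unfolding w by simp
  with pd_form_nonneg[OF assms, of "[(x, w), (0, 1)]"] show ?thesis by simp
qed

lemma pd_scale: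
  assumes "positive_definite \<phi>" "r \<ge> 0" shows "positive_definite (\<lambda>x. of_real r * \<phi> x)"
proof -
  have "hermitian_form (\<lambda>x. of_real r * \<phi> x) xs xs = of_real r * hermitian_form \<phi> xs xs" for xs
    unfolding hermitian_form_def sum_list_const_mult[symmetric] by (simp add: mult_ac)
  then show ?thesis
    using assms by (simp add: positive_definite_def)
qed

text \<open>If \<open>\<phi>\<close> is the Fourier transform of a measure, then the new function corresponds to the
  density \<open>|1 + c \<chi>(a)|\<^sup>2\<close> (in the variable \<open>\<chi>\<close>). Its form at a measure \<open>m\<close> is the form of \<open>\<phi>\<close> at \<open>m\<close>
  plus \<open>c\<close> times the translate of \<open>m\<close> by \<open>a\<close>. These tilts are used to test whether \<open>\<phi>\<close> is extreme.\<close>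

lemma pd_tilt:
  assumes "positive_definite \<phi>"
  shows "positive_definite (\<lambda>x. (1 + c * cnj c) * \<phi> x + c * \<phi> (x + a) + cnj c * \<phi> (x - a))" (is "positive_definite ?\<psi>")
  unfolding positive_definite_def
proof (intro conjI allI)
  show "?\<psi> (- x) = cnj (?\<psi> x)" for x
  proof -
    have "- x + a = - (x - a)" "- x - a = - (x + a)" by simp_all
    then show ?thesis
      by (simp only: pd_hermitian[OF assms] complex_cnj_add complex_cnj_mult complex_cnj_cnj
          complex_cnj_one) (simp add: algebra_simps)
  qed
  fix xs
  let ?ys = "map (\<lambda>p. (fst p + a, c * snd p)) xs"
  have "hermitian_form ?\<psi> xs xs = hermitian_form \<phi> (xs @ ?ys) (xs @ ?ys)"
    unfolding hermitian_form_append_left hermitian_form_append_right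
    by (simp add: hermitian_form_def o_def algebra_simps flip: sum_list_addf)
  then show "0 \<le> Re (hermitian_form ?\<psi> xs xs)"
    using pd_form_nonneg[OF assms] by simp
qed

context totally_bounded_seminorm
begin

lemma kernel_BL:
  assumes "BL M u" "BL M' v" "BL N \<phi>"
  shows "BL (2 * M * M' * N) (\<lambda>t. u s * v t * \<phi> (s - t))"
    and "BL (2 * M * M' * N) (\<lambda>s. u s * v t * \<phi> (s - t))"
proof -
  have ge: "M \<ge> 0" "M' \<ge> 0" "N \<ge> 0" using assms BL_nonneg by auto
  have "BL (norm (u s) * (2 * M' * N)) (\<lambda>t. u s * (v t * \<phi> (s - t)))"
    by (intro BL_cmult BL_mult BL_reflect assms)
  moreover have "norm (u s) * (2 * M' * N) \<le> M * (2 * M' * N)"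
    using BL_norm[OF assms(1)] ge by (intro mult_right_mono) auto
  ultimately show "BL (2 * M * M' * N) (\<lambda>t. u s * v t * \<phi> (s - t))"
    by (auto intro: BL_mono simp: mult_ac)
  have "BL (norm (v t) * (2 * M * N)) (\<lambda>s. v t * (u s * \<phi> (s + (- t))))"
    by (intro BL_cmult BL_mult BL_shift assms)
  moreover have "norm (v t) * (2 * M * N) \<le> M' * (2 * M * N)"
    using BL_norm[OF assms(2)] ge by (intro mult_right_mono) auto
  ultimately show "BL (2 * M * M' * N) (\<lambda>s. u s * v t * \<phi> (s - t))"
    by (auto intro: BL_mono simp: mult_ac)
qed

text \<open>The form of \<open>\<phi>\<close>, evaluated at the sum of a finitely supported measure \<open>\<kappa>\<close> and of the density \<open>u\<close>, is
  nonnegative: approximate the density by the finite measures with mass \<open>u t / n\<close> at the points \<open>t\<close> of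
  the averaging lists.\<close>

lemma pd_mean_form:
  assumes pd: "positive_definite \<phi>" and "bl \<phi>" "bl u"
  shows "0 \<le> Re (hermitian_form \<phi> \<kappa> \<kappa>) + 2 * Re (\<Sum>p\<leftarrow>\<kappa>. cnj (snd p) * mean (\<lambda>z. u z * \<phi> (z - fst p)))
    + Re (mean (\<lambda>s. mean (\<lambda>t. u s * cnj (u t) * \<phi> (s - t))))"
proof -
  obtain M N where BL: "BL M u" "BL N \<phi>" using assms by (auto simp: bl_def)
  define us where "us k = map (\<lambda>t. (t, u t / of_nat (length (averaging_list k)))) (averaging_list k)" for k
  define A where "A k = (\<Sum>p\<leftarrow>\<kappa>. cnj (snd p) * avg (averaging_list k) (\<lambda>z. u z * \<phi> (z - fst p)) 0)"
    for k
  define B where "B k = avg (averaging_list k) (\<lambda>s. avg (averaging_list k) (\<lambda>t. u s * cnj (u t) * \<phi> (s - t)) 0) 0" for k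
  have A: "hermitian_form \<phi> (us k) \<kappa> = A k" for k
    unfolding hermitian_form_def us_def A_def avg_def
    by (simp add: o_def divide_inverse mult_ac flip: sum_list_mult_const sum_list_const_mult)
       (subst sum_list_swap, simp)
  have B: "hermitian_form \<phi> (us k) (us k) = B k" for k
    unfolding hermitian_form_def us_def B_def avg_def
    by (simp add: o_def divide_inverse mult_ac flip: sum_list_mult_const sum_list_const_mult)
  have ge: "0 \<le> Re (hermitian_form \<phi> \<kappa> \<kappa>) + 2 * Re (A k) + Re (B k)" for k
    using pd_form_nonneg[OF pd, of "\<kappa> @ us k"] hermitian_form_cnj[OF pd, of \<kappa> "us k"]
    by (simp add: hermitian_form_append_left hermitian_form_append_right A B)
  have limA: "A \<longlonglongrightarrow> (\<Sum>p\<leftarrow>\<kappa>. cnj (snd p) * mean (\<lambda>z. u z * \<phi> (z - fst p)))"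
    unfolding A_def
  proof (induction \<kappa>)
    case (Cons p \<kappa>)
    show ?case
      by (simp, intro tendsto_add tendsto_mult tendsto_const Cons mean_lim bl_mult bl_shift_diff assms)
  qed simp
  have limB: "B \<longlonglongrightarrow> mean (\<lambda>s. mean (\<lambda>t. u s * cnj (u t) * \<phi> (s - t)))"
    unfolding B_def by (rule mean_iterated_lim) (rule kernel_BL[OF BL(1) BL_cnj[OF BL(1)] BL(2)])+
  have "(\<lambda>k. Re (hermitian_form \<phi> \<kappa> \<kappa>) + 2 * Re (A k) + Re (B k)) \<longlonglongrightarrow>
      Re (hermitian_form \<phi> \<kappa> \<kappa>) + 2 * Re (\<Sum>p\<leftarrow>\<kappa>. cnj (snd p) * mean (\<lambda>z. u z * \<phi> (z - fst p)))
      + Re (mean (\<lambda>s. mean (\<lambda>t. u s * cnj (u t) * \<phi> (s - t))))"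
    by (intro tendsto_intros limA limB)
  then show ?thesis
    by (rule tendsto_lowerbound) (use ge in auto)
qed

definition convolution :: "('g \<Rightarrow> complex) \<Rightarrow> ('g \<Rightarrow> complex) \<Rightarrow> 'g \<Rightarrow> complex" where
  "convolution u \<phi> x = mean (\<lambda>y. u y * \<phi> (x - y))"

text \<open>In spectral terms the autocorrelation of \<open>v\<close> has the squared moduli of the Fourier coefficients of
  \<open>v\<close> as its coefficients.\<close>

definition autocorr :: "('g \<Rightarrow> complex) \<Rightarrow> 'g \<Rightarrow> complex" where
  "autocorr v x = mean (\<lambda>z. v (z + x) * cnj (v z))"

lemma autocorr_integrand_BL:
  assumes "BL L v"
  shows "BL (2 * L * L) (\<lambda>z. v (z + x) * cnj (v z))" "BL (2 * L * L) (\<lambda>x. v (z + x) * cnj (v z))"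
proof -
  show "BL (2 * L * L) (\<lambda>z. v (z + x) * cnj (v z))"
    by (intro BL_mult BL_cnj BL_shift assms)
  have "BL (norm (cnj (v z)) * L) (\<lambda>x. cnj (v z) * v (x + z))"
    by (intro BL_cmult BL_shift assms)
  moreover have "norm (v z) * L \<le> 2 * L * L"
    using mult_right_mono[OF BL_norm[OF assms, of z] BL_nonneg[OF assms]]
      mult_nonneg_nonneg[OF BL_nonneg[OF assms] BL_nonneg[OF assms]] by linarith
  ultimately show "BL (2 * L * L) (\<lambda>x. v (z + x) * cnj (v z))"
    by (auto intro: BL_mono simp: mult.commute add.commute)
qed

lemma BL_autocorr: "BL L v \<Longrightarrow> BL (2 * L * L) (autocorr v)"
  unfolding autocorr_def[abs_def] by (intro BL_mean autocorr_integrand_BL)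

lemma autocorr_diff:
  assumes "bl v" shows "autocorr v (s - t) = mean (\<lambda>z. v (z + s) * cnj (v (z + t)))"
proof -
  have "mean (\<lambda>z. v ((z + t) + (s - t)) * cnj (v (z + t))) = autocorr v (s - t)"
    unfolding autocorr_def by (rule mean_shift) (intro bl_mult bl_cnj bl_shift assms)
  then show ?thesis by (simp add: algebra_simps)
qed

lemma sum_list_product:
  fixes f g :: "_ \<Rightarrow> complex"
  shows "(\<Sum>p\<leftarrow>xs. f p) * (\<Sum>q\<leftarrow>ys. g q) = (\<Sum>p\<leftarrow>xs. \<Sum>q\<leftarrow>ys. f p * g q)"
  by (simp add: sum_list_const_mult flip: sum_list_mult_const)

lemma pd_autocorr:
  assumes "bl v" shows "positive_definite (autocorr v)"
  unfolding positive_definite_def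
proof (intro conjI allI)
  show "autocorr v (- x) = cnj (autocorr v x)" for x
  proof -
    have "autocorr v (0 - x) = mean (\<lambda>z. v z * cnj (v (z + x)))"
      using autocorr_diff[OF assms, of 0 x] by simp
    also have "\<dots> = mean (\<lambda>z. cnj (v (z + x) * cnj (v z)))"
      by (simp add: mult.commute)
    also have "\<dots> = cnj (autocorr v x)"
      unfolding autocorr_def by (rule mean_cnj) (intro bl_mult bl_cnj bl_shift assms)
    finally show ?thesis by simp
  qed
  fix xs :: "('g \<times> complex) list"
  define w where "w z = (\<Sum>p\<leftarrow>xs. snd p * v (z + fst p))" for z
  have bl: "bl (\<lambda>z. snd p * cnj (snd q) * (v (z + fst p) * cnj (v (z + fst q))))"
    for p q :: "'g \<times> complex"
    by (intro bl_mult bl_const bl_cnj bl_shift assms)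
  have "hermitian_form (autocorr v) xs xs
      = (\<Sum>p\<leftarrow>xs. \<Sum>q\<leftarrow>xs. mean (\<lambda>z. snd p * cnj (snd q) * (v (z + fst p) * cnj (v (z + fst q)))))"
    unfolding hermitian_form_def autocorr_diff[OF assms]
    by (simp add: mean_cmult bl_mult bl_cnj bl_shift assms)
  also have "\<dots> = mean (\<lambda>z. \<Sum>p\<leftarrow>xs. \<Sum>q\<leftarrow>xs. snd p * cnj (snd q) * (v (z + fst p) * cnj (v (z + fst q))))"
    by (simp add: mean_sum_list bl_sum_list bl)
  also have "(\<lambda>z. \<Sum>p\<leftarrow>xs. \<Sum>q\<leftarrow>xs. snd p * cnj (snd q) * (v (z + fst p) * cnj (v (z + fst q))))
      = (\<lambda>z. w z * cnj (w z))"
    unfolding w_def cnj_sum_list sum_list_product by (simp add: mult_ac)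
  finally have eq: "hermitian_form (autocorr v) xs xs = mean (\<lambda>z. w z * cnj (w z))" .
  have "bl w" unfolding w_def[abs_def] by (intro bl_sum_list bl_cmult bl_shift assms)
  then show "0 \<le> Re (hermitian_form (autocorr v) xs xs)"
    unfolding eq by (intro mean_Re_nonneg bl_mult bl_cnj) (simp_all add: complex_mult_cnj)
qed

lemma bl_autocorr: "bl v \<Longrightarrow> bl (autocorr v)"
  using BL_autocorr by (auto simp: bl_def)

lemma convolution_commute:
  assumes "bl u" "bl \<phi>" shows "convolution u \<phi> x = mean (\<lambda>y. u (x - y) * \<phi> y)"
proof -
  let ?g = "\<lambda>y. u (x - y) * \<phi> y"
  have g: "bl ?g" by (intro bl_mult bl_reflect assms)
  have "convolution u \<phi> x = mean (\<lambda>y. ?g (- (y + (- x))))"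
    by (simp add: convolution_def)
  also have "\<dots> = mean (\<lambda>y. ?g (- y))"
    by (rule mean_shift[OF bl_uminus_arg[OF g]])
  also have "\<dots> = mean ?g"
    by (rule mean_reflect[OF g])
  finally show ?thesis .
qed

text \<open>Convolution smooths: the Lipschitz constant of the result is that of \<open>u\<close>, whatever the one of \<open>\<phi>\<close> is.
  This is the source of compactness below.\<close>

lemma BL_convolution:
  assumes u: "BL L u" and \<phi>: "bl \<phi>" and le: "\<And>x. norm (\<phi> x) \<le> 1"
  shows "BL L (convolution u \<phi>)"
  unfolding BL_def
proof (intro conjI allI)
  note bl = BL_imp_bl[OF u]
  have *: "norm (a * \<phi> y) \<le> K" if "norm a \<le> K" for a y K
    using mult_mono[OF that le[of y]] that norm_ge_zero[of a] by (auto simp: norm_mult)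
  fix x t
  show "norm (convolution u \<phi> x) \<le> L"
    unfolding convolution_def
    by (rule mean_norm_le) (intro bl_mult bl_reflect bl \<phi>, rule *, rule BL_norm[OF u])
  have "convolution u \<phi> (x + t) - convolution u \<phi> x = mean (\<lambda>y. u (x + t - y) * \<phi> y - u (x - y) * \<phi> y)"
    unfolding convolution_commute[OF bl \<phi>]
    by (rule mean_diff[symmetric]) (intro bl_mult bl_reflect bl \<phi>)+
  also have "\<dots> = mean (\<lambda>y. (u ((x - y) + t) - u (x - y)) * \<phi> y)"
    by (simp add: algebra_simps)
  finally have eq: "convolution u \<phi> (x + t) - convolution u \<phi> x = mean (\<lambda>y. (u ((x - y) + t) - u (x - y)) * \<phi> y)" .
  have "bl (\<lambda>y. u ((x + t) - y) - u (x - y))"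
    by (intro bl_diff bl_reflect bl)
  then have bl': "bl (\<lambda>y. u ((x - y) + t) - u (x - y))"
    by (simp add: algebra_simps)
  show "norm (convolution u \<phi> (x + t) - convolution u \<phi> x) \<le> L * D t"
    unfolding eq by (rule mean_norm_le) (rule bl_mult[OF bl' \<phi>], rule *, rule BL_lip[OF u])
qed

text \<open>With both means moved to suitable translates, the convolution at a difference \<open>s - t\<close> becomes a form of
  \<open>\<phi>\<close> in the translates of \<open>v\<close> by \<open>s\<close> and \<open>t\<close>; this makes its positive definiteness visible.\<close>

lemma convolution_autocorr_diff:
  assumes v: "bl v" and \<phi>: "bl \<phi>"
  shows "convolution (autocorr v) \<phi> (s - t) = mean (\<lambda>z. mean (\<lambda>y. cnj (v (z + t)) * v (y + s) * \<phi> (z - y)))"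
proof -
  obtain L N where L: "BL L v" and N: "BL N \<phi>" using assms by (auto simp: bl_def)
  note ge = BL_nonneg[OF L] BL_nonneg[OF N]
  define F where "F y z = v (z + y) * cnj (v z) * \<phi> (s - t - y)" for y z
  have "BL (norm (\<phi> (s - t - y)) * (2 * L * L)) (\<lambda>z. \<phi> (s - t - y) * (v (z + y) * cnj (v z)))" for y
    by (intro BL_cmult autocorr_integrand_BL L)
  moreover have "norm (\<phi> (s - t - y)) * (2 * L * L) \<le> N * (2 * L * L)" for y
    by (intro mult_right_mono BL_norm[OF N]) (use ge in auto)
  ultimately have "BL (N * (2 * L * L)) (\<lambda>z. \<phi> (s - t - y) * (v (z + y) * cnj (v z)))" for y
    by (rule BL_mono)
  then have "BL (4 * L * L * N) (\<lambda>z. \<phi> (s - t - y) * (v (z + y) * cnj (v z)))" for y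
    by (rule BL_mono) (use ge in simp)
  then have F1: "BL (4 * L * L * N) (F y)" for y
    by (simp add: F_def[abs_def] mult_ac)
  have F2: "BL (4 * L * L * N) (\<lambda>y. F y z)" for z
    using BL_mult[OF autocorr_integrand_BL(2)[OF L, of z] BL_reflect[OF N, of "s - t"]]
    by (simp add: F_def[abs_def] mult_ac)
  have "convolution (autocorr v) \<phi> (s - t) = mean (\<lambda>y. mean (F y))"
  proof -
    have "mean (F y) = autocorr v y * \<phi> (s - t - y)" for y
      using mean_cmult[OF BL_imp_bl[OF autocorr_integrand_BL(1)[OF L]], of "\<phi> (s - t - y)" y]
      by (simp add: F_def[abs_def] autocorr_def mult_ac)
    then show ?thesis by (simp add: convolution_def)
  qed
  also have "\<dots> = mean (\<lambda>z. mean (\<lambda>y. F y z))"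
    by (rule mean_swap[OF F1 F2])
  also have "\<dots> = mean (\<lambda>z. mean (\<lambda>y. F y (z + t)))"
    by (rule mean_shift[symmetric]) (rule BL_imp_bl[OF BL_mean[OF F2 F1]])
  also have "\<dots> = mean (\<lambda>z. mean (\<lambda>y. F (y + (s - z - t)) (z + t)))"
    by (subst mean_shift[OF BL_imp_bl[OF F2]]) simp
  also have "\<dots> = mean (\<lambda>z. mean (\<lambda>y. cnj (v (z + t)) * v (y + s) * \<phi> (z - y)))"
    by (simp add: F_def algebra_simps)
  finally show ?thesis .
qed

text \<open>The form of the convolution at a finite measure equals the form of \<open>\<phi>\<close> at the density \<open>w\<close>, the conjugate
  of the corresponding combination of translates of \<open>v\<close>, and is nonnegative by \<open>pd_mean_form\<close>.\<close>

lemma pd_convolution_autocorr: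
  assumes v: "bl v" and \<phi>: "bl \<phi>" "positive_definite \<phi>"
  shows "positive_definite (convolution (autocorr v) \<phi>)"
  unfolding positive_definite_def
proof (intro conjI allI)
  have C: "bl (autocorr v)" by (rule bl_autocorr[OF v])
  show "convolution (autocorr v) \<phi> (- x) = cnj (convolution (autocorr v) \<phi> x)" for x
  proof -
    have "- x - y = - (x - (- y))" for y by simp
    then have "convolution (autocorr v) \<phi> (- x) = mean (\<lambda>y. cnj (autocorr v (- y)) * cnj (\<phi> (x - (- y))))"
      unfolding convolution_def
      by (simp only: pd_hermitian[OF pd_autocorr[OF v]] pd_hermitian[OF \<phi>(2)] complex_cnj_cnj)
    also have "\<dots> = mean (\<lambda>y. cnj (autocorr v y * \<phi> (x - y)))"
      using mean_reflect[of "\<lambda>y. cnj (autocorr v y) * cnj (\<phi> (x - y))"]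
      by (simp add: bl_mult bl_cnj bl_reflect C \<phi>)
    also have "\<dots> = cnj (convolution (autocorr v) \<phi> x)"
      unfolding convolution_def by (rule mean_cnj) (intro bl_mult bl_reflect C \<phi>)
    finally show ?thesis .
  qed
  fix xs :: "('g \<times> complex) list"
  define w where "w z = cnj (\<Sum>p\<leftarrow>xs. snd p * v (z + fst p))" for z
  have w: "bl w" unfolding w_def[abs_def] by (intro bl_cnj bl_sum_list bl_cmult bl_shift v)
  obtain L N where L: "BL L v" and N: "BL N \<phi>" using v \<phi> by (auto simp: bl_def)
  let ?K = "\<lambda>p q z y. snd p * cnj (snd q) * (cnj (v (z + fst q)) * v (y + fst p) * \<phi> (z - y))"
  have K: "BL (2 * L * L * N) (\<lambda>y. cnj (v (z + t)) * v (y + s) * \<phi> (z - y))"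
     "BL (2 * L * L * N) (\<lambda>z. cnj (v (z + t)) * v (y + s) * \<phi> (z - y))" for s t z y
    by (rule kernel_BL[OF BL_cnj[OF BL_shift[OF L]] BL_shift[OF L] N])+
  have "hermitian_form (convolution (autocorr v) \<phi>) xs xs = (\<Sum>p\<leftarrow>xs. \<Sum>q\<leftarrow>xs. mean (\<lambda>z. mean (?K p q z)))"
    unfolding hermitian_form_def convolution_autocorr_diff[OF v \<phi>(1)]
    by (simp add: mean_cmult BL_imp_bl[OF K(1)] BL_imp_bl[OF BL_mean[OF K]])
  also have "\<dots> = mean (\<lambda>z. \<Sum>p\<leftarrow>xs. \<Sum>q\<leftarrow>xs. mean (?K p q z))"
    by (simp add: mean_sum_list bl_sum_list mean_cmult bl_cmult BL_imp_bl[OF K(1)] BL_imp_bl[OF BL_mean[OF K]])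
  also have "\<dots> = mean (\<lambda>z. mean (\<lambda>y. \<Sum>p\<leftarrow>xs. \<Sum>q\<leftarrow>xs. ?K p q z y))"
    by (simp add: mean_sum_list bl_sum_list bl_cmult BL_imp_bl[OF K(1)])
  also have "(\<lambda>z. mean (\<lambda>y. \<Sum>p\<leftarrow>xs. \<Sum>q\<leftarrow>xs. ?K p q z y)) = (\<lambda>z. mean (\<lambda>y. w z * cnj (w y) * \<phi> (z - y)))"
  proof -
    have "(\<Sum>p\<leftarrow>xs. \<Sum>q\<leftarrow>xs. ?K p q z y) = w z * cnj (w y) * \<phi> (z - y)" for z y
    proof -
      have "w z * cnj (w y) * \<phi> (z - y)
          = (\<Sum>p\<leftarrow>xs. snd p * v (y + fst p)) * (\<Sum>q\<leftarrow>xs. cnj (snd q * v (z + fst q))) * \<phi> (z - y)"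
        by (simp add: w_def cnj_sum_list)
      also have "\<dots> = (\<Sum>p\<leftarrow>xs. \<Sum>q\<leftarrow>xs. snd p * v (y + fst p) * cnj (snd q * v (z + fst q)) * \<phi> (z - y))"
        by (simp only: sum_list_product sum_list_mult_const)
      finally show ?thesis by (simp add: mult_ac)
    qed
    then show ?thesis by simp
  qed
  finally show "0 \<le> Re (hermitian_form (convolution (autocorr v) \<phi>) xs xs)"
    using pd_mean_form[OF \<phi>(2,1) w, of "[]"] by (simp add: hermitian_form_def)
qed

section \<open>Characters as extreme positive definite functions\<close>

text \<open>Every point is moved into the region where \<open>Re u \<ge> b\<close> by one of the finitely many translations in
  the net, so the sum of these translates is everywhere at least \<open>b\<close>.\<close>

lemma mean_lower_bound:
  assumes u: "bl u" and nonneg: "\<And>x. 0 \<le> Re (u x)"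
    and F: "finite F" "\<And>x. \<exists>s\<in>F. D (x - s) < d"
    and b: "\<And>t. D t < d \<Longrightarrow> b \<le> Re (u (x0 + t))"
  shows "b / card F \<le> Re (mean u)"
proof -
  obtain fs where fs: "set fs = F" "distinct fs" using F(1) finite_distinct_list by blast
  have card: "card F = length fs" using fs distinct_card by force
  have "F \<noteq> {}" using F(2) by blast
  then have n: "card F > 0" using F(1) by (simp add: card_gt_0_iff)
  have "mean (\<lambda>x. \<Sum>s\<leftarrow>fs. u (x + s)) = (\<Sum>s\<leftarrow>fs. mean (\<lambda>x. u (x + s)))"
    by (rule mean_sum_list) (rule bl_shift[OF u])
  also have "\<dots> = of_nat (card F) * mean u"
    by (simp add: mean_shift[OF u] sum_list_triv card)
  finally have eq: "mean (\<lambda>x. \<Sum>s\<leftarrow>fs. u (x + s)) = of_nat (card F) * mean u" .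
  have "b \<le> Re (\<Sum>s\<leftarrow>fs. u (x + s))" for x
  proof -
    obtain s where s: "s \<in> F" "D (x0 - x - s) < d" using F(2) by blast
    have "D (x + s - x0) < d"
      using s(2) D_minus[of "x + s - x0"] by (simp add: algebra_simps)
    then have "b \<le> Re (u (x + s))"
      using b[of "x + s - x0"] by simp
    also have "\<dots> \<le> (\<Sum>s\<in>F. Re (u (x + s)))"
      by (rule member_le_sum) (use s F nonneg in auto)
    also have "\<dots> = Re (\<Sum>s\<leftarrow>fs. u (x + s))"
      using fs by (simp add: sum_list_distinct_conv_sum_set flip: Re_sum)
    finally show ?thesis .
  qed
  then have "0 \<le> Re (mean (\<lambda>x. (\<Sum>s\<leftarrow>fs. u (x + s)) - of_real b))"
    by (intro mean_Re_nonneg bl_diff bl_sum_list bl_shift[OF u] bl_const) simp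
  also have "mean (\<lambda>x. (\<Sum>s\<leftarrow>fs. u (x + s)) - of_real b) = of_nat (card F) * mean u - of_real b"
    by (subst mean_diff) (simp_all add: eq mean_const bl_sum_list bl_shift[OF u] bl_const)
  finally show ?thesis
    using n by (simp add: field_simps)
qed

definition sqnorm :: "('g \<Rightarrow> complex) \<Rightarrow> real" where
  "sqnorm u = Re (mean (\<lambda>x. u x * cnj (u x)))"

text \<open>The mean is faithful, in a quantitative form: the constant depends only on \<open>L\<close> and \<open>e\<close>. This
  uniformity is what makes the final set of characters finite.\<close>

lemma sqnorm_lower_bound:
  assumes L: "L \<ge> 0" and e: "e > 0"
  obtains c where "c > 0" "\<And>u x. BL L u \<Longrightarrow> e \<le> norm (u x) \<Longrightarrow> c \<le> sqnorm u"
proof -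
  define a where "a = e / 2"
  define d where "d = a / (L + 1)"
  have pos: "a > 0" "L + 1 > 0" "d > 0" using L e by (auto simp: a_def d_def)
  obtain F where F: "finite F" "\<And>x. \<exists>s\<in>F. D (x - s) < d" using finite_net[OF pos(3)] by blast
  have "F \<noteq> {}" using F(2) by blast
  then have n: "card F > 0" using F(1) by (simp add: card_gt_0_iff)
  have "a\<^sup>2 / card F \<le> sqnorm u" if u: "BL L u" and x: "e \<le> norm (u x)" for u x
    unfolding sqnorm_def
  proof (rule mean_lower_bound[OF _ _ F])
    show "bl (\<lambda>x. u x * cnj (u x))" by (intro bl_mult bl_cnj BL_imp_bl[OF u])
    show "0 \<le> Re (u x * cnj (u x))" for x by (simp add: complex_mult_cnj)
    fix t assume "D t < d"
    then have "(L + 1) * D t \<le> (L + 1) * d" using pos by (intro mult_left_mono) auto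
    also have "\<dots> = a" using pos by (simp add: d_def)
    finally have "norm (u (x + t) - u x) \<le> a"
      using BL_lip[OF u, of x t] D_nonneg[of t] by (simp add: algebra_simps)
    then have "a \<le> norm (u (x + t))"
      using x norm_triangle_ineq3[of "u (x + t)" "u x"] by (simp add: a_def)
    then have "a\<^sup>2 \<le> (norm (u (x + t)))\<^sup>2" using pos by (intro power_mono) auto
    then show "a\<^sup>2 \<le> Re (u (x + t) * cnj (u (x + t)))"
      by (simp add: complex_mult_cnj cmod_power2)
  qed
  moreover have "a\<^sup>2 / card F > 0" using n pos by simp
  ultimately show thesis using that by blast
qed

lemma sqnorm_eq_0:
  assumes u: "bl u" and 0: "sqnorm u \<le> 0"
  shows "u x = 0"
proof (rule ccontr)
  assume x: "u x \<noteq> 0"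
  obtain L where L: "BL L u" using u by (auto simp: bl_def)
  from sqnorm_lower_bound[OF BL_nonneg[OF L], of "norm (u x)"] x
  obtain c where "c > 0" "c \<le> sqnorm u" using L by (metis order_refl zero_less_norm_iff)
  with 0 show False by simp
qed

text \<open>The analogue of the probability measures on the dual group.\<close>

definition normalized_pd :: "('g \<Rightarrow> complex) set" where
  "normalized_pd = {\<phi>. bl \<phi> \<and> positive_definite \<phi> \<and> \<phi> 0 = 1}"

text \<open>The integral of the squared moduli of the Fourier coefficients of \<open>v\<close> against the measure on the dual
  that belongs to \<open>\<phi>\<close>. Its maximum over
  \<open>normalized_pd\<close> is the largest squared Fourier coefficient of \<open>v\<close>.\<close>

definition pairing :: "('g \<Rightarrow> complex) \<Rightarrow> ('g \<Rightarrow> complex) \<Rightarrow> real" where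
  "pairing v \<phi> = Re (convolution (autocorr v) \<phi> 0)"

lemma normalized_pd_norm_le: "\<phi> \<in> normalized_pd \<Longrightarrow> norm (\<phi> x) \<le> 1"
  using pd_norm_le[of \<phi> x] by (simp add: normalized_pd_def)

lemma pd_normalize:
  assumes "positive_definite \<psi>" "bl \<psi>" "Re (\<psi> 0) > 0"
  shows "(\<lambda>x. of_real (1 / Re (\<psi> 0)) * \<psi> x) \<in> normalized_pd"
proof -
  have "of_real (1 / Re (\<psi> 0)) * \<psi> 0 = 1"
    by (subst (2) pd_zero_eq[OF assms(1)]) (use assms in \<open>simp flip: of_real_mult of_real_divide\<close>)
  moreover have "positive_definite (\<lambda>x. of_real (1 / Re (\<psi> 0)) * \<psi> x)"
    by (rule pd_scale) (use assms in auto)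
  ultimately show ?thesis
    using bl_cmult[OF assms(2)] unfolding normalized_pd_def by blast
qed

lemma convolution_cmult: "bl u \<Longrightarrow> bl \<phi> \<Longrightarrow> convolution u (\<lambda>x. c * \<phi> x) x = c * convolution u \<phi> x"
  unfolding convolution_def using mean_cmult[of "\<lambda>y. u y * \<phi> (x - y)" c]
  by (simp add: bl_mult bl_reflect mult_ac)

lemma convolution_add: "bl u \<Longrightarrow> bl \<phi> \<Longrightarrow> bl \<psi> \<Longrightarrow> convolution u (\<lambda>x. \<phi> x + \<psi> x) x = convolution u \<phi> x + convolution u \<psi> x"
  unfolding convolution_def using mean_add[of "\<lambda>y. u y * \<phi> (x - y)" "\<lambda>y. u y * \<psi> (x - y)"]
  by (simp add: bl_mult bl_reflect distrib_left)

lemma pairing_scale: "bl v \<Longrightarrow> bl \<phi> \<Longrightarrow> pairing v (\<lambda>x. of_real r * \<phi> x) = r * pairing v \<phi>"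
  by (simp add: pairing_def convolution_cmult bl_autocorr)

lemma bl_convolution: "bl v \<Longrightarrow> \<phi> \<in> normalized_pd \<Longrightarrow> bl (convolution (autocorr v) \<phi>)"
  using BL_convolution[of _ "autocorr v" \<phi>] normalized_pd_norm_le[of \<phi>] bl_autocorr[of v]
    unfolding bl_def normalized_pd_def by blast

lemma pd_convolution: "bl v \<Longrightarrow> \<phi> \<in> normalized_pd \<Longrightarrow> positive_definite (convolution (autocorr v) \<phi>)"
  by (simp add: normalized_pd_def pd_convolution_autocorr)

lemma convolution_zero: "bl v \<Longrightarrow> \<phi> \<in> normalized_pd \<Longrightarrow> convolution (autocorr v) \<phi> 0 = of_real (pairing v \<phi>)"
  unfolding pairing_def by (rule pd_zero_eq[OF pd_convolution])

text \<open>The form of \<open>\<phi>\<close> at the sum of \<open>\<kappa>\<close> and the density \<open>cnj \<circ> C\<close>, where \<open>C\<close> is the autocorrelation of \<open>v\<close>,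
  written with the convolution operator: the mixed terms are values of \<open>C * \<phi>\<close>, the quadratic term is the value of \<open>C * C * \<phi>\<close> at \<open>0\<close>.\<close>

lemma pd_convolution_form:
  assumes v: "bl v" and \<phi>: "\<phi> \<in> normalized_pd"
  shows "0 \<le> Re (hermitian_form \<phi> \<kappa> \<kappa>) + 2 * Re (\<Sum>p\<leftarrow>\<kappa>. snd p * convolution (autocorr v) \<phi> (fst p))
    + pairing v (convolution (autocorr v) \<phi>)"
proof -
  let ?C = "autocorr v"
  have C: "bl ?C" by (rule bl_autocorr[OF v])
  have p: "bl \<phi>" "positive_definite \<phi>" using \<phi> by (auto simp: normalized_pd_def)
  have cross: "mean (\<lambda>z. cnj (?C z) * \<phi> (z - x)) = cnj (convolution ?C \<phi> x)" for x
  proof -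
    have "z - x = - (x - z)" for z by simp
    then have "mean (\<lambda>z. cnj (?C z) * \<phi> (z - x)) = mean (\<lambda>z. cnj (?C z * \<phi> (x - z)))"
      by (simp only: pd_hermitian[OF p(2)] complex_cnj_mult)
    also have "\<dots> = cnj (convolution ?C \<phi> x)"
      unfolding convolution_def by (rule mean_cnj) (intro bl_mult bl_reflect C p)
    finally show ?thesis .
  qed
  have "mean (\<lambda>s. mean (\<lambda>t. cnj (?C s) * cnj (cnj (?C t)) * \<phi> (s - t)))
      = mean (\<lambda>s. cnj (?C s) * convolution ?C \<phi> s)"
    using mean_cmult[of "\<lambda>t. ?C t * \<phi> (_ - t)"]
      by (simp add: convolution_def bl_mult bl_reflect C p mult.assoc)
  also have "\<dots> = mean (\<lambda>s. ?C (0 - s) * convolution ?C \<phi> s)"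
    by (simp add: pd_hermitian[OF pd_autocorr[OF v]])
  also have "\<dots> = convolution ?C (convolution ?C \<phi>) 0"
    by (rule convolution_commute[symmetric]) (rule C, rule bl_convolution[OF v \<phi>])
  finally have last: "mean (\<lambda>s. mean (\<lambda>t. cnj (?C s) * cnj (cnj (?C t)) * \<phi> (s - t)))
      = convolution ?C (convolution ?C \<phi>) 0" .
  have "Re (\<Sum>p\<leftarrow>\<kappa>. cnj (snd p) * cnj (convolution ?C \<phi> (fst p))) = Re (cnj (\<Sum>p\<leftarrow>\<kappa>. snd p * convolution ?C \<phi> (fst p)))"
    by (simp only: cnj_sum_list complex_cnj_mult)
  then show ?thesis
    using pd_mean_form[OF p(2,1) bl_cnj[OF C], of \<kappa>] unfolding cross last pairing_def by simp
qed

text \<open>The Cauchy-Schwarz inequality for the form of \<open>\<phi>\<close> and the measures \<open>cnj \<circ> C\<close> and \<open>\<delta>\<^sub>0\<close>, where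
  \<open>C\<close> is the autocorrelation of \<open>v\<close>.\<close>

lemma pairing_convolution_ge:
  assumes v: "bl v" and \<phi>: "\<phi> \<in> normalized_pd"
  shows "(pairing v \<phi>)\<^sup>2 \<le> pairing v (convolution (autocorr v) \<phi>)"
proof -
  have "\<phi> 0 = 1" using \<phi> by (simp add: normalized_pd_def)
  then show ?thesis
    using pd_convolution_form[OF assms, of "[(0, - of_real (pairing v \<phi>))]"]
    by (simp add: hermitian_form_def convolution_zero[OF assms] power2_eq_square)
qed

text \<open>Equality in Cauchy-Schwarz: the measure \<open>cnj \<circ> C - \<lambda> \<delta>\<^sub>0\<close> with \<open>\<lambda> = pairing v \<phi>\<close> has norm zero in the
  form of \<open>\<phi>\<close>, so it is orthogonal to every \<open>\<delta>\<^sub>x\<close>.\<close>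

lemma convolution_eigenfunction:
  assumes v: "bl v" and \<phi>: "\<phi> \<in> normalized_pd"
    and le: "pairing v (convolution (autocorr v) \<phi>) \<le> (pairing v \<phi>)\<^sup>2"
  shows "convolution (autocorr v) \<phi> x = of_real (pairing v \<phi>) * \<phi> x"
proof -
  let ?l = "pairing v \<phi>"
  define w where "w = convolution (autocorr v) \<phi> x - of_real ?l * \<phi> x"
  have 1: "\<phi> 0 = 1" "\<phi> (- x) = cnj (\<phi> x)" using \<phi>
    by (auto simp: normalized_pd_def positive_definite_def)
  have "0 \<le> Re (w * cnj w) + ?l\<^sup>2 + 2 * ?l * Re (cnj w * \<phi> x)
      + 2 * (- Re (cnj w * convolution (autocorr v) \<phi> x) - ?l\<^sup>2) + ?l\<^sup>2"
    using pd_convolution_form[OF v \<phi>, of "[(x, - cnj w), (0, - of_real ?l)]"] le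
    by (simp add: hermitian_form_def convolution_zero[OF v \<phi>] power2_eq_square 1 algebra_simps)
  also have "\<dots> = Re (w * cnj w) - 2 * Re (cnj w * w)"
    by (simp add: w_def algebra_simps)
  also have "\<dots> = - (norm w)\<^sup>2"
    using cmod_power2[of w] by (simp add: power2_eq_square)
  finally have "w = 0" by simp
  then show ?thesis by (simp add: w_def)
qed

text \<open>For a fixed Lipschitz constant the normalized positive definite functions form a compact set for pointwise
  convergence, by Tychonoff's theorem.\<close>

definition lipschitz_pd :: "real \<Rightarrow> ('g \<Rightarrow> complex) set" where
  "lipschitz_pd M = {\<phi>. BL M \<phi> \<and> positive_definite \<phi> \<and> \<phi> 0 = 1}"

lemma lipschitz_pd_subset: "lipschitz_pd M \<subseteq> normalized_pd"
  by (auto simp: lipschitz_pd_def normalized_pd_def bl_def)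

lemma lipschitz_pd_BL: "\<phi> \<in> lipschitz_pd M \<Longrightarrow> BL M \<phi>"
  by (simp add: lipschitz_pd_def)

lemma compact_lipschitz_pd: "compact (lipschitz_pd M)"
proof -
  have coord [continuous_intros]: "continuous_on UNIV (\<lambda>\<phi>::'g \<Rightarrow> complex. \<phi> x)" for x
    by (rule continuous_on_product_coordinates)
  have sum: "continuous_on UNIV (\<lambda>\<phi>::'g \<Rightarrow> complex. \<Sum>p\<leftarrow>xs. f p \<phi>)"
    if "\<And>p. continuous_on UNIV (f p)" for f :: "'g \<times> complex \<Rightarrow> ('g \<Rightarrow> complex) \<Rightarrow> complex" and xs
    by (induction xs) (auto intro!: continuous_intros that)
  have "closed (lipschitz_pd M)"
    unfolding lipschitz_pd_def BL_def positive_definite_def hermitian_form_def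
    by (intro closed_Collect_conj closed_Collect_all closed_Collect_le closed_Collect_eq
        continuous_intros continuous_on_Re sum)
  moreover have "compact (PiE UNIV (\<lambda>_. cball 0 M) :: ('g \<Rightarrow> complex) set)"
    using compactin_PiE[of "\<lambda>_::'g. euclidean :: complex topology" UNIV "\<lambda>_. cball 0 M"]
    by (simp add: euclidean_product_topology compactin_euclidean_iff)
  moreover have "lipschitz_pd M \<subseteq> PiE UNIV (\<lambda>_. cball 0 M)"
    by (auto simp: lipschitz_pd_def BL_def)
  ultimately show ?thesis
    by (metis compact_Int_closed inf.absorb_iff2 inf_commute)
qed

text \<open>On an equicontinuous family pointwise closeness at a finite net is uniform closeness, so a functional
  that is Lipschitz for the supremum norm is continuous for pointwise convergence.\<close>

lemma continuous_on_lipschitz_pd: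
  fixes F :: "('g \<Rightarrow> complex) \<Rightarrow> real"
  assumes F: "\<And>\<phi> \<psi> e. \<phi> \<in> lipschitz_pd M \<Longrightarrow> \<psi> \<in> lipschitz_pd M \<Longrightarrow> (\<And>x. norm (\<phi> x - \<psi> x) \<le> e) \<Longrightarrow> \<bar>F \<phi> - F \<psi>\<bar> \<le> c * e"
  shows "continuous_on (lipschitz_pd M) F"
  unfolding continuous_on_def
proof (intro ballI tendstoI)
  fix \<phi> and e :: real assume \<phi>: "\<phi> \<in> lipschitz_pd M" and e: "e > 0"
  define e' where "e' = e / (\<bar>c\<bar> + 1)"
  have e': "e' > 0" using e by (simp add: e'_def)
  have "c * e' \<le> \<bar>c\<bar> * e'" using e' by (intro mult_right_mono) auto
  also have "\<dots> < (\<bar>c\<bar> + 1) * e'" using e' by simp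
  also have "\<dots> = e" by (simp add: e'_def)
  finally have ce: "c * e' < e" .
  have BL: "BL M \<phi>" using \<phi> by (simp add: lipschitz_pd_def)
  have M: "M \<ge> 0" using BL_nonneg[OF BL] .
  define d where "d = e' / 4 / (M + 1)"
  have d: "d > 0" using e' M by (simp add: d_def)
  have "M * d \<le> (M + 1) * d" using d by simp
  also have "\<dots> = e' / 4"
    using M unfolding d_def
      by (metis add_nonneg_eq_0_iff nonzero_mult_div_cancel_left times_divide_eq_right
        zero_le_one zero_neq_one)
  finally have Md: "M * d \<le> e' / 4" .
  obtain N where N: "finite N" "\<And>x. \<exists>s\<in>N. D (x - s) < d" using finite_net[OF d] by blast
  \<comment> \<open>Closeness \<open>e' / 2\<close> on the net and twice the oscillation \<open>e' / 4\<close> add up to \<open>e'\<close>.\<close>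
  define U where "U = (\<Inter>s\<in>N. {\<psi>. norm (\<psi> s - \<phi> s) < e' / 2})"
  have "open U"
    unfolding U_def
    by (intro open_INT N ballI open_Collect_less continuous_intros continuous_on_product_coordinates)
  moreover have "\<phi> \<in> U" using e' by (simp add: U_def)
  moreover have "dist (F \<psi>) (F \<phi>) < e" if "\<psi> \<in> U" "\<psi> \<in> lipschitz_pd M" for \<psi>
  proof -
    have BL': "BL M \<psi>" using that by (simp add: lipschitz_pd_def)
    have "norm (\<psi> x - \<phi> x) \<le> e'" for x
    proof -
      obtain s where s: "s \<in> N" "D (x - s) < d" using N(2) by blast
      have "M * D (x - s) \<le> e' / 4"
        using mult_left_mono[OF less_imp_le[OF s(2)] M] Md by linarith
      then have "norm (\<psi> x - \<psi> s) \<le> e' / 4" "norm (\<phi> x - \<phi> s) \<le> e' / 4"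
        using BL_lip[OF BL, of s "x - s"] BL_lip[OF BL', of s "x - s"] by auto
      moreover have "norm (\<psi> s - \<phi> s) < e' / 2" using that(1) s(1) by (auto simp: U_def)
      moreover have "\<psi> x - \<phi> x = (\<psi> x - \<psi> s) - (\<phi> x - \<phi> s) + (\<psi> s - \<phi> s)" by simp
      ultimately show ?thesis
        using norm_triangle_ineq[of "(\<psi> x - \<psi> s) - (\<phi> x - \<phi> s)" "\<psi> s - \<phi> s"]
          norm_triangle_ineq4[of "\<psi> x - \<psi> s" "\<phi> x - \<phi> s"] by simp
    qed
    then have "\<bar>F \<psi> - F \<phi>\<bar> \<le> c * e'" by (rule F[OF that(2) \<phi>])
    with ce show ?thesis by (simp add: dist_real_def)
  qed
  ultimately show "\<forall>\<^sub>F \<psi> in at \<phi> within lipschitz_pd M. dist (F \<psi>) (F \<phi>) < e"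
    unfolding eventually_at_topological by blast
qed

lemma pairing_diff_le:
  assumes C: "BL K (autocorr v)" and bl: "bl \<phi>" "bl \<psi>" and e: "\<And>x. norm (\<phi> x - \<psi> x) \<le> e"
  shows "\<bar>pairing v \<phi> - pairing v \<psi>\<bar> \<le> K * e"
proof -
  note [intro] = bl_mult bl_reflect bl bl_diff BL_imp_bl[OF C]
  have "convolution (autocorr v) \<phi> 0 - convolution (autocorr v) \<psi> 0 = mean (\<lambda>y. autocorr v y * \<phi> (0 - y) - autocorr v y * \<psi> (0 - y))"
    unfolding convolution_def
      by (rule mean_diff[symmetric]) (intro bl_mult bl_reflect bl BL_imp_bl[OF C])+
  also have "norm \<dots> \<le> K * e"
  proof (rule mean_norm_le)
    show "bl (\<lambda>y. autocorr v y * \<phi> (0 - y) - autocorr v y * \<psi> (0 - y))"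
      by (intro bl_diff bl_mult bl_reflect bl BL_imp_bl[OF C])
    show "norm (autocorr v y * \<phi> (0 - y) - autocorr v y * \<psi> (0 - y)) \<le> K * e" for y
      unfolding right_diff_distrib[symmetric] norm_mult
      using BL_norm[OF C] e BL_nonneg[OF C] by (intro mult_mono) auto
  qed
  finally show ?thesis
    unfolding pairing_def minus_complex.sel(1)[symmetric] using abs_Re_le_cmod order_trans by blast
qed

lemma pairing_le:
  assumes C: "BL K (autocorr v)" and \<phi>: "\<phi> \<in> normalized_pd" shows "pairing v \<phi> \<le> K"
proof -
  have "norm (convolution (autocorr v) \<phi> 0) \<le> K"
    by (rule BL_norm[OF BL_convolution[OF C]]) (use \<phi> normalized_pd_norm_le in \<open>auto simp: normalized_pd_def\<close>)
  then show ?thesis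
    using complex_Re_le_cmod[of "convolution (autocorr v) \<phi> 0"] by (simp add: pairing_def)
qed

lemma normalized_convolution_in_lipschitz_pd:
  assumes v: "bl v" and C: "BL K (autocorr v)" and \<phi>: "\<phi> \<in> normalized_pd" and pos: "pairing v \<phi> > 0"
  shows "(\<lambda>x. of_real (1 / pairing v \<phi>) * convolution (autocorr v) \<phi> x) \<in> lipschitz_pd (K / pairing v \<phi>)"
proof -
  have "BL (norm (complex_of_real (1 / pairing v \<phi>)) * K) (\<lambda>x. of_real (1 / pairing v \<phi>) * convolution (autocorr v) \<phi> x)"
    by (intro BL_cmult BL_convolution[OF C]) (use \<phi> normalized_pd_norm_le in \<open>auto simp: normalized_pd_def\<close>)
  moreover have "norm (complex_of_real (1 / pairing v \<phi>)) * K = K / pairing v \<phi>"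
    using pos by (simp add: norm_divide)
  ultimately show ?thesis
    using pd_normalize[OF pd_convolution[OF v \<phi>] bl_convolution[OF v \<phi>]] pos
    unfolding pairing_def[symmetric] lipschitz_pd_def normalized_pd_def by simp
qed

lemma pairing_normalized_convolution:
  assumes v: "bl v" and \<phi>: "\<phi> \<in> normalized_pd"
  shows "pairing v (\<lambda>x. of_real (1 / pairing v \<phi>) * convolution (autocorr v) \<phi> x) = pairing v (convolution (autocorr v) \<phi>) / pairing v \<phi>"
  by (subst pairing_scale[OF v bl_convolution[OF v \<phi>]]) simp

text \<open>Replacing \<open>\<phi>\<close> by its normalized convolution with the autocorrelation of \<open>v\<close> does not decrease the pairing
  and gives a Lipschitz constant \<open>K / pairing v \<phi>\<close>. The supremum is therefore the one over a compact set.\<close>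

lemma pairing_maximizer:
  assumes v: "bl v" and \<phi>0: "\<phi>0 \<in> normalized_pd" "pairing v \<phi>0 > 0"
  obtains \<phi> where "\<phi> \<in> normalized_pd" "\<And>\<psi>. \<psi> \<in> normalized_pd \<Longrightarrow> pairing v \<psi> \<le> pairing v \<phi>"
proof -
  obtain K where C: "BL K (autocorr v)" using bl_autocorr[OF v] by (auto simp: bl_def)
  define s where "s = (SUP \<phi>\<in>normalized_pd. pairing v \<phi>)"
  have bdd: "bdd_above (pairing v ` normalized_pd)" using pairing_le[OF C]
    by (auto intro!: bdd_aboveI2)
  have "pairing v \<phi>0 \<le> s" unfolding s_def by (rule cSUP_upper[OF \<phi>0(1) bdd])
  with \<phi>0 have s: "s > 0" by simp
  define M where "M = K / (s / 2)"
  have smooth: "\<exists>\<psi>\<in>lipschitz_pd M. pairing v \<phi> \<le> pairing v \<psi>" if \<phi>: "\<phi> \<in> normalized_pd"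
    and ge: "pairing v \<phi> \<ge> s / 2" for \<phi>
  proof
    have pos: "pairing v \<phi> > 0" using ge s by linarith
    let ?\<psi> = "\<lambda>x. of_real (1 / pairing v \<phi>) * convolution (autocorr v) \<phi> x"
    have "K / pairing v \<phi> \<le> M"
      unfolding M_def using ge s BL_nonneg[OF C] by (intro divide_left_mono) auto
    then show "?\<psi> \<in> lipschitz_pd M"
      using normalized_convolution_in_lipschitz_pd[OF v C \<phi> pos] BL_mono unfolding lipschitz_pd_def
        by blast
    show "pairing v \<phi> \<le> pairing v ?\<psi>"
      unfolding pairing_normalized_convolution[OF v \<phi>]
      using pairing_convolution_ge[OF v \<phi>] pos by (simp add: pos_le_divide_eq power2_eq_square)
  qed
  obtain \<phi>1 where \<phi>1: "\<phi>1 \<in> normalized_pd" "pairing v \<phi>1 > s / 2"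
    using less_cSUP_iff[OF _ bdd, of "s / 2"] \<phi>0 s by (auto simp: s_def)
  have "lipschitz_pd M \<noteq> {}" using smooth[OF \<phi>1(1)] \<phi>1(2) by auto
  moreover have "continuous_on (lipschitz_pd M) (pairing v)"
    by (rule continuous_on_lipschitz_pd[where c = K])
       (rule pairing_diff_le[OF C], auto simp: lipschitz_pd_def bl_def)
  ultimately obtain \<phi> where \<phi>: "\<phi> \<in> lipschitz_pd M"
    "\<And>\<psi>. \<psi> \<in> lipschitz_pd M \<Longrightarrow> pairing v \<psi> \<le> pairing v \<phi>"
    using continuous_attains_sup[OF compact_lipschitz_pd, of M "pairing v"] by blast
  have "pairing v \<psi> \<le> pairing v \<phi>" if "\<psi> \<in> normalized_pd" for \<psi>
  proof (cases "pairing v \<psi> \<ge> s / 2")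
    case True
    with smooth[OF that] \<phi>(2) show ?thesis by force
  next
    case False
    with smooth[OF \<phi>1(1)] \<phi>1(2) \<phi>(2) show ?thesis by force
  qed
  with \<phi>(1) lipschitz_pd_subset that show thesis by blast
qed

text \<open>The identity expressing that the square of a norm is strictly convex.\<close>

lemma sqnorm_convex_combination:
  assumes u: "bl u" and w: "bl w" and ab: "a + b = 1"
  shows "sqnorm (\<lambda>x. of_real a * u x + of_real b * w x)
    = a * sqnorm u + b * sqnorm w - a * b * sqnorm (\<lambda>x. u x - w x)"
proof -
  have b: "b = 1 - a" using ab by simp
  have "(of_real a * u x + of_real b * w x) * cnj (of_real a * u x + of_real b * w x)
      = (of_real a * (u x * cnj (u x)) + of_real b * (w x * cnj (w x)))
        - of_real (a * b) * ((u x - w x) * cnj (u x - w x))" for x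
    unfolding b by (simp add: algebra_simps)
  then show ?thesis
    unfolding sqnorm_def
    by (simp add: mean_diff mean_add mean_cmult bl_mult bl_cnj bl_diff bl_add bl_cmult u w
        del: complex_cnj_diff)
qed

lemma sqnorm_diff_le:
  assumes bl: "bl u" "bl w" and 1: "\<And>x. norm (u x) \<le> 1" "\<And>x. norm (w x) \<le> 1"
    and e: "\<And>x. norm (u x - w x) \<le> e"
  shows "\<bar>sqnorm u - sqnorm w\<bar> \<le> 2 * e"
proof -
  have "mean (\<lambda>x. u x * cnj (u x)) - mean (\<lambda>x. w x * cnj (w x))
      = mean (\<lambda>x. u x * cnj (u x) - w x * cnj (w x))"
    by (rule mean_diff[symmetric]) (intro bl_mult bl_cnj bl)+
  also have "norm \<dots> \<le> 2 * e"
  proof (rule mean_norm_le)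
    show "bl (\<lambda>x. u x * cnj (u x) - w x * cnj (w x))" by (intro bl_diff bl_mult bl_cnj bl)
    fix x
    have "u x * cnj (u x) - w x * cnj (w x) = u x * cnj (u x - w x) + (u x - w x) * cnj (w x)"
      by (simp add: algebra_simps)
    also have "norm \<dots> \<le> norm (u x) * norm (u x - w x) + norm (u x - w x) * norm (w x)"
      using norm_triangle_ineq[of "u x * cnj (u x - w x)" "(u x - w x) * cnj (w x)"]
      by (simp add: norm_mult flip: complex_cnj_diff)
    also have "\<dots> \<le> 1 * e + e * 1"
      using 1 e order_trans[OF norm_ge_zero e] by (intro add_mono mult_mono) auto
    finally show "norm (u x * cnj (u x) - w x * cnj (w x)) \<le> 2 * e" by simp
  qed
  finally show ?thesis
    unfolding sqnorm_def minus_complex.sel(1)[symmetric] using abs_Re_le_cmod order_trans by blast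
qed

definition character :: "('g \<Rightarrow> complex) \<Rightarrow> bool" where
  "character \<xi> \<longleftrightarrow> bl \<xi> \<and> (\<forall>x y. \<xi> (x + y) = \<xi> x * \<xi> y) \<and> (\<forall>x. norm (\<xi> x) = 1)"

text \<open>If \<open>\<phi>\<close> is proportional to its tilts, then \<open>c = 1/2\<close> and \<open>c = \<i>/2\<close> give the sum and the difference of
  \<open>\<phi> (x + a)\<close> and \<open>\<phi> (x - a)\<close>. The factor \<open>5/4\<close> is \<open>1 + |c|\<^sup>2\<close>.\<close>

lemma tilt_extremal_imp_multiplicative:
  fixes \<phi> :: "'g \<Rightarrow> complex"
  assumes "\<And>c. norm c = 1 / 2 \<Longrightarrow>
    (1 + c * cnj c) * \<phi> x + c * \<phi> (x + a) + cnj c * \<phi> (x - a) = (5 / 4 + 2 * Re (c * \<phi> a)) * \<phi> x"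
  shows "\<phi> (x + a) = \<phi> a * \<phi> x"
proof -
  have key: "c * \<phi> (x + a) + cnj c * \<phi> (x - a) = of_real (2 * Re (c * \<phi> a)) * \<phi> x"
    if c: "norm c = 1 / 2" for c
  proof -
    have "1 + c * cnj c = 5 / 4"
      using complex_norm_square[of c] c by (simp add: power2_eq_square)
    with assms[OF c] show ?thesis by (simp add: distrib_right)
  qed
  have "\<phi> (x + a) + \<phi> (x - a) = 2 * ((1 / 2) * \<phi> (x + a) + cnj (1 / 2) * \<phi> (x - a))"
    by simp
  also have "\<dots> = 2 * of_real (Re (\<phi> a)) * \<phi> x"
    by (subst key) simp_all
  finally have "\<phi> (x + a) + \<phi> (x - a) = 2 * of_real (Re (\<phi> a)) * \<phi> x" .
  moreover have "\<phi> (x + a) - \<phi> (x - a) = (- 2 * \<i>) * ((\<i> / 2) * \<phi> (x + a) + cnj (\<i> / 2) * \<phi> (x - a))"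
    by (simp add: algebra_simps)
  then have "\<phi> (x + a) - \<phi> (x - a) = 2 * \<i> * of_real (Im (\<phi> a)) * \<phi> x"
    by (subst (asm) key) (simp_all add: norm_divide)
  ultimately have "2 * \<phi> (x + a) = 2 * ((of_real (Re (\<phi> a)) + \<i> * of_real (Im (\<phi> a))) * \<phi> x)"
    by (simp add: algebra_simps)
  then show ?thesis
    by (simp add: complex_eq[symmetric])
qed

lemma multiplicative_pd_imp_character:
  assumes \<phi>: "\<phi> \<in> normalized_pd" and mult: "\<And>x a. \<phi> (x + a) = \<phi> a * \<phi> x"
  shows "character \<phi>"
proof -
  have "norm (\<phi> x) = 1" for x
  proof -
    have "\<phi> (- x) * \<phi> x = 1"
      using mult[of x "- x"] \<phi> by (simp add: normalized_pd_def)
    then have "\<phi> x * cnj (\<phi> x) = 1"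
      using \<phi> by (simp add: normalized_pd_def positive_definite_def mult.commute)
    then have "of_real ((norm (\<phi> x))\<^sup>2) = (1 :: complex)"
      by (simp only: complex_norm_square)
    then have "(norm (\<phi> x))\<^sup>2 = 1" by (simp only: of_real_eq_1_iff)
    then show ?thesis by (simp add: power2_eq_1_iff) (smt (verit) norm_ge_zero)
  qed
  with \<phi> mult show ?thesis by (simp add: character_def normalized_pd_def mult.commute)
qed

text \<open>The functions of maximal pairing form a face: if \<open>\<phi>\<close> is a convex combination of two normalized
  positive definite functions, then both have maximal pairing as well. By
  \<open>convolution_eigenfunction\<close> the face consists of eigenfunctions and is compact, and a member with the
  largest quadratic mean is extreme by strict convexity. As \<open>\<phi>\<close> is a convex combination of its tilts by \<open>c\<close>
  and \<open>- c\<close>, it is proportional to them, hence multiplicative.\<close>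

lemma eigencharacter_exists:
  assumes v: "bl v" and \<phi>0: "\<phi>0 \<in> normalized_pd" "pairing v \<phi>0 > 0"
  obtains \<xi> where "character \<xi>" "\<xi> \<in> normalized_pd" "pairing v \<phi>0 \<le> pairing v \<xi>"
proof -
  obtain K where C: "BL K (autocorr v)" using bl_autocorr[OF v] by (auto simp: bl_def)
  obtain \<phi>m where \<phi>m: "\<phi>m \<in> normalized_pd" "\<And>\<psi>. \<psi> \<in> normalized_pd \<Longrightarrow> pairing v \<psi> \<le> pairing v \<phi>m"
    using pairing_maximizer[OF assms] by blast
  define l where "l = pairing v \<phi>m"
  have l: "l > 0" using \<phi>m(2)[OF \<phi>0(1)] \<phi>0(2) by (simp add: l_def)
  define E where "E = {\<phi> \<in> lipschitz_pd (K / l). pairing v \<phi> = l}"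
  have E: "\<phi> \<in> E" if \<phi>: "\<phi> \<in> normalized_pd" and eq: "pairing v \<phi> = l" for \<phi>
  proof -
    let ?\<psi> = "\<lambda>x. of_real (1 / pairing v \<phi>) * convolution (autocorr v) \<phi> x"
    have \<psi>: "?\<psi> \<in> lipschitz_pd (K / l)"
      using normalized_convolution_in_lipschitz_pd[OF v C \<phi>] l eq by simp
    then have "pairing v ?\<psi> \<le> l"
      using \<phi>m(2) lipschitz_pd_subset unfolding l_def by blast
    then have "pairing v (convolution (autocorr v) \<phi>) \<le> (pairing v \<phi>)\<^sup>2"
      unfolding pairing_normalized_convolution[OF v \<phi>] using l eq
        by (simp add: divide_le_eq power2_eq_square)
    then have "?\<psi> x = \<phi> x" for x
      using convolution_eigenfunction[OF v \<phi>, of x] l eq by simp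
    then have "?\<psi> = \<phi>" by (rule ext)
    then show ?thesis using \<psi> eq by (simp add: E_def)
  qed
  have contL: "continuous_on (lipschitz_pd (K / l)) (pairing v)"
    by (rule continuous_on_lipschitz_pd[where c = K])
       (rule pairing_diff_le[OF C], auto simp: lipschitz_pd_def bl_def)
  have "compact E"
    unfolding E_def
      using closedin_compact[OF compact_lipschitz_pd continuous_closedin_preimage_constant[OF contL]] .
  moreover have "E \<noteq> {}" using E \<phi>m(1) l_def by blast
  moreover have "continuous_on E sqnorm"
  proof (rule continuous_on_subset)
    show "continuous_on (lipschitz_pd (K / l)) sqnorm"
      by (rule continuous_on_lipschitz_pd[where c = 2], rule sqnorm_diff_le)
         (use normalized_pd_norm_le lipschitz_pd_subset in \<open>blast intro: BL_imp_bl lipschitz_pd_BL\<close>)+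
  qed (auto simp: E_def)
  ultimately obtain \<phi> where "\<phi> \<in> E" and max: "\<And>\<psi>. \<psi> \<in> E \<Longrightarrow> sqnorm \<psi> \<le> sqnorm \<phi>"
    using continuous_attains_sup[of E sqnorm] by blast
  then have \<phi>: "\<phi> \<in> normalized_pd" "pairing v \<phi> = l" "bl \<phi>" "positive_definite \<phi>" "\<phi> 0 = 1"
    using lipschitz_pd_subset by (auto simp: E_def normalized_pd_def)
  have tilt: "(1 + c * cnj c) * \<phi> x + c * \<phi> (x + a) + cnj c * \<phi> (x - a) = (5 / 4 + 2 * Re (c * \<phi> a)) * \<phi> x"
    if c: "norm c = 1 / 2" for c a x
  proof -
    define \<tau> where "\<tau> d = (\<lambda>x. (1 + d * cnj d) * \<phi> x + d * \<phi> (x + a) + cnj d * \<phi> (x - a))" for d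
    define p q where "p = 5 / 4 + 2 * Re (c * \<phi> a)" and "q = 5 / 4 - 2 * Re (c * \<phi> a)"
    have cc: "c * cnj c = 1 / 4"
      using complex_norm_square[of c] c by (simp add: power2_eq_square)
    have bl: "bl (\<tau> d)" for d
      unfolding \<tau>_def by (intro bl_add bl_cmult bl_shift[OF \<phi>(3)] bl_shift_diff[OF \<phi>(3)] \<phi>(3))
    have pd: "positive_definite (\<tau> d)" for d
      unfolding \<tau>_def by (rule pd_tilt[OF \<phi>(4)])
    have at0: "Re (\<tau> c 0) = p" "Re (\<tau> (- c) 0) = q"
      using pd_hermitian[OF \<phi>(4), of a] by (simp_all add: \<tau>_def p_def q_def \<phi>(5) cc)
    have "\<bar>Re (c * \<phi> a)\<bar> \<le> norm c * norm (\<phi> a)"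
      using abs_Re_le_cmod[of "c * \<phi> a"] by (simp add: norm_mult)
    also have "\<dots> \<le> 1 / 2 * 1"
      using normalized_pd_norm_le[OF \<phi>(1), of a] unfolding c by (intro mult_left_mono) auto
    finally have le: "\<bar>Re (c * \<phi> a)\<bar> \<le> 1 / 2" by simp
    have pq: "p > 0" "q > 0" "p + q = 5 / 2"
      using abs_le_D1[OF le] abs_le_D2[OF le] unfolding p_def q_def by linarith+
    define T S where "T = (\<lambda>x. of_real (1 / p) * \<tau> c x)" and "S = (\<lambda>x. of_real (1 / q) * \<tau> (- c) x)"
    have TS: "T \<in> normalized_pd" "S \<in> normalized_pd"
      using pd_normalize[OF pd bl, of c] pd_normalize[OF pd bl, of "- c"] pq at0
        by (auto simp: T_def S_def)
    then have blTS: "bl T" "bl S" by (auto simp: normalized_pd_def)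
    \<comment> \<open>The two tilts add up to \<open>5/2\<close> times \<open>\<phi>\<close>; with \<open>|c| = 1/2\<close> both \<open>p\<close> and \<open>q\<close> are positive.\<close>
    define a b where "a = p / (5 / 2)" and "b = q / (5 / 2)"
    have ab: "a > 0" "b > 0" "a + b = 1"
      using pq by (auto simp: a_def b_def simp flip: add_divide_distrib)
    have comb: "of_real a * T x + of_real b * S x = \<phi> x" for x
    proof -
      have TS_eq: "of_real a * T x = of_real (2 / 5) * \<tau> c x"
        "of_real b * S x = of_real (2 / 5) * \<tau> (- c) x"
        using pq by (simp_all add: a_def b_def T_def S_def)
      have sum_eq: "\<tau> c x + \<tau> (- c) x = of_real (5 / 2) * \<phi> x"
        by (simp add: \<tau>_def cc algebra_simps)
      show ?thesis unfolding TS_eq distrib_left[symmetric] sum_eq by simp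
    qed
    have "pairing v \<phi> = pairing v (\<lambda>x. of_real a * T x + of_real b * S x)"
      by (simp add: comb)
    also have "\<dots> = pairing v (\<lambda>x. of_real a * T x) + pairing v (\<lambda>x. of_real b * S x)"
      by (simp add: pairing_def convolution_add bl_autocorr v bl_cmult blTS)
    also have "\<dots> = a * pairing v T + b * pairing v S"
      by (simp add: pairing_scale v blTS)
    finally have sum: "l = a * pairing v T + b * pairing v S" using \<phi>(2) by simp
    have le: "pairing v T \<le> l" "pairing v S \<le> l" using \<phi>m(2) TS by (auto simp: l_def)
    have l_ab: "l = a * l + b * l" using ab(3) by (metis distrib_right mult_1)
    have "a * (l - pairing v T) + b * (l - pairing v S) = 0"
      using sum l_ab by (simp add: right_diff_distrib)
    moreover have "a * (l - pairing v T) \<ge> 0" "b * (l - pairing v S) \<ge> 0" using ab le by auto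
    ultimately have "a * (l - pairing v T) = 0" "b * (l - pairing v S) = 0" by linarith+
    then have "T \<in> E" "S \<in> E" using ab TS E by auto
    then have "a * sqnorm T \<le> a * sqnorm \<phi>" "b * sqnorm S \<le> b * sqnorm \<phi>"
      using max ab by (auto intro!: mult_left_mono)
    moreover have "sqnorm \<phi> = a * sqnorm \<phi> + b * sqnorm \<phi>" using ab(3)
      by (metis distrib_right mult_1)
    moreover have "sqnorm \<phi> = a * sqnorm T + b * sqnorm S - a * b * sqnorm (\<lambda>x. T x - S x)"
      using sqnorm_convex_combination[OF blTS ab(3)] by (simp add: comb)
    ultimately have "a * b * sqnorm (\<lambda>x. T x - S x) \<le> 0" by linarith
    then have "sqnorm (\<lambda>x. T x - S x) \<le> 0"
      using ab by (simp add: mult_le_0_iff)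
    then have "T x - S x = 0"
      by (intro sqnorm_eq_0[of "\<lambda>x. T x - S x"] bl_diff blTS)
    then have "of_real (a + b) * T x = \<phi> x"
      unfolding of_real_add distrib_right using comb[of x] by simp
    then have "T x = \<phi> x" by (simp add: ab(3))
    then have "\<tau> c x = of_real p * \<phi> x"
      using pq by (simp add: T_def field_simps)
    then show ?thesis by (simp add: \<tau>_def p_def)
  qed
  have "\<phi> (x + a) = \<phi> a * \<phi> x" for x a
    by (rule tilt_extremal_imp_multiplicative) (rule tilt)
  from multiplicative_pd_imp_character[OF \<phi>(1) this] show thesis
    using \<phi>(1,2) \<phi>m(2)[OF \<phi>0(1)] that unfolding l_def by simp
qed

lemma character_bl: "character \<xi> \<Longrightarrow> bl \<xi>"
  and character_add: "character \<xi> \<Longrightarrow> \<xi> (x + y) = \<xi> x * \<xi> y"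
  and character_norm: "character \<xi> \<Longrightarrow> norm (\<xi> x) = 1"
  by (auto simp: character_def)

lemma character_cnj: "character \<xi> \<Longrightarrow> \<xi> x * cnj (\<xi> x) = 1"
  using complex_norm_square[of "\<xi> x"] by (simp add: character_norm)

lemma character_diff:
  assumes "character \<xi>" shows "\<xi> (x - y) = \<xi> x * cnj (\<xi> y)"
proof -
  have "\<xi> x * cnj (\<xi> y) = \<xi> (x - y) * (\<xi> y * cnj (\<xi> y))"
    using character_add[OF assms, of "x - y" y] by simp
  then show ?thesis by (simp add: character_cnj[OF assms])
qed

definition fourier_coef :: "('g \<Rightarrow> complex) \<Rightarrow> ('g \<Rightarrow> complex) \<Rightarrow> complex" where
  "fourier_coef f \<xi> = mean (\<lambda>x. f x * cnj (\<xi> x))"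

section \<open>Bohr sets of almost periods\<close>

lemma pairing_character:
  assumes v: "bl v" and \<xi>: "character \<xi>"
  shows "pairing v \<xi> = (norm (fourier_coef v \<xi>))\<^sup>2"
proof -
  note bl = v character_bl[OF \<xi>]
  have inner: "mean (\<lambda>y. cnj (v z) * v y * \<xi> (z - y)) = fourier_coef v \<xi> * cnj (v z * cnj (\<xi> z))"
    for z
  proof -
    have "mean (\<lambda>y. cnj (v z) * v y * \<xi> (z - y)) = mean (\<lambda>y. cnj (v z) * \<xi> z * (v y * cnj (\<xi> y)))"
      by (simp add: character_diff[OF \<xi>] mult_ac)
    also have "\<dots> = cnj (v z) * \<xi> z * fourier_coef v \<xi>"
      unfolding fourier_coef_def by (rule mean_cmult) (intro bl_mult bl_cnj bl)
    finally show ?thesis by (simp add: mult_ac)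
  qed
  have "convolution (autocorr v) \<xi> 0 = mean (\<lambda>z. fourier_coef v \<xi> * cnj (v z * cnj (\<xi> z)))"
    using convolution_autocorr_diff[OF bl, of 0 0] by (simp add: inner)
  also have "\<dots> = fourier_coef v \<xi> * mean (\<lambda>z. cnj (v z * cnj (\<xi> z)))"
    by (rule mean_cmult) (intro bl_mult bl_cnj bl)
  also have "mean (\<lambda>z. cnj (v z * cnj (\<xi> z))) = cnj (fourier_coef v \<xi>)"
    unfolding fourier_coef_def by (rule mean_cnj) (intro bl_mult bl_cnj bl)
  finally show ?thesis
    unfolding pairing_def complex_norm_square[symmetric] by simp
qed

text \<open>The autocorrelation itself, normalized, is a competitor in the maximization of the pairing, and its
  pairing is its quadratic mean divided by its value at \<open>0\<close>. Both are controlled by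
  \<open>sqnorm_lower_bound\<close>, applied first to \<open>v\<close> and then to the autocorrelation.\<close>

lemma fourier_coef_lower_bound:
  assumes L: "L \<ge> 0" and e: "e > 0"
  obtains c where "c > 0"
    "\<And>v x. BL L v \<Longrightarrow> e \<le> norm (v x) \<Longrightarrow> \<exists>\<xi>. character \<xi> \<and> c \<le> norm (fourier_coef v \<xi>)"
proof -
  obtain c1 where c1: "c1 > 0" "\<And>u x. BL L u \<Longrightarrow> e \<le> norm (u x) \<Longrightarrow> c1 \<le> sqnorm u"
    using sqnorm_lower_bound[OF L e] by blast
  have L2: "2 * L * L \<ge> 0" using L by simp
  \<comment> \<open>The value of the autocorrelation at \<open>0\<close> is the quadratic mean of \<open>v\<close>, so \<open>c1\<close> bounds it from below.\<close>
  obtain c2 where c2: "c2 > 0" "\<And>u x. BL (2 * L * L) u \<Longrightarrow> c1 \<le> norm (u x) \<Longrightarrow> c2 \<le> sqnorm u"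
    using sqnorm_lower_bound[OF L2 c1(1)] by blast
  define c3 where "c3 = c2 / (2 * L * L + 1)"
  have c3: "c3 > 0" unfolding c3_def using c2(1) L2 by (intro divide_pos_pos) linarith+
  have "\<exists>\<xi>. character \<xi> \<and> sqrt c3 \<le> norm (fourier_coef v \<xi>)" if v: "BL L v" and x: "e \<le> norm (v x)"
    for v x
  proof -
    let ?C = "autocorr v" and ?a = "Re (autocorr v 0)"
    note bl = BL_imp_bl[OF v]
    have C: "BL (2 * L * L) ?C" by (rule BL_autocorr[OF v])
    have a: "?a = sqnorm v" by (simp add: autocorr_def sqnorm_def)
    have "c1 \<le> ?a" unfolding a by (rule c1(2)[OF v x])
    then have apos: "?a > 0" and "c1 \<le> norm (?C 0)"
      using c1(1) complex_Re_le_cmod[of "?C 0"] by linarith+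
    then have c2le: "c2 \<le> sqnorm ?C" using c2(2)[OF C] by blast
    have "?a \<le> 2 * L * L + 1"
      using complex_Re_le_cmod[of "?C 0"] BL_norm[OF C, of 0] by linarith
    then have "c3 \<le> sqnorm ?C / ?a"
      unfolding c3_def using c2le c2(1) apos by (intro frac_le) auto
    also have "sqnorm ?C = pairing v ?C"
      using convolution_commute[OF bl_autocorr[OF bl] bl_autocorr[OF bl], of 0] pd_hermitian[OF pd_autocorr[OF bl]]
      by (simp add: pairing_def sqnorm_def mult.commute)
    also have "pairing v ?C / ?a = pairing v (\<lambda>x. of_real (1 / ?a) * ?C x)"
      by (subst pairing_scale[OF bl bl_autocorr[OF bl]]) simp
    finally have le: "c3 \<le> pairing v (\<lambda>x. of_real (1 / ?a) * ?C x)" .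
    obtain \<xi> where "character \<xi>" "pairing v (\<lambda>x. of_real (1 / ?a) * ?C x) \<le> pairing v \<xi>"
      using eigencharacter_exists[OF bl pd_normalize[OF pd_autocorr[OF bl] bl_autocorr[OF bl] apos]] le c3
      by (metis less_le_trans)
    with le have "character \<xi>" "c3 \<le> (norm (fourier_coef v \<xi>))\<^sup>2"
      by (simp_all add: pairing_character[OF bl])
    then show ?thesis by (intro exI[of _ \<xi>] conjI real_le_lsqrt) auto
  qed
  with c3 show thesis using that[of "sqrt c3"] by simp
qed

lemma characters_orthogonal:
  assumes \<xi>: "character \<xi>" and \<eta>: "character \<eta>" and ne: "\<xi> \<noteq> \<eta>"
  shows "fourier_coef \<xi> \<eta> = 0"
proof -
  obtain t where t: "\<xi> t \<noteq> \<eta> t" using ne by blast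
  have bl: "bl (\<lambda>x. \<xi> x * cnj (\<eta> x))" by (intro bl_mult bl_cnj character_bl \<xi> \<eta>)
  have "fourier_coef \<xi> \<eta> = mean (\<lambda>x. \<xi> (x + t) * cnj (\<eta> (x + t)))"
    unfolding fourier_coef_def by (rule mean_shift[OF bl, symmetric])
  also have "\<dots> = mean (\<lambda>x. (\<xi> t * cnj (\<eta> t)) * (\<xi> x * cnj (\<eta> x)))"
    by (simp add: character_add[OF \<xi>] character_add[OF \<eta>] mult_ac)
  also have "\<dots> = (\<xi> t * cnj (\<eta> t)) * fourier_coef \<xi> \<eta>"
    unfolding fourier_coef_def by (rule mean_cmult[OF bl])
  finally have "fourier_coef \<xi> \<eta> * (1 - \<xi> t * cnj (\<eta> t)) = 0" by (simp add: algebra_simps)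
  moreover have "\<xi> t * cnj (\<eta> t) \<noteq> 1"
  proof
    assume "\<xi> t * cnj (\<eta> t) = 1"
    then have "\<xi> t * (\<eta> t * cnj (\<eta> t)) = \<eta> t" by (simp add: mult_ac)
    with t show False by (simp add: character_cnj[OF \<eta>])
  qed
  ultimately show ?thesis by simp
qed

text \<open>The function \<open>g\<close> in the induction is \<open>f\<close> minus its Fourier sum over \<open>S\<close>.\<close>

lemma bessel_inequality:
  assumes f: "bl f" and S: "finite S" "\<And>\<xi>. \<xi> \<in> S \<Longrightarrow> character \<xi>"
  shows "(\<Sum>\<xi>\<in>S. (norm (fourier_coef f \<xi>))\<^sup>2) \<le> sqnorm f"
proof -
  have "\<exists>g. bl g \<and> sqnorm g = sqnorm f - (\<Sum>\<xi>\<in>S. (norm (fourier_coef f \<xi>))\<^sup>2)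
      \<and> (\<forall>\<eta>. character \<eta> \<longrightarrow> \<eta> \<notin> S \<longrightarrow> fourier_coef g \<eta> = fourier_coef f \<eta>)"
    using S
  proof (induction S rule: finite_induct)
    case empty
    show ?case by (rule exI[of _ f]) (simp add: f)
  next
    case (insert \<xi> S)
    then obtain g where g: "bl g" "sqnorm g = sqnorm f - (\<Sum>\<xi>\<in>S. (norm (fourier_coef f \<xi>))\<^sup>2)"
      "\<And>\<eta>. character \<eta> \<Longrightarrow> \<eta> \<notin> S \<Longrightarrow> fourier_coef g \<eta> = fourier_coef f \<eta>" by (metis insertCI)
    have \<xi>: "character \<xi>" using insert by simp
    define c where "c = fourier_coef f \<xi>"
    have c: "mean (\<lambda>x. g x * cnj (\<xi> x)) = c" using g(3)[OF \<xi>] insert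
      by (simp add: c_def fourier_coef_def)
    define h where "h = (\<lambda>x. g x - c * \<xi> x)"
    note bls = g(1) character_bl[OF \<xi>]
    have h: "bl h" unfolding h_def by (intro bl_diff bl_cmult bls)
    have "h x * cnj (h x) = (g x * cnj (g x) - (cnj c * (g x * cnj (\<xi> x)) + c * cnj (g x * cnj (\<xi> x))))
        + c * cnj c" for x
      using character_cnj[OF \<xi>, of x] by (simp add: h_def algebra_simps)
    then have "mean (\<lambda>x. h x * cnj (h x)) = (mean (\<lambda>x. g x * cnj (g x)) - (cnj c * c + c * cnj c)) + c * cnj c"
      by (simp only: mean_add mean_diff mean_cmult mean_cnj mean_const bl_add bl_diff bl_cmult bl_mult
          bl_cnj bl_const bls c)
    then have "mean (\<lambda>x. h x * cnj (h x)) = mean (\<lambda>x. g x * cnj (g x)) - of_real ((norm c)\<^sup>2)"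
      unfolding complex_norm_square by (simp add: mult.commute)
    then have "sqnorm h = sqnorm g - (norm c)\<^sup>2"
      unfolding sqnorm_def by (simp only: minus_complex.sel Re_complex_of_real)
    moreover have "fourier_coef h \<eta> = fourier_coef g \<eta>" if \<eta>: "character \<eta>" "\<eta> \<noteq> \<xi>" for \<eta>
    proof -
      note blx = bls character_bl[OF \<eta>(1)]
      have "fourier_coef h \<eta> = mean (\<lambda>x. g x * cnj (\<eta> x) - c * (\<xi> x * cnj (\<eta> x)))"
        by (simp add: fourier_coef_def h_def algebra_simps)
      also have "\<dots> = fourier_coef g \<eta> - c * fourier_coef \<xi> \<eta>"
        unfolding fourier_coef_def by (simp only: mean_diff mean_cmult bl_cmult bl_mult bl_cnj blx)
      finally show ?thesis using characters_orthogonal[OF \<xi> \<eta>(1)] \<eta>(2) by simp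
    qed
    ultimately show ?case
      using h g insert.hyps by (intro exI[of _ h]) (auto simp: c_def)
  qed
  then obtain g where g: "bl g" "sqnorm g = sqnorm f - (\<Sum>\<xi>\<in>S. (norm (fourier_coef f \<xi>))\<^sup>2)" by blast
  have "sqnorm g \<ge> 0"
    unfolding sqnorm_def by (intro mean_Re_nonneg bl_mult bl_cnj g(1)) (simp add: complex_mult_cnj)
  with g(2) show ?thesis by simp
qed

lemma finite_large_fourier_coefs:
  assumes f: "bl f" and c: "c > 0"
  shows "finite {\<xi>. character \<xi> \<and> c \<le> norm (fourier_coef f \<xi>)}" (is "finite ?A")
proof (rule ccontr)
  assume inf: "infinite ?A"
  obtain n :: nat where n: "sqnorm f / c\<^sup>2 < n" using reals_Archimedean2 by blast
  obtain S where S: "finite S" "card S = n" "S \<subseteq> ?A"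
    using infinite_arbitrarily_large[OF inf] by blast
  have "real n * c\<^sup>2 = (\<Sum>\<xi>\<in>S. c\<^sup>2)" using S by simp
  also have "\<dots> \<le> (\<Sum>\<xi>\<in>S. (norm (fourier_coef f \<xi>))\<^sup>2)"
    using S c by (intro sum_mono power_mono) auto
  also have "\<dots> \<le> sqnorm f" by (rule bessel_inequality[OF f S(1)]) (use S in auto)
  finally show False using n c by (simp add: divide_less_eq)
qed

text \<open>If \<open>t\<close> is not an \<open>e\<close>-almost period, some character \<open>\<xi>\<close> has a coefficient of size at least \<open>c\<close> against
  \<open>f(\<cdot> + t) - f\<close>. That coefficient is \<open>(\<xi> t - 1) \<cdot> fourier_coef f \<xi>\<close> and \<open>|\<xi> t - 1| \<le> 2\<close>, so the
  coefficient of \<open>f\<close> is at least \<open>c / 2\<close> and \<open>\<xi>\<close> belongs to a finite set depending only on \<open>f\<close> and \<open>e\<close>.\<close>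

theorem characters_detect_almost_periods:
  assumes f: "bl f" and e: "e > 0"
  obtains \<Phi> d where "finite \<Phi>" "\<And>\<xi>. \<xi> \<in> \<Phi> \<Longrightarrow> character \<xi>" "d > 0"
    "\<And>t x. (\<And>\<xi>. \<xi> \<in> \<Phi> \<Longrightarrow> norm (\<xi> t - 1) < d) \<Longrightarrow> norm (f (x + t) - f x) < e"
proof -
  obtain L where L: "BL L f" using f by (auto simp: bl_def)
  have L0: "L \<ge> 0" by (rule BL_nonneg[OF L])
  then have "L + norm (- 1 :: complex) * L \<ge> 0" by simp
  then obtain c where c: "c > 0" "\<And>v x. BL (L + norm (- 1 :: complex) * L) v \<Longrightarrow> e \<le> norm (v x)
      \<Longrightarrow> \<exists>\<xi>. character \<xi> \<and> c \<le> norm (fourier_coef v \<xi>)"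
    using fourier_coef_lower_bound[OF _ e] by metis
  define \<Phi> where "\<Phi> = {\<xi>. character \<xi> \<and> c / 2 \<le> norm (fourier_coef f \<xi>)}"
  show thesis
  proof
    show "finite \<Phi>" unfolding \<Phi>_def using finite_large_fourier_coefs[OF f, of "c / 2"] c(1) by simp
    show "character \<xi>" if "\<xi> \<in> \<Phi>" for \<xi> using that by (simp add: \<Phi>_def)
    show "c / (L + 1) > 0" using c(1) L0 by simp
    fix t x assume small: "\<And>\<xi>. \<xi> \<in> \<Phi> \<Longrightarrow> norm (\<xi> t - 1) < c / (L + 1)"
    show "norm (f (x + t) - f x) < e"
    proof (rule ccontr)
      assume large: "\<not> norm (f (x + t) - f x) < e"
      define v where "v = (\<lambda>x. f (x + t) + (- 1) * f x)"
      have "BL (L + norm (- 1 :: complex) * L) v" unfolding v_def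
        by (intro BL_add BL_cmult BL_shift L)
      moreover have "e \<le> norm (v x)" using large by (simp add: v_def)
      ultimately obtain \<xi> where \<xi>: "character \<xi>" "c \<le> norm (fourier_coef v \<xi>)" using c(2) by blast
      note bls = f character_bl[OF \<xi>(1)]
      have bl: "bl (\<lambda>x. f x * cnj (\<xi> x))" by (intro bl_mult bl_cnj bls)
      have "v x * cnj (\<xi> x) = \<xi> t * (f (x + t) * cnj (\<xi> (x + t))) - f x * cnj (\<xi> x)" for x
        using character_cnj[OF \<xi>(1), of t]
        by (simp add: v_def character_add[OF \<xi>(1)] algebra_simps)
      then have "fourier_coef v \<xi> = mean (\<lambda>x. \<xi> t * (f (x + t) * cnj (\<xi> (x + t))) - f x * cnj (\<xi> x))"
        by (simp add: fourier_coef_def)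
      also have "\<dots> = \<xi> t * mean (\<lambda>x. f (x + t) * cnj (\<xi> (x + t))) - fourier_coef f \<xi>"
        unfolding fourier_coef_def by (simp only: mean_diff mean_cmult bl_cmult bl_shift[OF bl] bl)
      also have "\<dots> = (\<xi> t - 1) * fourier_coef f \<xi>"
        by (simp only: mean_shift[OF bl]) (simp add: fourier_coef_def algebra_simps)
      finally have le: "c \<le> norm (\<xi> t - 1) * norm (fourier_coef f \<xi>)" using \<xi>(2)
        by (simp add: norm_mult)
      have "norm (\<xi> t - 1) \<le> 2"
        using norm_triangle_ineq4[of "\<xi> t" 1] by (simp add: character_norm[OF \<xi>(1)])
      then have "norm (\<xi> t - 1) * norm (fourier_coef f \<xi>) \<le> 2 * norm (fourier_coef f \<xi>)"
        by (intro mult_right_mono) auto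
      with le have "\<xi> \<in> \<Phi>" using \<xi>(1) by (simp add: \<Phi>_def)
      moreover have "norm (fourier_coef f \<xi>) \<le> L"
        unfolding fourier_coef_def by (rule mean_norm_le[OF bl])
          (simp add: norm_mult character_norm[OF \<xi>(1)] BL_norm[OF L])
      ultimately have "norm (\<xi> t - 1) * norm (fourier_coef f \<xi>) \<le> c / (L + 1) * L"
        using small c(1) L0 by (intro mult_mono) (auto intro: less_imp_le)
      also have "\<dots> < c" using c(1) L0 by (simp add: field_simps)
      finally show False using le by simp
    qed
  qed
qed

end

text \<open>The previous theorem for \<open>D t = (SUP x. |f (x + t) - f x|)\<close>. The fifth conclusion records that
  the characters are as continuous as the translation of \<open>f\<close>; it yields their continuity on a
  topological group and their triviality on the periods of \<open>f\<close>.\<close>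

theorem almost_periods_contain_bohr_set:
  fixes f :: "'g::ab_group_add \<Rightarrow> complex"
  assumes bd: "\<And>x. norm (f x) \<le> B"
    and net: "\<And>r. r > 0 \<Longrightarrow> \<exists>F. finite F \<and> (\<forall>t. \<exists>s\<in>F. \<forall>x. norm (f (x + t) - f (x + s)) \<le> r)"
    and e: "e > 0"
  obtains \<Phi> :: "('g \<Rightarrow> complex) set" and d :: real where "finite \<Phi>" "d > 0"
    "\<And>\<xi> x y. \<xi> \<in> \<Phi> \<Longrightarrow> \<xi> (x + y) = \<xi> x * \<xi> y" "\<And>\<xi> x. \<xi> \<in> \<Phi> \<Longrightarrow> norm (\<xi> x) = 1"
    "\<And>\<xi> r. \<xi> \<in> \<Phi> \<Longrightarrow> r > 0 \<Longrightarrow> \<exists>r'>0. \<forall>t. (\<forall>x. norm (f (x + t) - f x) \<le> r') \<longrightarrow> norm (\<xi> t - 1) \<le> r"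
    "\<And>t x. (\<And>\<xi>. \<xi> \<in> \<Phi> \<Longrightarrow> norm (\<xi> t - 1) < d) \<Longrightarrow> norm (f (x + t) - f x) < e"
proof -
  define D where "D t = (SUP x. norm (f (x + t) - f x))" for t
  have bdd: "bdd_above (range (\<lambda>x. norm (f (x + t) - f x)))" for t
  proof (rule bdd_aboveI2)
    show "norm (f (x + t) - f x) \<le> B + B" for x
      using norm_triangle_ineq4[of "f (x + t)" "f x"] bd[of "x + t"] bd[of x] by linarith
  qed
  have le_D: "norm (f (x + t) - f x) \<le> D t" for x t
    unfolding D_def by (rule cSUP_upper[OF UNIV_I bdd])
  have D_le: "D t \<le> r" if "\<And>x. norm (f (x + t) - f x) \<le> r" for t r
    unfolding D_def by (rule cSUP_least) (use that in auto)
  interpret totally_bounded_seminorm D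
  proof
    show "D 0 = 0" by (simp add: D_def)
    have "D (- x) \<le> D x" for x
      by (rule D_le) (use le_D[of "_ - x" x] in \<open>simp add: norm_minus_commute\<close>)
    from this this[of "- x" for x] show "D (- x) = D x" for x by (simp add: order_antisym)
    show "D (x + y) \<le> D x + D y" for x y
    proof (rule D_le)
      fix z
      show "norm (f (z + (x + y)) - f z) \<le> D x + D y"
        using norm_triangle_ineq[of "f (z + y + x) - f (z + y)" "f (z + y) - f z"]
          le_D[of "z + y" x] le_D[of z y] by (simp add: algebra_simps)
    qed
    fix r :: real assume r: "r > 0"
    obtain F where F: "finite F" "\<And>t. \<exists>s\<in>F. \<forall>x. norm (f (x + t) - f (x + s)) \<le> r / 2"
      using net[of "r / 2"] r by auto
    have "\<exists>s\<in>F. D (t - s) < r" for t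
    proof -
      obtain s where s: "s \<in> F" "\<And>x. norm (f (x + t) - f (x + s)) \<le> r / 2" using F(2) by blast
      have "D (t - s) \<le> r / 2"
        by (rule D_le) (use s(2)[of "_ - s"] in \<open>simp add: algebra_simps\<close>)
      with s(1) r show ?thesis by force
    qed
    with F(1) show "\<exists>F. finite F \<and> (\<forall>t. \<exists>s\<in>F. D (t - s) < r)" by blast
  qed
  have "BL (max 1 B) f"
    unfolding BL_def
  proof (intro conjI allI)
    show "norm (f x) \<le> max 1 B" for x using bd[of x] by simp
    show "norm (f (x + t) - f x) \<le> max 1 B * D t" for x t
      using le_D[of x t] mult_right_mono[OF max.cobounded1[of 1 B] D_nonneg[of t]] by simp
  qed
  then have "bl f" by (rule BL_imp_bl)
  from characters_detect_almost_periods[OF this e]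
  obtain \<Phi> d where \<Phi>: "finite \<Phi>" "\<And>\<xi>. \<xi> \<in> \<Phi> \<Longrightarrow> character \<xi>" "d > 0"
    "\<And>t x. (\<And>\<xi>. \<xi> \<in> \<Phi> \<Longrightarrow> norm (\<xi> t - 1) < d) \<Longrightarrow> norm (f (x + t) - f x) < e" by metis
  show thesis
  proof (rule that[OF \<Phi>(1,3)])
    fix \<xi> assume "\<xi> \<in> \<Phi>"
    then have \<xi>: "character \<xi>" by (rule \<Phi>(2))
    show "\<xi> (x + y) = \<xi> x * \<xi> y" "norm (\<xi> x) = 1" for x y
      using character_add[OF \<xi>] character_norm[OF \<xi>] by auto
    fix r :: real assume r: "r > 0"
    obtain L where L: "BL L \<xi>" using character_bl[OF \<xi>] by (auto simp: bl_def)
    have L0: "L \<ge> 0" by (rule BL_nonneg[OF L])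
    have "norm (\<xi> t - 1) \<le> r" if "\<And>x. norm (f (x + t) - f x) \<le> r / (L + 1)" for t
    proof -
      have "\<xi> 0 = 1"
        using character_add[OF \<xi>, of 0 0] character_norm[OF \<xi>, of 0] by auto
      then have "norm (\<xi> t - 1) \<le> L * D t" using BL_lip[OF L, of 0 t] by simp
      also have "\<dots> \<le> L * (r / (L + 1))" using D_le[OF that] L0 by (intro mult_left_mono) auto
      also have "\<dots> \<le> r" using L0 r by (simp add: field_simps)
      finally show ?thesis .
    qed
    then show "\<exists>r'>0. \<forall>t. (\<forall>x. norm (f (x + t) - f x) \<le> r') \<longrightarrow> norm (\<xi> t - 1) \<le> r"
      using r L0 by (intro exI[of _ "r / (L + 1)"]) auto
  qed (rule \<Phi>(4))
qed

section \<open>Locally compact abelian groups and the Bohr compactification\<close>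

lemma continuous_map_complex_metric:
  fixes f :: "'a \<Rightarrow> complex"
  shows "continuous_map X euclidean f \<longleftrightarrow>
    (\<forall>x\<in>topspace X. \<forall>e>0. \<exists>U. openin X U \<and> x \<in> U \<and> (\<forall>y\<in>U. norm (f y - f x) < e))"
  using Met_TC.continuous_map_to_metric[of X f]
    by (simp add: dist_norm norm_minus_commute[of "f _" "f (_::'a)"])

lemma continuous_map_complex_mult:
  fixes f g :: "'a \<Rightarrow> complex"
  shows "continuous_map X euclidean f \<Longrightarrow> continuous_map X euclidean g \<Longrightarrow>
    continuous_map X euclidean (\<lambda>x. f x * g x)"
  by (simp add: continuous_map_atin tendsto_mult)

context lcag
begin

lemma continuous_map_product:
  assumes "continuous_map X (gtop G) f" "continuous_map X (gtop G) g"
  shows "continuous_map X (gtop G) (\<lambda>x. f x \<otimes> g x)"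
  using continuous_map_compose[OF continuous_map_pairedI[OF assms] continuous_mult]
  by (simp add: o_def)

lemma continuous_map_inverse:
  assumes "continuous_map X (gtop G) f" shows "continuous_map X (gtop G) (\<lambda>x. inv (f x))"
  using continuous_map_compose[OF assms continuous_inv] by (simp add: o_def)

lemma continuous_map_right_mult:
  "a \<in> carrier G \<Longrightarrow> continuous_map (gtop G) (gtop G) (\<lambda>x. x \<otimes> a)"
  by (intro continuous_map_product) (simp_all add: topspace_gtop continuous_map_const)

lemma openin_right_translate:
  assumes "openin (gtop G) U" "a \<in> carrier G"
  shows "openin (gtop G) {x \<in> carrier G. x \<otimes> a \<in> U}"
  using openin_continuous_map_preimage[OF continuous_map_right_mult[OF assms(2)] assms(1)]
  by (simp add: topspace_gtop)

lemma mult_inv_cancel: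
  assumes "a \<in> carrier G" "b \<in> carrier G" "c \<in> carrier G"
  shows "(a \<otimes> inv b) \<otimes> (b \<otimes> inv c) = a \<otimes> inv c"
proof -
  have "inv b \<otimes> (b \<otimes> inv c) = inv c"
    using assms by (simp flip: m_assoc)
  with assms show ?thesis by (simp add: m_assoc)
qed

lemma divide_neighbourhood:
  assumes "openin (gtop G) V" "\<one> \<in> V"
  obtains U where "openin (gtop G) U" "\<one> \<in> U" "\<And>a b. a \<in> U \<Longrightarrow> b \<in> U \<Longrightarrow> a \<otimes> inv b \<in> V"
proof -
  let ?m = "\<lambda>p. fst p \<otimes> inv (snd p)"
  have "continuous_map (prod_topology (gtop G) (gtop G)) (gtop G) ?m"
    by (intro continuous_map_product continuous_map_inverse continuous_map_fst continuous_map_snd)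
  from openin_continuous_map_preimage[OF this assms(1)]
  have op: "openin (prod_topology (gtop G) (gtop G)) {p \<in> carrier G \<times> carrier G. ?m p \<in> V}" (is "openin _ ?S")
    by (simp add: topspace_gtop)
  have one: "(\<one>, \<one>) \<in> ?S" using assms by simp
  obtain A B where AB: "openin (gtop G) A" "openin (gtop G) B" "\<one> \<in> A" "\<one> \<in> B" "A \<times> B \<subseteq> ?S"
    using op[unfolded openin_prod_topology_alt, rule_format, OF one] by auto
  show thesis
  proof (rule that[of "A \<inter> B"])
    show "a \<otimes> inv b \<in> V" if "a \<in> A \<inter> B" "b \<in> A \<inter> B" for a b
      using AB(5) that by auto
  qed (use AB in auto)
qed

lemma mult_neighbourhood:
  assumes "openin (gtop G) V" "\<one> \<in> V"
  obtains U where "openin (gtop G) U" "\<one> \<in> U" "\<And>a b. a \<in> U \<Longrightarrow> b \<in> U \<Longrightarrow> a \<otimes> b \<in> V"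
proof -
  obtain A where A: "openin (gtop G) A" "\<one> \<in> A" "\<And>a b. a \<in> A \<Longrightarrow> b \<in> A \<Longrightarrow> a \<otimes> inv b \<in> V"
    using divide_neighbourhood[OF assms] by blast
  have sub: "A \<subseteq> carrier G" using openin_subset[OF A(1)] by (simp add: topspace_gtop)
  let ?U = "A \<inter> {x \<in> carrier G. inv x \<in> A}"
  have "openin (gtop G) ?U"
    using openin_continuous_map_preimage[OF continuous_inv A(1)] A(1)
      by (simp add: topspace_gtop openin_Int)
  moreover have "a \<otimes> b \<in> V" if "a \<in> ?U" "b \<in> ?U" for a b
    using A(3)[of a "inv b"] that by simp
  ultimately show thesis using that[of ?U] A(2) by simp
qed

end

lemma uniformly_continuous_imp_continuous_map:
  fixes G :: "'a top_group" (structure)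
  assumes G: "lcag G" and K: "lcag K" and h: "h \<in> carrier G \<rightarrow> carrier K"
    and uc: "uniformly_continuous_group_map G K h"
  shows "continuous_map (gtop G) (gtop K) h"
proof -
  interpret lcag G by (rule G)
  interpret K: lcag K by (rule K)
  have "\<exists>U. openin (gtop G) U \<and> x \<in> U \<and> U \<subseteq> {y \<in> carrier G. h y \<in> V}"
    if V: "openin (gtop K) V" and x: "x \<in> carrier G" "h x \<in> V" for V x
  proof -
    have hx: "h x \<in> carrier K" using h x by auto
    let ?V = "{k \<in> carrier K. k \<otimes>\<^bsub>K\<^esub> h x \<in> V}"
    have "openin (gtop K) ?V" "\<one>\<^bsub>K\<^esub> \<in> ?V"
      using K.openin_right_translate[OF V hx] x hx by auto
    then obtain U where U: "openin (gtop G) U" "\<one> \<in> U"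
      "\<And>a b. a \<in> carrier G \<Longrightarrow> b \<in> carrier G \<Longrightarrow> a \<otimes> inv b \<in> U \<Longrightarrow> h a \<otimes>\<^bsub>K\<^esub> inv\<^bsub>K\<^esub> (h b) \<in> ?V"
      using uc unfolding uniformly_continuous_group_map_def by meson
    show ?thesis
    proof (intro exI conjI)
      show "openin (gtop G) {y \<in> carrier G. y \<otimes> inv x \<in> U}"
        by (rule openin_right_translate) (use U x in auto)
      show "x \<in> {y \<in> carrier G. y \<otimes> inv x \<in> U}" using U x by simp
      show "{y \<in> carrier G. y \<otimes> inv x \<in> U} \<subseteq> {y \<in> carrier G. h y \<in> V}"
      proof clarify
        fix y assume y: "y \<in> carrier G" "y \<otimes> inv x \<in> U"
        then have "h y \<otimes>\<^bsub>K\<^esub> inv\<^bsub>K\<^esub> (h x) \<otimes>\<^bsub>K\<^esub> h x \<in> V" using U(3) x by blast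
        moreover have "h y \<in> carrier K" using h y by auto
        ultimately show "h y \<in> V" using hx by (simp add: K.m_assoc)
      qed
    qed
  qed
  then have "openin (gtop G) {y \<in> carrier G. h y \<in> V}" if "openin (gtop K) V" for V
    using that by (subst openin_subopen) blast
  then show ?thesis
    using h by (simp add: continuous_map_def topspace_gtop K.topspace_gtop)
qed

lemma carrier_dual_group:
  "\<xi> \<in> carrier (dual_group G) \<longleftrightarrow>
    \<xi> \<in> extensional (carrier G) \<and> \<xi> \<in> hom G circle_group \<and> continuous_map (gtop G) (gtop circle_group) \<xi>"
  by (simp add: dual_group_def Let_def)

lemma mult_dual_group: "\<xi> \<otimes>\<^bsub>dual_group G\<^esub> \<eta> = (\<lambda>x\<in>carrier G. \<xi> x * \<eta> x)"
  by (simp add: dual_group_def Let_def)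

lemma dual_group_hom:
  assumes "\<xi> \<in> carrier (dual_group G)"
  shows "x \<in> carrier G \<Longrightarrow> norm (\<xi> x) = 1"
    and "x \<in> carrier G \<Longrightarrow> y \<in> carrier G \<Longrightarrow> \<xi> (x \<otimes>\<^bsub>G\<^esub> y) = \<xi> x * \<xi> y"
  using assms by (auto simp: carrier_dual_group hom_def circle_group_def)

lemma dual_group_continuous:
  "\<xi> \<in> carrier (dual_group G) \<Longrightarrow> continuous_map (gtop G) euclidean \<xi>"
  by (auto simp: carrier_dual_group circle_group_def intro: continuous_map_into_fulltopology)

lemma gtop_dual_group:
  "gtop (dual_group G) = topology_generated_by
    {{\<xi> \<in> carrier (dual_group G). \<xi> ` K \<subseteq> U} | K U. compactin (gtop G) K \<and> openin (gtop circle_group) U}"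
  by (simp add: dual_group_def Let_def)

lemma discretization_simps:
  "carrier (discretization G) = carrier G" "mult (discretization G) = mult G"
  "gtop (discretization G) = discrete_topology (carrier G)"
  by (simp_all add: discretization_def)

lemma carrier_bohr:
  "\<eta> \<in> carrier (bohr G) \<longleftrightarrow> \<eta> \<in> extensional (carrier (dual_group G)) \<and>
    (\<forall>\<xi>\<in>carrier (dual_group G). norm (\<eta> \<xi>) = 1) \<and>
    (\<forall>\<xi>\<in>carrier (dual_group G). \<forall>\<psi>\<in>carrier (dual_group G). \<eta> (\<xi> \<otimes>\<^bsub>dual_group G\<^esub> \<psi>) = \<eta> \<xi> * \<eta> \<psi>)"
  unfolding bohr_def carrier_dual_group[of \<eta>]
  by (auto simp: discretization_simps hom_def circle_group_def continuous_map_from_discrete_topology Pi_iff)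

lemma topspace_dual_group: "topspace (gtop (dual_group G)) = carrier (dual_group G)"
  unfolding gtop_dual_group topology_generated_by_topspace
  by (auto intro!: exI[of _ "carrier (dual_group G)"] exI[of _ "{}"])

lemma topspace_bohr: "topspace (gtop (bohr G)) = carrier (bohr G)"
  unfolding bohr_def by (rule topspace_dual_group)

lemma openin_bohr_evaluation:
  assumes \<xi>: "\<xi> \<in> carrier (dual_group G)" and U: "open U"
  shows "openin (gtop (bohr G)) {\<eta> \<in> carrier (bohr G). \<eta> \<xi> \<in> U}"
proof -
  have "openin (gtop circle_group) ({z. norm z = 1} \<inter> U)"
    unfolding circle_group_def using U by (auto simp: openin_open)
  then have "openin (gtop (bohr G)) {\<eta> \<in> carrier (bohr G). \<eta> ` {\<xi>} \<subseteq> {z. norm z = 1} \<inter> U}"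
    unfolding bohr_def gtop_dual_group[of "discretization (dual_group G)"]
    by (intro topology_generated_by_Basis CollectI exI[of _ "{\<xi>}"] exI[of _ "{z. norm z = 1} \<inter> U"])
       (simp add: discretization_simps \<xi>)
  also have "{\<eta> \<in> carrier (bohr G). \<eta> ` {\<xi>} \<subseteq> {z. norm z = 1} \<inter> U} = {\<eta> \<in> carrier (bohr G). \<eta> \<xi> \<in> U}"
    using \<xi> by (auto simp: carrier_bohr)
  finally show ?thesis .
qed

lemma continuous_map_bohr_evaluation:
  "\<xi> \<in> carrier (dual_group G) \<Longrightarrow> continuous_map (gtop (bohr G)) euclidean (\<lambda>\<eta>. \<eta> \<xi>)"
  using openin_bohr_evaluation[of \<xi> G] by (simp add: continuous_map_def topspace_bohr)

text \<open>The compact-open topology on the dual of a discrete group is the topology of pointwise convergence, as the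
  compact subsets are finite.\<close>

lemma continuous_map_into_bohr:
  assumes F: "\<And>x. x \<in> topspace X \<Longrightarrow> F x \<in> carrier (bohr G)"
    and cont: "\<And>\<xi>. \<xi> \<in> carrier (dual_group G) \<Longrightarrow> continuous_map X euclidean (\<lambda>x. F x \<xi>)"
  shows "continuous_map X (gtop (bohr G)) F"
  unfolding bohr_def gtop_dual_group[of "discretization (dual_group G)"]
proof (rule continuous_on_generated_topo)
  let ?\<S> = "{{\<eta> \<in> carrier (dual_group (discretization (dual_group G))). \<eta> ` K \<subseteq> U} |K U.
    compactin (gtop (discretization (dual_group G))) K \<and> openin (gtop circle_group) U}"
  have "\<Union> ?\<S> = carrier (bohr G)"
    using topspace_bohr[of G] unfolding bohr_def gtop_dual_group[of "discretization (dual_group G)"]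
      topology_generated_by_topspace .
  then show "F ` topspace X \<subseteq> \<Union> ?\<S>" using F by auto
  fix W assume "W \<in> ?\<S>"
  then obtain K U where W: "W = {\<eta> \<in> carrier (bohr G). \<eta> ` K \<subseteq> U}"
    and K: "K \<subseteq> carrier (dual_group G)" "finite K" and U: "openin (gtop circle_group) U"
    by (auto simp: discretization_simps compactin_discrete_topology bohr_def)
  obtain U' where U': "open U'" "U = {z. norm z = 1} \<inter> U'"
    using U by (auto simp: circle_group_def openin_open)
  have "F -` W \<inter> topspace X = topspace X \<inter> (\<Inter>\<xi>\<in>K. {x \<in> topspace X. F x \<xi> \<in> U'})"
    using F K by (auto simp: W U' carrier_bohr)
  also have "openin X \<dots>"
  proof (cases "K = {}")
    case False
    have "openin X {x \<in> topspace X. F x \<xi> \<in> U'}" if "\<xi> \<in> K" for \<xi>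
      using openin_continuous_map_preimage[OF cont, of \<xi> U'] K U' that by auto
    with False K(2) show ?thesis
      by (intro openin_Int[OF openin_topspace openin_Inter]) auto
  qed simp
  finally show "openin X (F -` W \<inter> topspace X)" .
qed

lemma dual_group_mult_closed:
  fixes G :: "'a top_group"
  assumes G: "lcag G" and \<xi>: "\<xi> \<in> carrier (dual_group G)" and \<zeta>: "\<zeta> \<in> carrier (dual_group G)"
  shows "\<xi> \<otimes>\<^bsub>dual_group G\<^esub> \<zeta> \<in> carrier (dual_group G)"
proof -
  interpret lcag G by (rule G)
  let ?\<psi> = "\<lambda>x\<in>carrier G. \<xi> x * \<zeta> x"
  have "continuous_map (gtop G) euclidean ?\<psi>"
    by (rule continuous_map_eq[OF continuous_map_complex_mult[OF dual_group_continuous[OF \<xi>] dual_group_continuous[OF \<zeta>]]])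
       (simp add: topspace_gtop)
  then show ?thesis
    using dual_group_hom[OF \<xi>] dual_group_hom[OF \<zeta>]
    unfolding mult_dual_group carrier_dual_group
    by (auto simp: circle_group_def hom_def continuous_map_in_subtopology norm_mult topspace_gtop)
qed

lemma bohr_mult:
  fixes G :: "'a top_group"
  assumes G: "lcag G" and "\<eta> \<in> carrier (bohr G)" "\<psi> \<in> carrier (bohr G)"
  shows "\<eta> \<otimes>\<^bsub>bohr G\<^esub> \<psi> = (\<lambda>\<xi>\<in>carrier (dual_group G). \<eta> \<xi> * \<psi> \<xi>)"
    and "(\<lambda>\<xi>\<in>carrier (dual_group G). \<eta> \<xi> * \<psi> \<xi>) \<in> carrier (bohr G)"
proof -
  show "\<eta> \<otimes>\<^bsub>bohr G\<^esub> \<psi> = (\<lambda>\<xi>\<in>carrier (dual_group G). \<eta> \<xi> * \<psi> \<xi>)"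
    by (simp add: bohr_def mult_dual_group discretization_simps)
  have "\<xi> \<otimes>\<^bsub>dual_group G\<^esub> \<zeta> \<in> carrier (dual_group G)"
    if "\<xi> \<in> carrier (dual_group G)" "\<zeta> \<in> carrier (dual_group G)" for \<xi> \<zeta>
    by (rule dual_group_mult_closed[OF G that])
  then show "(\<lambda>\<xi>\<in>carrier (dual_group G). \<eta> \<xi> * \<psi> \<xi>) \<in> carrier (bohr G)"
    using assms by (auto simp: carrier_bohr norm_mult)
qed

lemma continuous_map_bohr_mult:
  fixes G :: "'a top_group"
  assumes G: "lcag G" and f: "continuous_map X (gtop (bohr G)) f"
    and g: "continuous_map X (gtop (bohr G)) g"
  shows "continuous_map X (gtop (bohr G)) (\<lambda>x. f x \<otimes>\<^bsub>bohr G\<^esub> g x)"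
proof -
  have carr: "f x \<in> carrier (bohr G)" "g x \<in> carrier (bohr G)" if "x \<in> topspace X" for x
    using that continuous_map_funspace[OF f] continuous_map_funspace[OF g] topspace_bohr[of G]
      by auto
  show ?thesis
  proof (rule continuous_map_into_bohr)
    show "f x \<otimes>\<^bsub>bohr G\<^esub> g x \<in> carrier (bohr G)" if "x \<in> topspace X" for x
      using bohr_mult[OF G carr[OF that]] by simp
    fix \<xi> assume \<xi>: "\<xi> \<in> carrier (dual_group G)"
    have "continuous_map X euclidean (\<lambda>x. f x \<xi> * g x \<xi>)"
      using continuous_map_complex_mult[OF continuous_map_compose[OF f continuous_map_bohr_evaluation[OF \<xi>]]
          continuous_map_compose[OF g continuous_map_bohr_evaluation[OF \<xi>]]]
      by (simp add: o_def)
    then show "continuous_map X euclidean (\<lambda>x. (f x \<otimes>\<^bsub>bohr G\<^esub> g x) \<xi>)"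
      by (rule continuous_map_eq) (simp add: bohr_mult(1)[OF G carr] \<xi>)
  qed
qed

lemma bohr_map_apply: "\<xi> \<in> carrier (dual_group G) \<Longrightarrow> bohr_map G x \<xi> = \<xi> x"
  by (simp add: bohr_map_def)

lemma bohr_map_in_carrier:
  assumes G: "lcag G" and x: "x \<in> carrier G" shows "bohr_map G x \<in> carrier (bohr G)"
proof -
  have "bohr_map G x (\<xi> \<otimes>\<^bsub>dual_group G\<^esub> \<psi>) = \<xi> x * \<psi> x"
    if "\<xi> \<in> carrier (dual_group G)" "\<psi> \<in> carrier (dual_group G)" for \<xi> \<psi>
    using bohr_map_apply[OF dual_group_mult_closed[OF G that]] x by (simp add: mult_dual_group)
  then show ?thesis
    unfolding carrier_bohr using dual_group_hom(1)[OF _ x]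
    by (auto simp: bohr_map_apply) (simp add: bohr_map_def)
qed

lemma bohr_map_mult:
  assumes G: "lcag G" and xy: "x \<in> carrier G" "y \<in> carrier G"
  shows "bohr_map G (x \<otimes>\<^bsub>G\<^esub> y) = bohr_map G x \<otimes>\<^bsub>bohr G\<^esub> bohr_map G y"
  unfolding bohr_mult(1)[OF G bohr_map_in_carrier[OF G xy(1)] bohr_map_in_carrier[OF G xy(2)]]
  using dual_group_hom(2)[OF _ xy] by (simp add: bohr_map_def cong: restrict_cong)

lemma continuous_map_bohr_map:
  assumes G: "lcag G" shows "continuous_map (gtop G) (gtop (bohr G)) (bohr_map G)"
proof (rule continuous_map_into_bohr)
  interpret lcag G by (rule G)
  show "bohr_map G x \<in> carrier (bohr G)" if "x \<in> topspace (gtop G)" for x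
    using bohr_map_in_carrier[OF G] that by (simp add: topspace_gtop)
  show "continuous_map (gtop G) euclidean (\<lambda>x. bohr_map G x \<xi>)" if "\<xi> \<in> carrier (dual_group G)"
    for \<xi>
    using dual_group_continuous[OF that] by (simp add: bohr_map_apply that)
qed

text \<open>The group \<open>G\<close> is a carrier set inside a type; its free abelian group is a whole type that maps onto \<open>G\<close>
  by a homomorphism \<open>h\<close>. The theorem is applied to \<open>f \<circ> h\<close> there. The characters that it yields
  are trivial on the kernel of \<open>h\<close>, because elements of the kernel are periods of \<open>f \<circ> h\<close>, and
  they descend to continuous characters of \<open>G\<close>.\<close>

theorem group_almost_periods_contain_bohr_set:
  fixes G :: "'a top_group" (structure) and f :: "'a \<Rightarrow> complex"
  assumes G: "lcag G"
    and bd: "\<And>x. x \<in> carrier G \<Longrightarrow> norm (f x) \<le> B"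
    and uc: "\<And>r. r > 0 \<Longrightarrow> \<exists>U. openin (gtop G) U \<and> \<one> \<in> U \<and>
      (\<forall>t\<in>U. \<forall>x\<in>carrier G. norm (f (x \<otimes> t) - f x) \<le> r)"
    and net: "\<And>r. r > 0 \<Longrightarrow> \<exists>F. finite F \<and> F \<subseteq> carrier G \<and>
      (\<forall>t\<in>carrier G. \<exists>s\<in>F. \<forall>x\<in>carrier G. norm (f (x \<otimes> t) - f (x \<otimes> s)) \<le> r)"
    and e: "e > 0"
  obtains \<Phi> d where "finite \<Phi>" "\<Phi> \<subseteq> carrier (dual_group G)" "d > 0"
    "\<And>t x. t \<in> carrier G \<Longrightarrow> x \<in> carrier G \<Longrightarrow> (\<And>\<xi>. \<xi> \<in> \<Phi> \<Longrightarrow> norm (\<xi> t - 1) < d)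
      \<Longrightarrow> norm (f (x \<otimes> t) - f x) < e"
proof -
  interpret lcag G by (rule G)
  obtain h where h: "h \<in> hom (free_Abelian_group UNIV) G"
    "\<And>x. h (frag_of x) = (if x \<in> carrier G then x else \<one>)"
    using free_Abelian_group_universal[of "\<lambda>x. if x \<in> carrier G then x else \<one>" UNIV] by auto
  have carr: "h a \<in> carrier G" and add: "h (a + b) = h a \<otimes> h b" for a b
    using h(1) by (auto simp: hom_def)
  have frag: "h (frag_of x) = x" if "x \<in> carrier G" for x using h(2) that by simp
  have zero: "h 0 = \<one>"
    using hom_one[OF h(1)] by simp
  have freenet: "\<exists>F. finite F \<and> (\<forall>t. \<exists>s\<in>F. \<forall>x. norm (f (h (x + t)) - f (h (x + s))) \<le> r)"
    if r: "r > 0" for r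
  proof -
    obtain F where F: "finite F" "F \<subseteq> carrier G"
      "\<And>t. t \<in> carrier G \<Longrightarrow> \<exists>s\<in>F. \<forall>x\<in>carrier G. norm (f (x \<otimes> t) - f (x \<otimes> s)) \<le> r"
      using net[OF r] by blast
    have "\<exists>s\<in>frag_of ` F. \<forall>x. norm (f (h (x + t)) - f (h (x + s))) \<le> r" for t
    proof -
      obtain s where "s \<in> F" "\<And>x. x \<in> carrier G \<Longrightarrow> norm (f (x \<otimes> h t) - f (x \<otimes> s)) \<le> r"
        using F(3)[OF carr] by blast
      then show ?thesis
        using F(2) by (intro bexI[of _ "frag_of s"]) (auto simp: add frag carr subset_iff)
    qed
    with F(1) show ?thesis by blast
  qed
  obtain \<Psi> :: "(('a \<Rightarrow>\<^sub>0 int) \<Rightarrow> complex) set" and d where \<Psi>: "finite \<Psi>" "d > 0"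
    and add\<Psi>: "\<And>\<xi> x y. \<xi> \<in> \<Psi> \<Longrightarrow> \<xi> (x + y) = \<xi> x * \<xi> y" and norm\<Psi>: "\<And>\<xi> x. \<xi> \<in> \<Psi> \<Longrightarrow> norm (\<xi> x) = 1"
    and cont\<Psi>: "\<And>\<xi> r. \<xi> \<in> \<Psi> \<Longrightarrow> r > 0 \<Longrightarrow>
      \<exists>r'>0. \<forall>t. (\<forall>x. norm (f (h (x + t)) - f (h x)) \<le> r') \<longrightarrow> norm (\<xi> t - 1) \<le> r"
    and det\<Psi>: "\<And>t x. (\<And>\<xi>. \<xi> \<in> \<Psi> \<Longrightarrow> norm (\<xi> t - 1) < d) \<Longrightarrow> norm (f (h (x + t)) - f (h x)) < e"
    using almost_periods_contain_bohr_set[of "\<lambda>a. f (h a)" B e, OF bd[OF carr] freenet e] by metis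
  have kernel: "\<xi> a = \<xi> b" if \<xi>: "\<xi> \<in> \<Psi>" and ab: "h a = h b" for \<xi> a b
  proof -
    have "h (a - b) \<otimes> h b = h b" using add[of "a - b" b] ab by simp
    then have t: "h (a - b) = \<one>" using carr[of b] carr[of "a - b"] by (metis r_cancel_one')
    have "norm (\<xi> (a - b) - 1) \<le> r" if "r > 0" for r
      using cont\<Psi>[OF \<xi> that] by (auto simp: add t carr)
    then have "\<xi> (a - b) = 1"
      by (metis field_le_epsilon norm_le_zero_iff right_minus_eq add_0)
    then show ?thesis using add\<Psi>[OF \<xi>, of "a - b" b] by simp
  qed
  define desc where "desc \<xi> = (\<lambda>x\<in>carrier G. \<xi> (frag_of x))" for \<xi> :: "('a \<Rightarrow>\<^sub>0 int) \<Rightarrow> complex"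
  have desc_h: "desc \<xi> (h a) = \<xi> a" if "\<xi> \<in> \<Psi>" for \<xi> a
    using kernel[OF that, of "frag_of (h a)" a] by (simp add: desc_def carr frag)
  have desc_mult: "desc \<xi> (x \<otimes> y) = desc \<xi> x * desc \<xi> y" if "\<xi> \<in> \<Psi>" "x \<in> carrier G" "y \<in> carrier G"
    for \<xi> x y
    using desc_h[OF that(1), of "frag_of x + frag_of y"] that
      by (simp add: add frag add\<Psi>) (simp add: desc_def)
  have desc_dual: "desc \<xi> \<in> carrier (dual_group G)" if \<xi>: "\<xi> \<in> \<Psi>" for \<xi>
  proof -
    have norm: "norm (desc \<xi> x) = 1" if "x \<in> carrier G" for x
      using that norm\<Psi>[OF \<xi>] by (simp add: desc_def)
    have "continuous_map (gtop G) euclidean (desc \<xi>)"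
      unfolding continuous_map_complex_metric topspace_gtop
    proof (intro ballI allI impI)
      fix x and r :: real assume x: "x \<in> carrier G" and r: "r > 0"
      obtain r' where r': "r' > 0"
        "\<And>t. (\<And>x. norm (f (h (x + t)) - f (h x)) \<le> r') \<Longrightarrow> norm (\<xi> t - 1) \<le> r / 2"
        using cont\<Psi>[OF \<xi>, of "r / 2"] r by auto
      obtain U where U: "openin (gtop G) U" "\<one> \<in> U"
        "\<And>t x. t \<in> U \<Longrightarrow> x \<in> carrier G \<Longrightarrow> norm (f (x \<otimes> t) - f x) \<le> r'"
        using uc[OF r'(1)] by blast
      show "\<exists>W. openin (gtop G) W \<and> x \<in> W \<and> (\<forall>y\<in>W. norm (desc \<xi> y - desc \<xi> x) < r)"
      proof (intro exI conjI ballI)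
        show "openin (gtop G) {y \<in> carrier G. y \<otimes> inv x \<in> U}"
          by (rule openin_right_translate) (use U x in auto)
        show "x \<in> {y \<in> carrier G. y \<otimes> inv x \<in> U}" using U x by simp
        fix y assume "y \<in> {y \<in> carrier G. y \<otimes> inv x \<in> U}"
        then have y: "y \<in> carrier G" "y \<otimes> inv x \<in> U" by auto
        let ?t = "y \<otimes> inv x"
        have t: "?t \<in> carrier G" using x y by simp
        have "norm (\<xi> (frag_of ?t) - 1) \<le> r / 2"
          by (rule r'(2)) (use U(3)[OF y(2) carr] t in \<open>simp add: add frag\<close>)
        then have small: "norm (desc \<xi> ?t - 1) \<le> r / 2" using t by (simp add: desc_def)
        have "desc \<xi> y = desc \<xi> ?t * desc \<xi> x"
          using desc_mult[OF \<xi> t x] x y by (simp add: m_assoc)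
        then have "norm (desc \<xi> y - desc \<xi> x) = norm ((desc \<xi> ?t - 1) * desc \<xi> x)"
          by (simp add: left_diff_distrib)
        with small norm[OF x] r show "norm (desc \<xi> y - desc \<xi> x) < r" by (simp add: norm_mult)
      qed
    qed
    then show ?thesis
      unfolding carrier_dual_group
      using norm desc_mult[OF \<xi>]
      by (auto simp: circle_group_def hom_def continuous_map_in_subtopology topspace_gtop)
         (simp add: desc_def)
  qed
  show thesis
  proof (rule that[of "desc ` \<Psi>" d])
    fix t x assume t: "t \<in> carrier G" and x: "x \<in> carrier G"
      and small: "\<And>\<xi>. \<xi> \<in> desc ` \<Psi> \<Longrightarrow> norm (\<xi> t - 1) < d"
    have "norm (f (h (frag_of x + frag_of t)) - f (h (frag_of x))) < e"
      by (rule det\<Psi>) (use small t in \<open>force simp: desc_def\<close>)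
    then show "norm (f (x \<otimes> t) - f x) < e" using t x by (simp add: add frag)
  qed (use \<Psi> desc_dual in auto)
qed

section \<open>Continuous extension of almost periodic functions\<close>

lemma Cu_D:
  assumes "h \<in> Cu G K"
  shows "x \<in> carrier G \<Longrightarrow> h x \<in> carrier K" "h \<in> carrier G \<rightarrow> carrier K"
    "uniformly_continuous_group_map G K h"
    "compactin (gtop K) (gtop K closure_of (h ` carrier G))"
  using assms by (auto simp: Cu_def)

lemma Cu_in_range_closure:
  assumes "lcag K" "h \<in> Cu G K" "x \<in> carrier G"
  shows "h x \<in> gtop K closure_of (h ` carrier G)"
proof -
  have "h ` carrier G \<subseteq> topspace (gtop K)"
    using Cu_D(1)[OF assms(2)] lcag.topspace_gtop[OF assms(1)] by auto
  from closure_of_subset[OF this] assms(3) show ?thesis by auto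
qed

lemma translate_in_Cu:
  fixes G :: "'a top_group" (structure)
  assumes G: "lcag G" and h: "h \<in> Cu G K" and t: "t \<in> carrier G"
  shows "translate G t h \<in> Cu G K"
proof -
  interpret lcag G by (rule G)
  have sub: "translate G t h ` carrier G \<subseteq> h ` carrier G"
    using t by (auto simp: translate_def)
  have "uniformly_continuous_group_map G K (translate G t h)"
    unfolding uniformly_continuous_group_map_def
  proof (intro allI impI)
    fix V assume "openin (gtop K) V \<and> \<one>\<^bsub>K\<^esub> \<in> V"
    then obtain U where U: "openin (gtop G) U" "\<one> \<in> U"
      "\<And>x y. x \<in> carrier G \<Longrightarrow> y \<in> carrier G \<Longrightarrow> x \<otimes> inv y \<in> U \<Longrightarrow> h x \<otimes>\<^bsub>K\<^esub> inv\<^bsub>K\<^esub> (h y) \<in> V"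
      using Cu_D(3)[OF h] unfolding uniformly_continuous_group_map_def by meson
    have "(x \<otimes> inv t) \<otimes> inv (y \<otimes> inv t) = x \<otimes> inv y" if "x \<in> carrier G" "y \<in> carrier G" for x y
      using mult_inv_cancel[OF that(1) t that(2)] that t by (simp add: inv_mult_group)
    then have "\<forall>x\<in>carrier G. \<forall>y\<in>carrier G. x \<otimes> inv y \<in> U \<longrightarrow>
        translate G t h x \<otimes>\<^bsub>K\<^esub> inv\<^bsub>K\<^esub> (translate G t h y) \<in> V"
      using U(3)[of "_ \<otimes> inv t" "_ \<otimes> inv t"] t by (simp add: translate_def)
    with U(1,2) show "\<exists>U. openin (gtop G) U \<and> \<one> \<in> U \<and> (\<forall>x\<in>carrier G. \<forall>y\<in>carrier G. x \<otimes> inv y \<in> U \<longrightarrow>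
        translate G t h x \<otimes>\<^bsub>K\<^esub> inv\<^bsub>K\<^esub> (translate G t h y) \<in> V)" by blast
  qed
  moreover have "compactin (gtop K) (gtop K closure_of (translate G t h ` carrier G))"
    by (rule closed_compactin[OF Cu_D(4)[OF h] closure_of_mono[OF sub] closedin_closure_of])
  moreover have "translate G t h \<in> carrier G \<rightarrow>\<^sub>E carrier K"
    using Cu_D(1)[OF h] t by (auto simp: translate_def)
  ultimately show ?thesis by (simp add: Cu_def)
qed

text \<open>Compactness of the closure of the translates gives finitely many small balls that contain all translates; one
  translate is chosen in each ball that contains any. Balls need not be open in \<open>Cu_topology\<close> as they
  are defined, so the cover uses the sets \<open>W k\<close> of functions having a smaller ball around them inside the
  ball of \<open>k\<close>.\<close>

lemma almost_periodic_translation_net: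
  fixes G :: "'a top_group" (structure)
  assumes G: "lcag G" and K: "lcag K" and ap: "almost_periodic G K h"
    and V: "openin (gtop K) V" "\<one>\<^bsub>K\<^esub> \<in> V"
  obtains F where "finite F" "F \<subseteq> carrier G"
    "\<And>t. t \<in> carrier G \<Longrightarrow> \<exists>s\<in>F. \<forall>x\<in>carrier G. h (x \<otimes> t) \<otimes>\<^bsub>K\<^esub> inv\<^bsub>K\<^esub> (h (x \<otimes> s)) \<in> V"
proof -
  interpret lcag G by (rule G)
  interpret K: lcag K by (rule K)
  have h: "h \<in> Cu G K" using ap by (simp add: almost_periodic_def)
  let ?T = "{translate G t h | t. t \<in> carrier G}"
  let ?cl = "Cu_topology G K closure_of ?T"
  obtain V1 where V1: "openin (gtop K) V1" "\<one>\<^bsub>K\<^esub> \<in> V1"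
    "\<And>a b. a \<in> V1 \<Longrightarrow> b \<in> V1 \<Longrightarrow> a \<otimes>\<^bsub>K\<^esub> inv\<^bsub>K\<^esub> b \<in> V"
    using K.divide_neighbourhood[OF V] by blast
  define near where "near V k = {k' \<in> Cu G K. \<forall>x\<in>carrier G. k' x \<otimes>\<^bsub>K\<^esub> inv\<^bsub>K\<^esub> (k x) \<in> V}" for V k
  define W where "W k = {k' \<in> Cu G K. \<exists>V'. openin (gtop K) V' \<and> \<one>\<^bsub>K\<^esub> \<in> V' \<and> near V' k' \<subseteq> near V1 k}"
    for k
  have self: "k \<in> near V' k" if "k \<in> Cu G K" "\<one>\<^bsub>K\<^esub> \<in> V'" for k V'
    using that Cu_D(1)[OF that(1)] by (simp add: near_def)
  have W_near: "W k \<subseteq> near V1 k" for k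
    unfolding W_def using self by blast
  have W_self: "k \<in> W k" if "k \<in> Cu G K" for k
    unfolding W_def using that V1 by blast
  have W_open: "openin (Cu_topology G K) (W k)" for k
    unfolding openin_Cu_topology
  proof (intro conjI ballI)
    fix k' assume k': "k' \<in> W k"
    then obtain V' where V': "openin (gtop K) V'" "\<one>\<^bsub>K\<^esub> \<in> V'" "near V' k' \<subseteq> near V1 k"
      by (auto simp: W_def)
    obtain V2 where V2: "openin (gtop K) V2" "\<one>\<^bsub>K\<^esub> \<in> V2"
      "\<And>a b. a \<in> V2 \<Longrightarrow> b \<in> V2 \<Longrightarrow> a \<otimes>\<^bsub>K\<^esub> b \<in> V'"
      using K.mult_neighbourhood[OF V'(1,2)] by blast
    have kC: "k' \<in> Cu G K" using k' by (simp add: W_def)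
    have "k2 \<in> W k" if k2: "k2 \<in> Cu G K" "\<forall>x\<in>carrier G. k2 x \<otimes>\<^bsub>K\<^esub> inv\<^bsub>K\<^esub> (k' x) \<in> V2" for k2
    proof -
      have "near V2 k2 \<subseteq> near V' k'"
      proof
        fix k3 assume "k3 \<in> near V2 k2"
        then have k3: "k3 \<in> Cu G K" "\<And>x. x \<in> carrier G \<Longrightarrow> k3 x \<otimes>\<^bsub>K\<^esub> inv\<^bsub>K\<^esub> (k2 x) \<in> V2"
          by (auto simp: near_def)
        have "k3 x \<otimes>\<^bsub>K\<^esub> inv\<^bsub>K\<^esub> (k' x) \<in> V'" if x: "x \<in> carrier G" for x
          using V2(3)[OF k3(2)[OF x] k2(2)[rule_format, OF x]]
            K.mult_inv_cancel[OF Cu_D(1)[OF k3(1) x] Cu_D(1)[OF k2(1) x] Cu_D(1)[OF kC x]] by simp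
        then show "k3 \<in> near V' k'" using k3(1) by (simp add: near_def)
      qed
      with V' have "near V2 k2 \<subseteq> near V1 k" by blast
      with k2(1) V2(1,2) show ?thesis unfolding W_def by blast
    qed
    with V2(1,2) show "\<exists>V. openin (gtop K) V \<and> \<one>\<^bsub>K\<^esub> \<in> V \<and>
      (\<forall>h'\<in>Cu G K. (\<forall>x\<in>carrier G. h' x \<otimes>\<^bsub>K\<^esub> inv\<^bsub>K\<^esub> (k' x) \<in> V) \<longrightarrow> h' \<in> W k)" by blast
  qed (auto simp: W_def)
  have "openin (Cu_topology G K) (Cu G K)"
    unfolding openin_Cu_topology using V by blast
  then have top: "Cu G K \<subseteq> topspace (Cu_topology G K)" by (rule openin_subset)
  have "topspace (Cu_topology G K) \<subseteq> Cu G K"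
    using openin_topspace[of "Cu_topology G K"] unfolding openin_Cu_topology by blast
  with closure_of_subset_topspace[of "Cu_topology G K" ?T] have clC: "?cl \<subseteq> Cu G K" by blast
  have "?T \<subseteq> topspace (Cu_topology G K)" using translate_in_Cu[OF G h] top by blast
  then have Tcl: "?T \<subseteq> ?cl" by (rule closure_of_subset)
  have "compactin (Cu_topology G K) ?cl" using ap by (simp add: almost_periodic_def)
  moreover have "\<forall>U\<in>W ` ?cl. openin (Cu_topology G K) U" using W_open by blast
  moreover have "?cl \<subseteq> \<Union> (W ` ?cl)" using W_self clC by blast
  ultimately obtain \<F> where \<F>: "finite \<F>" "\<F> \<subseteq> W ` ?cl" "?cl \<subseteq> \<Union> \<F>"
    unfolding compactin_def by meson
  obtain ks where ks: "finite ks" "\<F> = W ` ks" "ks \<subseteq> ?cl"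
    using finite_subset_image[OF \<F>(1,2)] by blast
  define pick where "pick k = (SOME t. t \<in> carrier G \<and> translate G t h \<in> near V1 k)" for k
  define F where "F = (\<lambda>k. inv (pick k)) ` {k \<in> ks. \<exists>t. t \<in> carrier G \<and> translate G t h \<in> near V1 k}"
  have pick: "pick k \<in> carrier G \<and> translate G (pick k) h \<in> near V1 k"
    if "t \<in> carrier G" "translate G t h \<in> near V1 k" for k t
    unfolding pick_def by (rule someI[of _ t]) (use that in blast)
  show thesis
  proof (rule that[of F])
    show "finite F" using ks by (simp add: F_def)
    show "F \<subseteq> carrier G" using pick by (auto simp: F_def)
    fix t assume t: "t \<in> carrier G"
    then have t': "inv t \<in> carrier G" by simp
    have "translate G (inv t) h \<in> ?cl" using Tcl t' by blast
    then obtain k where k: "k \<in> ks" "translate G (inv t) h \<in> W k"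
      using \<F>(3) unfolding ks(2) by blast
    then have kn: "translate G (inv t) h \<in> near V1 k" using W_near by blast
    then have p: "pick k \<in> carrier G" "translate G (pick k) h \<in> near V1 k" using pick[OF t'] by auto
    let ?s = "inv (pick k)"
    have s: "?s \<in> F" unfolding F_def using k(1) kn t' by blast
    have "h (x \<otimes> t) \<otimes>\<^bsub>K\<^esub> inv\<^bsub>K\<^esub> (h (x \<otimes> ?s)) \<in> V" if x: "x \<in> carrier G" for x
    proof -
      have "h (x \<otimes> t) \<otimes>\<^bsub>K\<^esub> inv\<^bsub>K\<^esub> (k x) \<in> V1" "h (x \<otimes> ?s) \<otimes>\<^bsub>K\<^esub> inv\<^bsub>K\<^esub> (k x) \<in> V1"
        using kn p x t by (auto simp: near_def translate_def)
      from V1(3)[OF this]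
      have "(h (x \<otimes> t) \<otimes>\<^bsub>K\<^esub> inv\<^bsub>K\<^esub> (k x)) \<otimes>\<^bsub>K\<^esub> inv\<^bsub>K\<^esub> (h (x \<otimes> ?s) \<otimes>\<^bsub>K\<^esub> inv\<^bsub>K\<^esub> (k x)) \<in> V" .
      moreover have "h (x \<otimes> t) \<in> carrier K" "h (x \<otimes> ?s) \<in> carrier K"
        using Cu_D(1)[OF h] x t p by auto
      moreover have "k x \<in> carrier K"
        using Cu_D(1)[OF _ x] clC ks(3) k(1) by blast
      ultimately show ?thesis
        using K.mult_inv_cancel[of "h (x \<otimes> t)" "k x" "h (x \<otimes> ?s)"] by (simp add: K.inv_mult_group)
    qed
    with s show "\<exists>s\<in>F. \<forall>x\<in>carrier G. h (x \<otimes> t) \<otimes>\<^bsub>K\<^esub> inv\<^bsub>K\<^esub> (h (x \<otimes> s)) \<in> V" by blast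
  qed
qed

text \<open>The quotients \<open>a \<otimes> inv b\<close> of the pairs in \<open>C \<times> C\<close> on which \<open>u\<close> differs by at least \<open>r\<close> form a compact, hence
  closed, set that omits the neutral element. Its complement is the desired neighbourhood.\<close>

lemma compact_uniform_continuity:
  fixes K :: "'k top_group" and u :: "'k \<Rightarrow> complex"
  assumes K: "lcag K" and C: "compactin (gtop K) C" and u: "continuous_map (gtop K) euclidean u"
    and r: "r > 0"
  obtains V where "openin (gtop K) V" "\<one>\<^bsub>K\<^esub> \<in> V"
    "\<And>a b. a \<in> C \<Longrightarrow> b \<in> C \<Longrightarrow> a \<otimes>\<^bsub>K\<^esub> inv\<^bsub>K\<^esub> b \<in> V \<Longrightarrow> norm (u a - u b) < r"
proof -
  interpret K: lcag K by (rule K)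
  let ?P = "prod_topology (gtop K) (gtop K)"
  let ?m = "\<lambda>p. fst p \<otimes>\<^bsub>K\<^esub> inv\<^bsub>K\<^esub> (snd p)"
  have CK: "C \<subseteq> carrier K" using compactin_subset_topspace[OF C] by (simp add: K.topspace_gtop)
  have m: "continuous_map ?P (gtop K) ?m"
    by (intro K.continuous_map_product K.continuous_map_inverse continuous_map_fst continuous_map_snd)
  have "continuous_map ?P euclidean (\<lambda>p. norm (u (fst p) - u (snd p)))"
    using continuous_map_compose[OF continuous_map_fst[of "gtop K" "gtop K"] u]
      continuous_map_compose[OF continuous_map_snd[of "gtop K" "gtop K"] u]
    by (intro continuous_map_norm continuous_map_diff) (simp_all add: o_def)
  from closedin_continuous_map_preimage[OF this, of "{r..}"]
  have cl: "closedin ?P {p \<in> topspace ?P. norm (u (fst p) - u (snd p)) \<in> {r..}}" by simp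
  let ?S = "{p \<in> topspace ?P. norm (u (fst p) - u (snd p)) \<in> {r..}} \<inter> (C \<times> C)"
  have "compactin ?P (C \<times> C)" using C by (simp add: compactin_Times)
  from closed_Int_compactin[OF cl this] have "compactin ?P ?S" .
  from compactin_imp_closedin[OF K.Hausdorff image_compactin[OF this m]]
  have im: "closedin (gtop K) (?m ` ?S)" .
  show thesis
  proof (rule that[of "topspace (gtop K) - ?m ` ?S"])
    show "openin (gtop K) (topspace (gtop K) - ?m ` ?S)" using im by blast
    have "a = b" if "a \<in> C" "b \<in> C" "a \<otimes>\<^bsub>K\<^esub> inv\<^bsub>K\<^esub> b = \<one>\<^bsub>K\<^esub>" for a b
    proof -
      have ab: "a \<in> carrier K" "b \<in> carrier K" using that CK by auto
      then have "a = (a \<otimes>\<^bsub>K\<^esub> inv\<^bsub>K\<^esub> b) \<otimes>\<^bsub>K\<^esub> b"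
        by (simp only: K.m_assoc K.inv_closed K.l_inv K.r_one)
      with that(3) ab show ?thesis by simp
    qed
    then show "\<one>\<^bsub>K\<^esub> \<in> topspace (gtop K) - ?m ` ?S"
      using r by (auto simp: K.topspace_gtop) (metis diff_self norm_zero not_le)
    show "norm (u a - u b) < r" if "a \<in> C" "b \<in> C" "a \<otimes>\<^bsub>K\<^esub> inv\<^bsub>K\<^esub> b \<in> topspace (gtop K) - ?m ` ?S"
      for a b
    proof (rule ccontr)
      assume "\<not> norm (u a - u b) < r"
      then have "(a, b) \<in> ?S" using that(1,2) CK by (auto simp: K.topspace_gtop)
      then have "?m (a, b) \<in> ?m ` ?S" by (rule imageI)
      with that(3) show False by simp
    qed
  qed
qed

lemma continuous_compactin_bounded:
  fixes u :: "'k \<Rightarrow> complex"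
  assumes "compactin X C" "continuous_map X euclidean u"
  obtains B where "B \<ge> 0" "\<And>x. x \<in> C \<Longrightarrow> norm (u x) \<le> B"
proof -
  have "bounded (u ` C)"
    using image_compactin[OF assms] by (simp add: compactin_euclidean_iff compact_imp_bounded)
  then obtain B where B: "\<And>x. x \<in> C \<Longrightarrow> norm (u x) \<le> B"
    by (auto simp: bounded_iff)
  show thesis by (rule that[of "max 0 B"]) (use B in \<open>auto intro: max.coboundedI2\<close>)
qed

text \<open>Composition with \<open>u\<close> gives a scalar almost periodic function. Two points whose images are both close to
  \<open>b\<close> at finitely many characters differ by an almost period of it.\<close>

lemma almost_periodic_bohr_cauchy:
  fixes G :: "'a top_group" (structure) and K :: "'k top_group" and u :: "'k \<Rightarrow> complex"
  assumes G: "lcag G" and K: "lcag K" and ap: "almost_periodic G K h"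
    and u: "continuous_map (gtop K) euclidean u" and b: "b \<in> carrier (bohr G)" and e: "e > 0"
  obtains W where "openin (gtop (bohr G)) W" "b \<in> W"
    "\<And>x y. x \<in> carrier G \<Longrightarrow> y \<in> carrier G \<Longrightarrow> bohr_map G x \<in> W \<Longrightarrow> bohr_map G y \<in> W \<Longrightarrow>
      norm (u (h x) - u (h y)) < e"
proof -
  interpret lcag G by (rule G)
  interpret K: lcag K by (rule K)
  have h: "h \<in> Cu G K" using ap by (simp add: almost_periodic_def)
  let ?C = "gtop K closure_of (h ` carrier G)"
  note C = Cu_D(4)[OF h] and hC = Cu_in_range_closure[OF K h]
  obtain B where B: "\<And>x. x \<in> ?C \<Longrightarrow> norm (u x) \<le> B"
    using continuous_compactin_bounded[OF C u] by blast
  have bd: "norm (u (h x)) \<le> B" if "x \<in> carrier G" for x using B hC that by blast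
  have uc: "\<exists>U. openin (gtop G) U \<and> \<one> \<in> U \<and> (\<forall>t\<in>U. \<forall>x\<in>carrier G. norm (u (h (x \<otimes> t)) - u (h x)) \<le> r)"
    if r: "r > 0" for r
  proof -
    obtain V where V: "openin (gtop K) V" "\<one>\<^bsub>K\<^esub> \<in> V"
      "\<And>a b. a \<in> ?C \<Longrightarrow> b \<in> ?C \<Longrightarrow> a \<otimes>\<^bsub>K\<^esub> inv\<^bsub>K\<^esub> b \<in> V \<Longrightarrow> norm (u a - u b) < r"
      using compact_uniform_continuity[OF K C u r] by blast
    then obtain U where U: "openin (gtop G) U" "\<one> \<in> U"
      "\<And>x y. x \<in> carrier G \<Longrightarrow> y \<in> carrier G \<Longrightarrow> x \<otimes> inv y \<in> U \<Longrightarrow> h x \<otimes>\<^bsub>K\<^esub> inv\<^bsub>K\<^esub> (h y) \<in> V"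
      using Cu_D(3)[OF h] unfolding uniformly_continuous_group_map_def by meson
    have "norm (u (h (x \<otimes> t)) - u (h x)) \<le> r" if t: "t \<in> U" and x: "x \<in> carrier G" for t x
    proof -
      have tG: "t \<in> carrier G" using openin_subset[OF U(1)] t by (auto simp: topspace_gtop)
      have "x \<otimes> t \<otimes> inv x = t"
        using x tG by (simp add: m_comm[of x t] m_assoc)
      then have "h (x \<otimes> t) \<otimes>\<^bsub>K\<^esub> inv\<^bsub>K\<^esub> (h x) \<in> V" using U(3)[of "x \<otimes> t" x] x t tG by simp
      then show ?thesis using V(3)[OF hC hC] x tG by (simp add: less_imp_le)
    qed
    with U(1,2) show ?thesis by blast
  qed
  have net: "\<exists>F. finite F \<and> F \<subseteq> carrier G \<and>
      (\<forall>t\<in>carrier G. \<exists>s\<in>F. \<forall>x\<in>carrier G. norm (u (h (x \<otimes> t)) - u (h (x \<otimes> s))) \<le> r)" if r: "r > 0" for r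
  proof -
    obtain V where V: "openin (gtop K) V" "\<one>\<^bsub>K\<^esub> \<in> V"
      "\<And>a b. a \<in> ?C \<Longrightarrow> b \<in> ?C \<Longrightarrow> a \<otimes>\<^bsub>K\<^esub> inv\<^bsub>K\<^esub> b \<in> V \<Longrightarrow> norm (u a - u b) < r"
      using compact_uniform_continuity[OF K C u r] by blast
    obtain F where F: "finite F" "F \<subseteq> carrier G"
      "\<And>t. t \<in> carrier G \<Longrightarrow> \<exists>s\<in>F. \<forall>x\<in>carrier G. h (x \<otimes> t) \<otimes>\<^bsub>K\<^esub> inv\<^bsub>K\<^esub> (h (x \<otimes> s)) \<in> V"
      using almost_periodic_translation_net[OF G K ap V(1,2)] by blast
    have "\<exists>s\<in>F. \<forall>x\<in>carrier G. norm (u (h (x \<otimes> t)) - u (h (x \<otimes> s))) \<le> r" if t: "t \<in> carrier G" for t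
    proof -
      obtain s where s: "s \<in> F" "\<And>x. x \<in> carrier G \<Longrightarrow> h (x \<otimes> t) \<otimes>\<^bsub>K\<^esub> inv\<^bsub>K\<^esub> (h (x \<otimes> s)) \<in> V"
        using F(3)[OF t] by blast
      then have "s \<in> carrier G" using F(2) by blast
      then show ?thesis
        using V(3)[OF hC hC s(2)] s(1) t by (intro bexI[of _ s]) (auto intro: less_imp_le)
    qed
    with F(1,2) show ?thesis by blast
  qed
  obtain \<Phi> d where \<Phi>: "finite \<Phi>" "\<Phi> \<subseteq> carrier (dual_group G)" "d > 0"
    "\<And>t x. t \<in> carrier G \<Longrightarrow> x \<in> carrier G \<Longrightarrow> (\<And>\<xi>. \<xi> \<in> \<Phi> \<Longrightarrow> norm (\<xi> t - 1) < d)
      \<Longrightarrow> norm (u (h (x \<otimes> t)) - u (h x)) < e"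
    using group_almost_periods_contain_bohr_set[OF G, of "\<lambda>x. u (h x)", OF bd uc net e] by metis
  define W where "W = carrier (bohr G) \<inter> (\<Inter>\<xi>\<in>\<Phi>. {\<eta> \<in> carrier (bohr G). \<eta> \<xi> \<in> ball (b \<xi>) (d / 2)})"
  show thesis
  proof (rule that[of W])
    have open1: "openin (gtop (bohr G)) {\<eta> \<in> carrier (bohr G). \<eta> \<xi> \<in> ball (b \<xi>) (d / 2)}" if "\<xi> \<in> \<Phi>"
      for \<xi>
      using openin_bohr_evaluation[of \<xi> G "ball (b \<xi>) (d / 2)"] \<Phi>(2) that by auto
    show "openin (gtop (bohr G)) W"
    proof (cases "\<Phi> = {}")
      case True
      then show ?thesis using openin_topspace[of "gtop (bohr G)"] by (simp add: W_def topspace_bohr)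
    next
      case False
      show ?thesis unfolding W_def
        by (intro openin_Int openin_Inter)
           (use False \<Phi>(1) open1 openin_topspace[of "gtop (bohr G)"] in \<open>auto simp: topspace_bohr\<close>)
    qed
    show "b \<in> W" using b \<Phi>(3) by (simp add: W_def)
    fix x y assume x: "x \<in> carrier G" and y: "y \<in> carrier G"
      and xW: "bohr_map G x \<in> W" and yW: "bohr_map G y \<in> W"
    let ?t = "inv y \<otimes> x"
    have t: "?t \<in> carrier G" using x y by simp
    have yt: "y \<otimes> ?t = x" using x y by (simp flip: m_assoc)
    have small: "norm (\<xi> ?t - 1) < d" if \<xi>: "\<xi> \<in> \<Phi>" for \<xi>
    proof -
      have \<xi>': "\<xi> \<in> carrier (dual_group G)" using \<xi> \<Phi>(2) by blast
      have "dist (b \<xi>) (\<xi> x) < d / 2" "dist (b \<xi>) (\<xi> y) < d / 2"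
        using xW yW \<xi> by (auto simp: W_def bohr_map_apply[OF \<xi>'])
      then have "norm (\<xi> x - \<xi> y) < d"
        using dist_triangle_half_r[of "b \<xi>" "\<xi> x" d "\<xi> y"]
          by (simp add: dist_norm norm_minus_commute)
      moreover have "\<xi> x - \<xi> y = \<xi> y * (\<xi> ?t - 1)"
        using dual_group_hom(2)[OF \<xi>' y t] by (simp add: yt right_diff_distrib)
      ultimately show ?thesis by (simp add: norm_mult dual_group_hom(1)[OF \<xi>' y])
    qed
    have "norm (u (h (y \<otimes> ?t)) - u (h y)) < e" by (rule \<Phi>(4)[OF t y]) (rule small)
    then show "norm (u (h x) - u (h y)) < e" by (simp add: yt)
  qed
qed

text \<open>The value at a point \<open>b\<close> of the closure is the limit of \<open>h x\<close> as \<open>bohr_map G x\<close> tends to \<open>b\<close>. A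
  cluster point exists because \<open>h\<close> has relatively compact range. It is a limit because continuous functions
  on \<open>K\<close> separate points from closed sets, and along each of them \<open>h\<close> has the Cauchy property by
  \<open>almost_periodic_bohr_cauchy\<close>. Regularity of \<open>K\<close> makes the limit function continuous.\<close>

theorem almost_periodic_bohr_extension:
  fixes G :: "'a top_group" (structure) and K :: "'k top_group"
  assumes G: "lcag G" and K: "lcag K" and ap: "almost_periodic G K h"
  obtains hb where
    "continuous_map (subtopology (gtop (bohr G)) (gtop (bohr G) closure_of (bohr_map G ` carrier G))) (gtop K) hb"
    "\<And>x. x \<in> carrier G \<Longrightarrow> hb (bohr_map G x) = h x"
proof -
  interpret lcag G by (rule G)
  interpret K: lcag K by (rule K)
  have h: "h \<in> Cu G K" using ap by (simp add: almost_periodic_def)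
  let ?C = "gtop K closure_of (h ` carrier G)" and ?b = "gtop (bohr G)"
  let ?B = "?b closure_of (bohr_map G ` carrier G)"
  note C = Cu_D(4)[OF h] and hC = Cu_in_range_closure[OF K h]
  have CK: "?C \<subseteq> carrier K" using closure_of_subset_topspace K.topspace_gtop by metis
  define lim_at where "lim_at b l \<longleftrightarrow> l \<in> carrier K \<and> (\<forall>O'. openin (gtop K) O' \<and> l \<in> O' \<longrightarrow>
    (\<exists>W. openin ?b W \<and> b \<in> W \<and> (\<forall>x\<in>carrier G. bohr_map G x \<in> W \<longrightarrow> h x \<in> O')))" for b l
  have dense: "\<exists>x\<in>carrier G. bohr_map G x \<in> W" if "b \<in> ?B" "openin ?b W" "b \<in> W" for b W
    using that unfolding in_closure_of by blast
  have "\<exists>l. lim_at b l" if b: "b \<in> ?B" for b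
  proof -
    have bc: "b \<in> carrier (bohr G)" using b topspace_bohr[of G] by (metis in_closure_of)
    \<comment> \<open>Existence of a cluster point, by compactness of the closure of the range.\<close>
    have "\<exists>l\<in>?C. \<forall>O' W. openin (gtop K) O' \<and> l \<in> O' \<and> openin ?b W \<and> b \<in> W \<longrightarrow>
        (\<exists>x\<in>carrier G. bohr_map G x \<in> W \<and> h x \<in> O')"
    proof (rule ccontr)
      assume "\<not> ?thesis"
      then have "\<forall>l\<in>?C. \<exists>O' W. openin (gtop K) O' \<and> l \<in> O' \<and> openin ?b W \<and> b \<in> W \<and>
          (\<forall>x\<in>carrier G. bohr_map G x \<in> W \<longrightarrow> h x \<notin> O')" by meson
      then obtain O' W where OW: "\<And>l. l \<in> ?C \<Longrightarrow> openin (gtop K) (O' l) \<and> l \<in> O' l \<and> openin ?b (W l) \<and> b \<in> W l \<and>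
          (\<forall>x\<in>carrier G. bohr_map G x \<in> W l \<longrightarrow> h x \<notin> O' l)" by metis
      have "\<forall>U\<in>O' ` ?C. openin (gtop K) U" "?C \<subseteq> \<Union> (O' ` ?C)" using OW by blast+
      with C obtain \<F> where \<F>: "finite \<F>" "\<F> \<subseteq> O' ` ?C" "?C \<subseteq> \<Union> \<F>"
        unfolding compactin_def by meson
      obtain ls where ls: "finite ls" "ls \<subseteq> ?C" "\<F> = O' ` ls"
        using finite_subset_image[OF \<F>(1,2)] by blast
      have "?C \<noteq> {}" using hC[of \<one>] by auto
      then have "ls \<noteq> {}" using \<F>(3) ls(3) by auto
      then have "openin ?b (\<Inter> (W ` ls))" using ls OW by (intro openin_Inter) auto
      moreover have "b \<in> \<Inter> (W ` ls)" using ls(2) OW by auto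
      ultimately obtain x where x: "x \<in> carrier G" "bohr_map G x \<in> \<Inter> (W ` ls)"
        using dense[OF b] by blast
      obtain l where "l \<in> ls" "h x \<in> O' l" using \<F>(3) ls(3) hC[OF x(1)] by blast
      with x OW ls(2) show False by blast
    qed
    then obtain l where l: "l \<in> ?C" and cluster: "\<And>O' W. openin (gtop K) O' \<Longrightarrow> l \<in> O' \<Longrightarrow> openin ?b W \<Longrightarrow>
        b \<in> W \<Longrightarrow> \<exists>x\<in>carrier G. bohr_map G x \<in> W \<and> h x \<in> O'" by blast
    have "lim_at b l"
      unfolding lim_at_def
    proof (intro conjI allI impI)
      show lK: "l \<in> carrier K" using l CK by blast
      fix O' assume O': "openin (gtop K) O' \<and> l \<in> O'"
      have "completely_regular_space (gtop K)"
        using K.locally_compact K.Hausdorff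
          by (intro locally_compact_regular_imp_completely_regular_space) auto
      moreover have "closedin (gtop K) (topspace (gtop K) - O')" using O' by blast
      moreover have "l \<in> topspace (gtop K) - (topspace (gtop K) - O')" using O' lK
        by (simp add: K.topspace_gtop)
      ultimately obtain v :: "'k \<Rightarrow> real" where v: "continuous_map (gtop K) (top_of_set {0..1}) v"
        "v l = 0"
        "v ` (topspace (gtop K) - O') \<subseteq> {1}"
        unfolding completely_regular_space_def by blast
      define u where "u = (\<lambda>k. complex_of_real (v k))"
      have vc: "continuous_map (gtop K) euclidean v" using v(1)
        by (rule continuous_map_into_fulltopology)
      have "continuous_map euclidean euclidean complex_of_real"
        by (simp add: continuous_on_of_real)
      from continuous_map_compose[OF vc this] have u: "continuous_map (gtop K) euclidean u"
        by (simp add: u_def o_def)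
      obtain W where W: "openin ?b W" "b \<in> W"
        "\<And>x y. x \<in> carrier G \<Longrightarrow> y \<in> carrier G \<Longrightarrow> bohr_map G x \<in> W \<Longrightarrow> bohr_map G y \<in> W \<Longrightarrow>
          norm (u (h x) - u (h y)) < 1 / 2"
        using almost_periodic_bohr_cauchy[OF G K ap u bc, of "1 / 2"] by auto
      have "openin (gtop K) {k \<in> topspace (gtop K). v k \<in> {..<1 / 2}}"
        by (rule openin_continuous_map_preimage[OF vc]) simp
      moreover have "l \<in> {k \<in> topspace (gtop K). v k \<in> {..<1 / 2}}" using lK v(2)
        by (simp add: K.topspace_gtop)
      ultimately obtain y where y: "y \<in> carrier G" "bohr_map G y \<in> W" "v (h y) < 1 / 2"
        using cluster[OF _ _ W(1,2)] by blast
      have "h x \<in> O'" if x: "x \<in> carrier G" "bohr_map G x \<in> W" for x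
      proof (rule ccontr)
        assume "h x \<notin> O'"
        then have "v (h x) = 1" using v(3) Cu_D(1)[OF h x(1)] by (auto simp: K.topspace_gtop)
        moreover have "norm (complex_of_real (v (h x) - v (h y))) < 1 / 2"
          using W(3)[OF x(1) y(1) x(2) y(2)] by (simp add: u_def)
        ultimately show False using y(3) unfolding norm_of_real by linarith
      qed
      with W show "\<exists>W. openin ?b W \<and> b \<in> W \<and> (\<forall>x\<in>carrier G. bohr_map G x \<in> W \<longrightarrow> h x \<in> O')" by blast
    qed
    then show ?thesis ..
  qed
  then obtain hb where hb: "\<And>b. b \<in> ?B \<Longrightarrow> lim_at b (hb b)" by metis
  have reg: "regular_space (gtop K)"
    using K.locally_compact K.Hausdorff by (rule locally_compact_Hausdorff_imp_regular_space)
  have Btop: "topspace (subtopology ?b ?B) = ?B"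
    using closure_of_subset_topspace[of ?b "bohr_map G ` carrier G"] by auto
  show thesis
  proof (rule that[of hb])
    have "\<exists>W. openin (subtopology ?b ?B) W \<and> b \<in> W \<and> W \<subseteq> {b \<in> ?B. hb b \<in> O'}"
      if b: "b \<in> ?B" and O': "openin (gtop K) O'" "hb b \<in> O'" for b O'
    proof -
      obtain U Q where UQ: "openin (gtop K) U" "closedin (gtop K) Q" "hb b \<in> U" "U \<subseteq> Q" "Q \<subseteq> O'"
        using reg O' unfolding neighbourhood_base_of_closedin[symmetric] neighbourhood_base_of
          by metis
      obtain W where W: "openin ?b W" "b \<in> W" "\<And>x. x \<in> carrier G \<Longrightarrow> bohr_map G x \<in> W \<Longrightarrow> h x \<in> U"
        using hb[OF b] UQ(1,3) unfolding lim_at_def by meson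
      have "hb b' \<in> Q" if b': "b' \<in> ?B" "b' \<in> W" for b'
      proof (rule ccontr)
        assume "hb b' \<notin> Q"
        moreover have "hb b' \<in> topspace (gtop K)" using hb[OF b'(1)]
          by (simp add: lim_at_def K.topspace_gtop)
        ultimately have "hb b' \<in> topspace (gtop K) - Q" by blast
        moreover have "openin (gtop K) (topspace (gtop K) - Q)" using UQ(2) by blast
        ultimately obtain W' where W': "openin ?b W'" "b' \<in> W'"
          "\<And>x. x \<in> carrier G \<Longrightarrow> bohr_map G x \<in> W' \<Longrightarrow> h x \<in> topspace (gtop K) - Q"
          using hb[OF b'(1)] unfolding lim_at_def by meson
        obtain x where "x \<in> carrier G" "bohr_map G x \<in> W \<inter> W'"
          using dense[OF b'(1), of "W \<inter> W'"] W W' b'(2) by (auto simp: openin_Int)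
        with W(3) W'(3) UQ(4) show False by blast
      qed
      with UQ(5) W(1,2) b show ?thesis
        by (intro exI[of _ "W \<inter> ?B"]) (auto simp: openin_subtopology)
    qed
    then have "openin (subtopology ?b ?B) {b \<in> ?B. hb b \<in> O'}" if "openin (gtop K) O'" for O'
      using that by (subst openin_subopen) blast
    moreover have "hb b \<in> topspace (gtop K)" if "b \<in> ?B" for b
      using hb[OF that] by (simp add: lim_at_def K.topspace_gtop)
    ultimately show "continuous_map (subtopology ?b ?B) (gtop K) hb"
      unfolding continuous_map_def Btop by blast
    fix x assume x: "x \<in> carrier G"
    have "bohr_map G ` carrier G \<subseteq> topspace ?b" using bohr_map_in_carrier[OF G]
      by (auto simp: topspace_bohr)
    from closure_of_subset[OF this] have l: "lim_at (bohr_map G x) (hb (bohr_map G x))" using x hb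
      by blast
    show "hb (bohr_map G x) = h x"
    proof (rule ccontr)
      assume "hb (bohr_map G x) \<noteq> h x"
      then obtain U V where "openin (gtop K) U" "openin (gtop K) V" "hb (bohr_map G x) \<in> U"
        "h x \<in> V" "disjnt U V"
        using K.Hausdorff l Cu_D(1)[OF h x] unfolding Hausdorff_space_def lim_at_def K.topspace_gtop
          by metis
      with l x show False unfolding lim_at_def disjnt_iff by blast
    qed
  qed
qed

section \<open>Modulations of deformed weighted model sets\<close>

lemma complex_group_lcag: "lcag complex_group"
proof -
  have grp: "comm_group complex_group"
  proof (rule comm_groupI)
    show "\<exists>y\<in>carrier complex_group. y \<otimes>\<^bsub>complex_group\<^esub> x = \<one>\<^bsub>complex_group\<^esub>" for x
      by (rule bexI[of _ "- x"]) (simp_all add: complex_group_def)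
  qed (simp_all add: complex_group_def add.assoc add.commute)
  interpret comm_group complex_group by (rule grp)
  have inv: "inv\<^bsub>complex_group\<^esub> x = - x" for x
    by (rule inv_equality) (simp_all add: complex_group_def)
  show ?thesis
  proof (intro lcag.intro grp lcag_axioms.intro)
    show "continuous_map (gtop complex_group) (gtop complex_group) (\<lambda>x. inv\<^bsub>complex_group\<^esub> x)"
      unfolding inv by (simp add: complex_group_def continuous_on_minus)
    show "continuous_map (prod_topology (gtop complex_group) (gtop complex_group)) (gtop complex_group)
        (\<lambda>(x, y). x \<otimes>\<^bsub>complex_group\<^esub> y)"
      by (simp add: complex_group_def split_beta) (intro continuous_intros)
  qed (simp_all add: complex_group_def locally_compact_space_euclidean)
qed

lemma Cc_D:
  assumes "\<phi> \<in> Cc G"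
  shows "continuous_map (gtop G) euclidean \<phi>"
    "compactin (gtop G) (gtop G closure_of {x \<in> carrier G. \<phi> x \<noteq> 0})"
    "x \<notin> carrier G \<Longrightarrow> \<phi> x = 0"
  using assms by (auto simp: Cc_def)

lemma CcI:
  assumes G: "lcag G" and \<phi>: "continuous_map (gtop G) euclidean \<phi>" and K: "compactin (gtop G) K"
    and out: "\<And>x. x \<notin> K \<Longrightarrow> \<phi> x = 0"
  shows "\<phi> \<in> Cc G"
proof -
  interpret lcag G by (rule G)
  have "gtop G closure_of {x \<in> carrier G. \<phi> x \<noteq> 0} \<subseteq> K"
    by (rule closure_of_minimal) (use out compactin_imp_closedin[OF Hausdorff K] in auto)
  moreover have "K \<subseteq> carrier G" using compactin_subset_topspace[OF K] by (simp add: topspace_gtop)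
  ultimately show ?thesis
    using \<phi> out closed_compactin[OF K _ closedin_closure_of] by (auto simp: Cc_def)
qed

lemma Cc_support:
  assumes G: "lcag G" and \<phi>: "\<phi> \<in> Cc G"
  obtains K where "compactin (gtop G) K" "\<And>x. x \<notin> K \<Longrightarrow> \<phi> x = 0"
proof (rule that[OF Cc_D(2)[OF \<phi>]])
  interpret lcag G by (rule G)
  have "{x \<in> carrier G. \<phi> x \<noteq> 0} \<subseteq> gtop G closure_of {x \<in> carrier G. \<phi> x \<noteq> 0}"
    by (rule closure_of_subset) (auto simp: topspace_gtop)
  then show "\<phi> x = 0" if "x \<notin> gtop G closure_of {x \<in> carrier G. \<phi> x \<noteq> 0}" for x
    using that Cc_D(3)[OF \<phi>] by blast
qed

lemma Cc_bounded:
  assumes "\<phi> \<in> Cc G" "lcag G"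
  obtains B where "\<And>x. norm (\<phi> x) \<le> B"
proof -
  obtain K where K: "compactin (gtop G) K" "\<And>x. x \<notin> K \<Longrightarrow> \<phi> x = 0" using Cc_support assms by blast
  obtain B where B: "B \<ge> 0" "\<And>x. x \<in> K \<Longrightarrow> norm (\<phi> x) \<le> B"
    using continuous_compactin_bounded[OF K(1) Cc_D(1)[OF assms(1)]] by blast
  have "norm (\<phi> x) \<le> B" for x using B K(2) by (cases "x \<in> K") auto
  then show thesis by (rule that)
qed

lemma Cc_norm_le_SUP:
  assumes "\<phi> \<in> Cc G" "lcag G" "x \<in> carrier G"
  shows "norm (\<phi> x) \<le> (SUP x\<in>carrier G. norm (\<phi> x))"
proof -
  obtain B where "\<And>x. norm (\<phi> x) \<le> B" using Cc_bounded[OF assms(1,2)] by blast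
  then show ?thesis by (intro cSUP_upper assms bdd_aboveI2)
qed

lemma Cc_add:
  assumes G: "lcag G" and \<phi>: "\<phi> \<in> Cc G" and \<psi>: "\<psi> \<in> Cc G" shows "(\<lambda>x. \<phi> x + \<psi> x) \<in> Cc G"
proof -
  obtain K where K: "compactin (gtop G) K" "\<And>x. x \<notin> K \<Longrightarrow> \<phi> x = 0" using Cc_support[OF G \<phi>] by blast
  obtain K' where K': "compactin (gtop G) K'" "\<And>x. x \<notin> K' \<Longrightarrow> \<psi> x = 0" using Cc_support[OF G \<psi>]
    by blast
  show ?thesis
    by (rule CcI[OF G continuous_map_add[OF Cc_D(1)[OF \<phi>] Cc_D(1)[OF \<psi>]] compactin_Un[OF K(1) K'(1)]])
       (use K K' in auto)
qed

lemma Cc_cmult: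
  assumes G: "lcag G" and \<phi>: "\<phi> \<in> Cc G" shows "(\<lambda>x. c * \<phi> x) \<in> Cc G"
proof -
  obtain K where K: "compactin (gtop G) K" "\<And>x. x \<notin> K \<Longrightarrow> \<phi> x = 0" using Cc_support[OF G \<phi>] by blast
  show ?thesis
    by (rule CcI[OF G continuous_map_complex_mult[OF _ Cc_D(1)[OF \<phi>]] K(1)])
       (use K in auto)
qed

text \<open>The test function against which a measure is evaluated in \<open>modulate\<close>.\<close>

definition modulated :: "'a top_group \<Rightarrow> ('a \<Rightarrow> complex) \<Rightarrow> ('a \<Rightarrow> 'a) \<Rightarrow> ('a \<Rightarrow> complex) \<Rightarrow> 'a \<Rightarrow> complex" where
  "modulated G w g \<phi> = (\<lambda>x. if x \<in> carrier G then w x * \<phi> (x \<otimes>\<^bsub>G\<^esub> g x) else 0)"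

text \<open>If \<open>x \<otimes> g x\<close> lies in \<open>K\<close>, then \<open>x\<close> lies in the compact set \<open>K \<otimes> inv C\<close>, where \<open>C\<close> is the closure of the
  range of \<open>g\<close>. This set depends neither on \<open>w\<close> nor on \<open>\<phi>\<close>.\<close>

lemma modulated_support:
  fixes G :: "'a top_group" (structure)
  assumes G: "lcag G" and g: "g \<in> Cu G G" and K: "compactin (gtop G) K"
  obtains K' where "compactin (gtop G) K'"
    "\<And>w \<phi> x. (\<And>x. x \<notin> K \<Longrightarrow> \<phi> x = 0) \<Longrightarrow> x \<notin> K' \<Longrightarrow> modulated G w g \<phi> x = 0"
proof -
  interpret lcag G by (rule G)
  let ?C = "gtop G closure_of (g ` carrier G)"
  let ?m = "\<lambda>p. fst p \<otimes> inv (snd p)"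
  have m: "continuous_map (prod_topology (gtop G) (gtop G)) (gtop G) ?m"
    by (intro continuous_map_product continuous_map_inverse continuous_map_fst continuous_map_snd)
  have "compactin (prod_topology (gtop G) (gtop G)) (K \<times> ?C)"
    using K Cu_D(4)[OF g] by (simp add: compactin_Times)
  from image_compactin[OF this m] have K': "compactin (gtop G) (?m ` (K \<times> ?C))" .
  show thesis
  proof (rule that[OF K'])
    fix w :: "'a \<Rightarrow> complex" and \<phi> :: "'a \<Rightarrow> complex" and x
    assume out: "\<And>x. x \<notin> K \<Longrightarrow> \<phi> x = 0" and x: "x \<notin> ?m ` (K \<times> ?C)"
    have "x \<otimes> g x \<notin> K" if xG: "x \<in> carrier G"
    proof
      assume "x \<otimes> g x \<in> K"
      then have "(x \<otimes> g x, g x) \<in> K \<times> ?C" using Cu_in_range_closure[OF G g xG] by simp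
      then have "?m (x \<otimes> g x, g x) \<in> ?m ` (K \<times> ?C)" by (rule imageI)
      moreover have "?m (x \<otimes> g x, g x) = x" using xG Cu_D(1)[OF g xG] by (simp add: m_assoc)
      ultimately show False using x by simp
    qed
    with out show "modulated G w g \<phi> x = 0" by (simp add: modulated_def)
  qed
qed

lemma modulated_in_Cc:
  fixes G :: "'a top_group" (structure)
  assumes G: "lcag G" and w: "w \<in> Cu G complex_group" and g: "g \<in> Cu G G" and \<phi>: "\<phi> \<in> Cc G"
  shows "modulated G w g \<phi> \<in> Cc G"
proof -
  interpret lcag G by (rule G)
  obtain K where K: "compactin (gtop G) K" "\<And>x. x \<notin> K \<Longrightarrow> \<phi> x = 0" using Cc_support[OF G \<phi>] by blast
  obtain K' where K': "compactin (gtop G) K'"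
    "\<And>w \<phi> x. (\<And>x. x \<notin> K \<Longrightarrow> \<phi> x = 0) \<Longrightarrow> x \<notin> K' \<Longrightarrow> modulated G w g \<phi> x = 0"
    using modulated_support[OF G g K(1)] by metis
  have wc: "continuous_map (gtop G) euclidean w"
    using uniformly_continuous_imp_continuous_map[OF G complex_group_lcag Cu_D(2)[OF w] Cu_D(3)[OF w]]
    by (simp add: complex_group_def)
  have gc: "continuous_map (gtop G) (gtop G) g"
    by (rule uniformly_continuous_imp_continuous_map[OF G G Cu_D(2)[OF g] Cu_D(3)[OF g]])
  have "continuous_map (gtop G) (gtop G) (\<lambda>x. x \<otimes> g x)"
    by (intro continuous_map_product gc) simp
  from continuous_map_complex_mult[OF wc continuous_map_compose[OF this Cc_D(1)[OF \<phi>]]]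
  have "continuous_map (gtop G) euclidean (\<lambda>x. w x * \<phi> (x \<otimes> g x))" by (simp add: o_def)
  then have "continuous_map (gtop G) euclidean (modulated G w g \<phi>)"
    by (rule continuous_map_eq) (simp add: modulated_def topspace_gtop)
  then show ?thesis
    by (rule CcI[OF G _ K'(1)]) (rule K'(2)[OF K(2)])
qed

lemma radon_measure_modulation:
  fixes G :: "'a top_group" (structure)
  assumes G: "lcag G" and w: "w \<in> Cu G complex_group" and g: "g \<in> Cu G G"
    and \<nu>: "radon_measure G \<nu>" and \<mu>: "\<And>\<phi>. \<phi> \<in> Cc G \<Longrightarrow> \<mu> \<phi> = \<nu> (modulated G w g \<phi>)"
  shows "radon_measure G \<mu>"
proof -
  interpret lcag G by (rule G)
  have \<nu>_add: "\<nu> (\<lambda>x. \<phi> x + \<psi> x) = \<nu> \<phi> + \<nu> \<psi>" if "\<phi> \<in> Cc G" "\<psi> \<in> Cc G" for \<phi> \<psi>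
    using \<nu> that unfolding radon_measure_def by blast
  have \<nu>_cmult: "\<nu> (\<lambda>x. c * \<phi> x) = c * \<nu> \<phi>" if "\<phi> \<in> Cc G" for c \<phi>
    using \<nu> that unfolding radon_measure_def by blast
  have \<nu>_bound: "\<exists>C. \<forall>\<phi>\<in>Cc G. (\<forall>x. x \<notin> K \<longrightarrow> \<phi> x = 0) \<longrightarrow> norm (\<nu> \<phi>) \<le> C * (SUP x\<in>carrier G. norm (\<phi> x))"
    if "compactin (gtop G) K" for K
    using \<nu> that unfolding radon_measure_def by blast
  note T = modulated_in_Cc[OF G w g]
  obtain B where B: "B \<ge> 0" "\<And>x. x \<in> carrier G \<Longrightarrow> norm (w x) \<le> B"
  proof -
    have "continuous_map (gtop complex_group) euclidean (\<lambda>z. z)" by (simp add: complex_group_def)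
    from continuous_compactin_bounded[OF Cu_D(4)[OF w] this]
    obtain B where B: "B \<ge> 0" "\<And>z. z \<in> gtop complex_group closure_of (w ` carrier G) \<Longrightarrow> norm z \<le> B"
      by blast
    show thesis by (rule that[OF B(1)]) (rule B(2)[OF Cu_in_range_closure[OF complex_group_lcag w]])
  qed
  show ?thesis
    unfolding radon_measure_def
  proof (intro conjI ballI allI impI)
    fix \<phi> \<psi> assume \<phi>: "\<phi> \<in> Cc G" and \<psi>: "\<psi> \<in> Cc G"
    have "modulated G w g (\<lambda>x. \<phi> x + \<psi> x) = (\<lambda>x. modulated G w g \<phi> x + modulated G w g \<psi> x)"
      by (auto simp: modulated_def distrib_left)
    then show "\<mu> (\<lambda>x. \<phi> x + \<psi> x) = \<mu> \<phi> + \<mu> \<psi>"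
      using \<nu>_add[OF T[OF \<phi>] T[OF \<psi>]] by (simp add: \<mu> \<phi> \<psi> Cc_add[OF G])
  next
    fix c \<phi> assume \<phi>: "\<phi> \<in> Cc G"
    have "modulated G w g (\<lambda>x. c * \<phi> x) = (\<lambda>x. c * modulated G w g \<phi> x)"
      by (auto simp: modulated_def)
    then show "\<mu> (\<lambda>x. c * \<phi> x) = c * \<mu> \<phi>"
      using \<nu>_cmult[OF T[OF \<phi>]] by (simp add: \<mu> \<phi> Cc_cmult[OF G])
  next
    fix K assume "compactin (gtop G) K"
    then obtain K' where K': "compactin (gtop G) K'"
      "\<And>w \<phi> x. (\<And>x. x \<notin> K \<Longrightarrow> \<phi> x = 0) \<Longrightarrow> x \<notin> K' \<Longrightarrow> modulated G w g \<phi> x = 0"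
      using modulated_support[OF G g] by metis
    obtain C where C: "\<And>\<phi>. \<phi> \<in> Cc G \<Longrightarrow> (\<And>x. x \<notin> K' \<Longrightarrow> \<phi> x = 0) \<Longrightarrow>
        norm (\<nu> \<phi>) \<le> C * (SUP x\<in>carrier G. norm (\<phi> x))"
      using \<nu>_bound[OF K'(1)] by blast
    have "norm (\<mu> \<phi>) \<le> \<bar>C\<bar> * B * (SUP x\<in>carrier G. norm (\<phi> x))"
      if \<phi>: "\<phi> \<in> Cc G" and out: "\<And>x. x \<notin> K \<Longrightarrow> \<phi> x = 0" for \<phi>
    proof -
      let ?T = "modulated G w g \<phi>" and ?s = "SUP x\<in>carrier G. norm (\<phi> x)"
      let ?S = "SUP x\<in>carrier G. norm (?T x)"
      have "norm (?T x) \<le> B * ?s" if x: "x \<in> carrier G" for x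
      proof -
        have "x \<otimes> g x \<in> carrier G" using x Cu_D(1)[OF g x] by simp
        then have "norm (\<phi> (x \<otimes> g x)) \<le> ?s" by (rule Cc_norm_le_SUP[OF \<phi> G])
        then show ?thesis
          using B x by (simp add: modulated_def norm_mult mult_mono)
      qed
      then have "?S \<le> B * ?s" by (intro cSUP_least) auto
      moreover have "0 \<le> ?S"
        using Cc_norm_le_SUP[OF T[OF \<phi>] G one_closed] norm_ge_zero order_trans by blast
      moreover have "norm (\<nu> ?T) \<le> C * ?S" by (rule C[OF T[OF \<phi>]]) (rule K'(2)[OF out])
      moreover have "C * ?S \<le> \<bar>C\<bar> * ?S" using \<open>0 \<le> ?S\<close> by (intro mult_right_mono) auto
      moreover have "\<bar>C\<bar> * ?S \<le> \<bar>C\<bar> * (B * ?s)" using \<open>?S \<le> B * ?s\<close> by (intro mult_left_mono) auto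
      ultimately show ?thesis by (simp add: \<mu> \<phi> mult.assoc)
    qed
    then show "\<exists>C. \<forall>\<phi>\<in>Cc G. (\<forall>x. x \<notin> K \<longrightarrow> \<phi> x = 0) \<longrightarrow> norm (\<mu> \<phi>) \<le> C * (SUP x\<in>carrier G. norm (\<phi> x))"
      by blast
  qed
qed

theorem theorem8p2:
  fixes G :: "'a top_group" and H\<^sub>0 :: "'b top_group" and \<L>\<^sub>0 :: "('a \<times> 'b) set"
    and \<nu> \<mu> :: "('a \<Rightarrow> complex) \<Rightarrow> complex"
  assumes "cut_and_project_scheme G H\<^sub>0 \<L>\<^sub>0"
    and "deformed_weighted_model_set G (extended_internal G H\<^sub>0 \<L>\<^sub>0) (extended_lattice G \<L>\<^sub>0) \<nu>"
    and "is_modulation G \<nu> \<mu>"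
  shows "deformed_weighted_model_set G (extended_internal G H\<^sub>0 \<L>\<^sub>0) (extended_lattice G \<L>\<^sub>0) \<mu>"
proof -
  have G: "lcag G" and H0: "lcag H\<^sub>0" and inj: "inj_on fst \<L>\<^sub>0"
    and lat: "subgroup \<L>\<^sub>0 (prod_group G H\<^sub>0)"
    using assms(1) by (auto simp: cut_and_project_scheme_def is_lattice_def)
  interpret lcag G by (rule G)
  have L0: "\<L>\<^sub>0 \<subseteq> carrier G \<times> carrier H\<^sub>0"
    using subgroup.subset[OF lat] by (simp add: prod_group_def)
  let ?L = "fst ` \<L>\<^sub>0" and ?b = "gtop (bohr G)"
  let ?H = "extended_internal G H\<^sub>0 \<L>\<^sub>0" and ?\<L> = "extended_lattice G \<L>\<^sub>0"
  let ?star = "extended_star G \<L>\<^sub>0"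
  let ?B = "?b closure_of (bohr_map G ` carrier G)"
  have LG: "?L \<subseteq> carrier G" using L0 by auto
  have star0: "star_map \<L>\<^sub>0 l \<in> carrier H\<^sub>0" if l: "l \<in> ?L" for l
  proof -
    obtain y where y: "(l, y) \<in> \<L>\<^sub>0" using l by force
    then have "star_map \<L>\<^sub>0 l = y"
      unfolding star_map_def using inj_onD[OF inj] by (intro the_equality) fastforce+
    with y L0 show ?thesis by auto
  qed
  have fstL: "fst ` ?\<L> = ?L" by (force simp: extended_lattice_def)
  have star: "star_map ?\<L> l = ?star l" if "l \<in> ?L" for l
    unfolding star_map_def extended_lattice_def using that by blast
  define S where "S = prod_topology (gtop H\<^sub>0) ?b closure_of (?star ` ?L)"
  have gH: "gtop ?H = subtopology (prod_topology (gtop H\<^sub>0) ?b) S" and cH: "carrier ?H = S"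
    by (simp_all add: extended_internal_def sub_group_def prod_group_def S_def Let_def)
  have Stop: "S \<subseteq> topspace (prod_topology (gtop H\<^sub>0) ?b)" unfolding S_def
    by (rule closure_of_subset_topspace)
  then have topH: "topspace (gtop ?H) = S" by (auto simp: gH)
  have "?star ` ?L \<subseteq> topspace (prod_topology (gtop H\<^sub>0) ?b)"
    using star0 LG bohr_map_in_carrier[OF G]
    by (auto simp: extended_star_def lcag.topspace_gtop[OF H0] topspace_bohr)
  from closure_of_subset[OF this] have star_S: "?star l \<in> S" if "l \<in> ?L" for l
    using that by (auto simp: S_def)
  have snd_B: "snd \<eta> \<in> ?B" if "\<eta> \<in> S" for \<eta>
  proof -
    have "snd ` S \<subseteq> ?b closure_of (snd ` ?star ` ?L)"
      unfolding S_def by (rule continuous_map_image_closure_subset[OF continuous_map_snd])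
    also have "\<dots> \<subseteq> ?B"
      by (rule closure_of_mono) (use LG in \<open>auto simp: extended_star_def\<close>)
    finally show ?thesis using that by blast
  qed
  have snd_cont: "continuous_map (gtop ?H) ?b snd"
    unfolding gH by (rule continuous_map_from_subtopology[OF continuous_map_snd])
  have B_mult: "\<eta> \<otimes>\<^bsub>bohr G\<^esub> bohr_map G x \<in> ?B" if \<eta>: "\<eta> \<in> ?B" and x: "x \<in> carrier G" for \<eta> x
  proof -
    let ?t = "\<lambda>\<eta>. \<eta> \<otimes>\<^bsub>bohr G\<^esub> bohr_map G x"
    have "continuous_map ?b ?b ?t"
      by (rule continuous_map_bohr_mult[OF G])
         (use bohr_map_in_carrier[OF G x] in \<open>simp_all add: topspace_bohr\<close>)
    from continuous_map_image_closure_subset[OF this]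
    have "?t ` ?B \<subseteq> ?b closure_of (?t ` bohr_map G ` carrier G)" .
    also have "\<dots> \<subseteq> ?B"
    proof (rule closure_of_mono, clarify)
      fix y assume y: "y \<in> carrier G"
      show "?t (bohr_map G y) \<in> bohr_map G ` carrier G"
        unfolding bohr_map_mult[OF G y x, symmetric] using x y by blast
    qed
    finally show ?thesis using \<eta> by blast
  qed
  obtain w g where w: "almost_periodic G complex_group w" and g: "almost_periodic G G g"
    and \<mu>: "\<And>\<phi>. \<phi> \<in> Cc G \<Longrightarrow> \<mu> \<phi> = \<nu> (modulated G w g \<phi>)"
    using assms(3) unfolding is_modulation_def modulate_def modulated_def by blast
  have wC: "w \<in> Cu G complex_group" and gC: "g \<in> Cu G G" using w g
    by (auto simp: almost_periodic_def)
  obtain wb where wb: "continuous_map (subtopology ?b ?B) euclidean wb"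
    "\<And>x. x \<in> carrier G \<Longrightarrow> wb (bohr_map G x) = w x"
    using almost_periodic_bohr_extension[OF G complex_group_lcag w]
      by (auto simp: complex_group_def)
  obtain gb where gb: "continuous_map (subtopology ?b ?B) (gtop G) gb"
    "\<And>x. x \<in> carrier G \<Longrightarrow> gb (bohr_map G x) = g x"
    using almost_periodic_bohr_extension[OF G G g] by blast
  obtain f p where \<nu>: "radon_measure G \<nu>" and f: "f \<in> Cc ?H"
    and p: "continuous_map (gtop ?H) (gtop G) p"
    and sum: "\<And>\<phi>. \<phi> \<in> Cc G \<Longrightarrow> ((\<lambda>l. f (?star l) * \<phi> (l \<otimes>\<^bsub>G\<^esub> p (?star l))) has_sum \<nu> \<phi>) ?L"
    using assms(2) unfolding deformed_weighted_model_set_def fstL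
    by (auto simp: star cong: has_sum_cong)
  have p_carr: "p \<eta> \<in> carrier G" if "\<eta> \<in> S" for \<eta>
    using continuous_map_funspace[OF p] that by (auto simp: topH topspace_gtop)
  \<comment> \<open>At \<open>l\<^sup>\<star>\<close> this is the Bohr image of the displaced point \<open>l + p(l\<^sup>\<star>)\<close>.\<close>
  define q where "q \<eta> = snd \<eta> \<otimes>\<^bsub>bohr G\<^esub> bohr_map G (p \<eta>)" for \<eta>
  have q: "continuous_map (gtop ?H) (subtopology ?b ?B) q"
  proof (rule continuous_map_into_subtopology)
    show "continuous_map (gtop ?H) ?b q"
      unfolding q_def
      using continuous_map_compose[OF p continuous_map_bohr_map[OF G]]
      by (intro continuous_map_bohr_mult[OF G snd_cont]) (simp add: o_def)
    show "q \<in> topspace (gtop ?H) \<rightarrow> ?B"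
      unfolding q_def topH using B_mult snd_B p_carr by blast
  qed
  have q_star: "q (?star l) = bohr_map G (l \<otimes>\<^bsub>G\<^esub> p (?star l))" if "l \<in> ?L" for l
    using that LG p_carr[OF star_S[OF that]]
    by (auto simp: q_def extended_star_def bohr_map_mult[OF G])
  define f' where "f' \<eta> = f \<eta> * wb (q \<eta>)" for \<eta>
  define p' where "p' \<eta> = p \<eta> \<otimes>\<^bsub>G\<^esub> gb (q \<eta>)" for \<eta>
  have f'_cont: "continuous_map (gtop ?H) euclidean f'"
    unfolding f'_def
      using continuous_map_complex_mult[OF Cc_D(1)[OF f] continuous_map_compose[OF q wb(1)]]
    by (simp add: o_def)
  have "{\<eta> \<in> carrier ?H. f' \<eta> \<noteq> 0} \<subseteq> {\<eta> \<in> carrier ?H. f \<eta> \<noteq> 0}" by (auto simp: f'_def)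
  from closed_compactin[OF Cc_D(2)[OF f] closure_of_mono[OF this] closedin_closure_of]
  have "f' \<in> Cc ?H"
    using f'_cont Cc_D(3)[OF f] by (simp add: Cc_def f'_def)
  moreover have "continuous_map (gtop ?H) (gtop G) p'"
    unfolding p'_def using continuous_map_compose[OF q gb(1)]
    by (intro continuous_map_product p) (simp add: o_def)
  moreover have "((\<lambda>l. f' (star_map ?\<L> l) * \<phi> (l \<otimes>\<^bsub>G\<^esub> p' (star_map ?\<L> l))) has_sum \<mu> \<phi>) (fst ` ?\<L>)"
    if \<phi>: "\<phi> \<in> Cc G" for \<phi>
  proof -
    have eq: "f (?star l) * modulated G w g \<phi> (l \<otimes>\<^bsub>G\<^esub> p (?star l)) =
        f' (star_map ?\<L> l) * \<phi> (l \<otimes>\<^bsub>G\<^esub> p' (star_map ?\<L> l))" if l: "l \<in> ?L" for l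
    proof -
      have carr: "l \<in> carrier G" "p (?star l) \<in> carrier G" using l LG p_carr[OF star_S[OF l]]
        by auto
      then show ?thesis
        using Cu_D(1)[OF gC, of "l \<otimes>\<^bsub>G\<^esub> p (?star l)"]
        by (simp add: star[OF l] f'_def p'_def q_star[OF l] wb(2) gb(2) modulated_def m_assoc)
    qed
    from sum[OF modulated_in_Cc[OF G wC gC \<phi>]] show ?thesis
      unfolding fstL \<mu>[OF \<phi>] by (rule has_sum_cong[THEN iffD1, rotated]) (rule eq)
  qed
  ultimately show ?thesis
    using radon_measure_modulation[OF G wC gC \<nu> \<mu>] unfolding deformed_weighted_model_set_def
      by blast
qed

end
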